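(* For every $\Lambda_1>0$ there exists $\epsilon_0=\epsilon_0(\Lambda_1)$ with $0<\epsilon_0<\frac{4}{3}\pi$ such that the following holds. Let $g=e^{2u}g_{euc}$ be a smooth metric on the unit disk $D\subset\mathbb{C}$ such that $$\frac{\mu(B_r^{g}(z),g)}{\pi r^2}<\Lambda_1\quad\text{for all } r>0 \text{ and all } z\in D_{3/4},$$ and $$\int_D|K(g)|\,d\mu_{g}\le\epsilon_0 .$$ Then $$\|\nabla u\|_{L^{2,\infty}(D_{1/2})}<C .$$ Moreover, for every $p\in(1,2)$, $$\|u\|_{W^{1,p}(D_{1/2})}\le C\bigl(1+|\log \mu(D_{1/2},g)|\bigr).$$ Here $C$ denotes constants that do not depend on $g$ (they depend only on $\Lambda_1$, $\epsilon_0$ and, in the second estimate, also on $p$).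
   Context: $D_r(x)$ is the open Euclidean disk of radius $r$ centred at $x$ in $\mathbb{C}=\mathbb{R}^2$, $D_r=D_r(0)$, $D=D_1$, and $g_{euc}=dx^2+dy^2$. For a metric $g=e^{2u}g_{euc}$: $K(g)=-e^{-2u}\Delta u$ is the Gauss curvature, $d\mu_g=e^{2u}dx\,dy$ the area measure, $\mu(A,g)=\int_A e^{2u}dx\,dy$ the area of a set $A$, and $B^g_r(z)$ the geodesic ball of radius $r$ about $z$ for the distance of $g$. $L^{2,\infty}$ is the Lorentz (weak-$L^2$) space. *)

theory Defs
  imports "HOL-Analysis.Analysis"
begin

text \<open>A conformal metric \<open>g = e\<^sup>2\<^sup>u g\<^sub>e\<^sub>u\<^sub>c\<close> on an open set \<open>S\<close> of the plane is represented by
  the function \<open>u\<close>, of which only the values on \<open>S\<close> matter.\<close>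

section \<open>Smooth functions and differential operators\<close>

text \<open>Meant for open \<open>S\<close>: all partial derivatives of order at most \<open>k\<close> exist and are continuous;
  as every derivative of order below \<open>k\<close> is required to be totally differentiable, continuity
  need only be demanded at the top order.\<close>

primrec Ck_on :: "nat \<Rightarrow> ('a::euclidean_space \<Rightarrow> real) \<Rightarrow> 'a set \<Rightarrow> bool" where
  "Ck_on 0 f S \<longleftrightarrow> continuous_on S f"
| "Ck_on (Suc k) f S \<longleftrightarrow>
     (\<forall>x\<in>S. f differentiable (at x)) \<and>
     (\<forall>b\<in>Basis. Ck_on k (\<lambda>x. frechet_derivative f (at x) b) S)"

definition smooth_on :: "('a::euclidean_space \<Rightarrow> real) \<Rightarrow> 'a set \<Rightarrow> bool" where
  "smooth_on f S \<longleftrightarrow> (\<forall>k. Ck_on k f S)"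

definition grad :: "('a::euclidean_space \<Rightarrow> real) \<Rightarrow> 'a \<Rightarrow> 'a" where
  "grad f x = (\<Sum>b\<in>Basis. frechet_derivative f (at x) b *\<^sub>R b)"

definition laplacian :: "('a::euclidean_space \<Rightarrow> real) \<Rightarrow> 'a \<Rightarrow> real" where
  "laplacian f x =
     (\<Sum>b\<in>Basis. frechet_derivative (\<lambda>y. frechet_derivative f (at y) b) (at x) b)"

section \<open>Conformal metrics\<close>

definition gauss_curvature :: "(complex \<Rightarrow> real) \<Rightarrow> complex \<Rightarrow> real" where
  "gauss_curvature u z = - exp (- 2 * u z) * laplacian u z"

definition area_measure :: "complex set \<Rightarrow> (complex \<Rightarrow> real) \<Rightarrow> complex measure" where
  "area_measure S u = density lborel (\<lambda>z. ennreal (exp (2 * u z)) * indicator S z)"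

text \<open>Lengths are extended real: a \<^const>\<open>valid_path\<close> may have unbounded speed near its finitely
  many exceptional parameters, hence infinite length. A Henstock--Kurzweil integral would
  give such a path the junk length 0.\<close>

definition curve_length :: "(complex \<Rightarrow> real) \<Rightarrow> (real \<Rightarrow> complex) \<Rightarrow> ennreal" where
  "curve_length u \<gamma> =
     (\<integral>\<^sup>+t\<in>{0..1}. ennreal (exp (u (\<gamma> t)) * norm (vector_derivative \<gamma> (at t))) \<partial>lborel)"

definition geodesic_dist ::
    "complex set \<Rightarrow> (complex \<Rightarrow> real) \<Rightarrow> complex \<Rightarrow> complex \<Rightarrow> ennreal" where
  "geodesic_dist S u z w =
     (INF \<gamma> \<in> {\<gamma>. valid_path \<gamma> \<and> path_image \<gamma> \<subseteq> S \<and> pathstart \<gamma> = z \<and> pathfinish \<gamma> = w}.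
        curve_length u \<gamma>)"

definition geodesic_ball ::
    "complex set \<Rightarrow> (complex \<Rightarrow> real) \<Rightarrow> complex \<Rightarrow> real \<Rightarrow> complex set" where
  "geodesic_ball S u z r = {w\<in>S. geodesic_dist S u z w < ennreal r}"

section \<open>Lorentz and Sobolev norms\<close>

definition ennreal_powr :: "ennreal \<Rightarrow> real \<Rightarrow> ennreal" where
  "ennreal_powr x p = (if x = \<infinity> then \<infinity> else ennreal (enn2real x powr p))"  \<comment> \<open>meant for \<open>p > 0\<close>\<close>

text \<open>The weak-\<open>L\<^sup>p\<close> quasinorm, i.e. the \<open>L\<^sup>p\<^sup>,\<^sup>\<infinity>\<close> quasinorm
  \<open>sup\<^sub>t t\<^sup>1\<^sup>/\<^sup>p f\<^sup>*(t)\<close> expressed through the distribution function.\<close>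

definition weak_Lp_norm ::
    "real \<Rightarrow> 'a::euclidean_space set \<Rightarrow> ('a \<Rightarrow> 'b::real_normed_vector) \<Rightarrow> ennreal" where
  "weak_Lp_norm p A f =
     (SUP s\<in>{0<..}. ennreal s * ennreal_powr (emeasure lborel {x\<in>A. s < norm (f x)}) (1 / p))"

text \<open>Only for functions that are smooth on an open set \<open>A\<close>, where the weak gradient is the
  classical one.\<close>

definition W1p_norm :: "real \<Rightarrow> 'a::euclidean_space set \<Rightarrow> ('a \<Rightarrow> real) \<Rightarrow> ennreal" where
  "W1p_norm p A f =
     ennreal_powr (\<integral>\<^sup>+x\<in>A. ennreal (\<bar>f x\<bar> powr p + norm (grad f x) powr p) \<partial>lborel) (1 / p)"

text \<open>The hypotheses on \<open>g\<close>, with \<open>D = ball 0 1\<close>.\<close>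

definition admissible_metric :: "real \<Rightarrow> real \<Rightarrow> (complex \<Rightarrow> real) \<Rightarrow> bool" where
  "admissible_metric \<Lambda> \<epsilon> u \<longleftrightarrow>
     smooth_on u (ball 0 1) \<and>
     (\<forall>r>0. \<forall>z\<in>ball 0 (3/4).
        emeasure (area_measure (ball 0 1) u) (geodesic_ball (ball 0 1) u z r) / ennreal (pi * r\<^sup>2)
          < ennreal \<Lambda>) \<and>
     (\<integral>\<^sup>+z\<in>ball 0 1. ennreal \<bar>gauss_curvature u z\<bar> \<partial>area_measure (ball 0 1) u) \<le> ennreal \<epsilon>"

end

theory Submission
  imports Defs "HOL-Complex_Analysis.Complex_Analysis"
begin

text \<open>A cutoff in Green's formula writes \<open>u\<close> as the logarithmic potential of a charge of small total mass plus the real part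
  of a holomorphic function \<open>G\<close>. The gradient of the potential is bounded by a Riesz potential and hence lies in weak
  \<open>L\<^sup>2\<close> and in \<open>L\<^sup>p\<close> for \<open>p < 2\<close>, and by Jensen's inequality the potential is exponentially integrable
  around suitable means. It remains to bound \<open>G'\<close>. Were it large, then at a point where \<open>(3/4 - |z|) |G' z|\<close> is
  maximal and on the scale \<open>1 / |G'|\<close>, the metric would look like \<open>e\<^sup>2\<^sup>x g\<^sub>e\<^sub>u\<^sub>c\<close>, whose geodesic
  balls have arbitrarily large area density since detours through \<open>x \<rightarrow> -\<infinity>\<close> are cheap; exponential
  integrability shows that the potential does not destroy this, contradicting the bound on the area density. Finally
  \<open>Re (G 0)\<close> is controlled by the logarithm of the area.\<close>

section \<open>Integrals of powers of the distance\<close>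

text \<open>No pointwise bound on the potential is available, because the charge is controlled only
  in mass and may concentrate anywhere. Every estimate on the potential is therefore an average:
  areas are integrals of its exponential, and single segments, which may be badly placed, give way
  to averages over broken lines. Both need only exponential moments, with the potential measured
  against its mean on a given scale. This dictates the order of the constants. The bound \<Lambda>
  fixes the number N of disks that contradict it; all these disks must be compared with one and the
  same mean, on a scale R = N + 2 times theirs, which costs a factor \<open>R powr (2 * m0)\<close>,
  where m0 bounds the mass. So m0, and with it the curvature bound, is chosen after N. Maximality of
  (3/4 - |z|) |G' z| bounds G' near the chosen point by twice its value there, hence G'' by Cauchy's
  inequality, so that G is affine up to an error 1 on the scale of the whole array of disks. No
  limit of a sequence of metrics is taken, and all constants come from \<Lambda>.\<close>

lemma nn_integral_affine:
  fixes t :: "'a::euclidean_space" and f :: "'a \<Rightarrow> ennreal"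
  assumes [measurable]: "f \<in> borel_measurable borel" and c: "c > 0"
  shows "(\<integral>\<^sup>+x. f (t + c *\<^sub>R x) \<partial>lborel) = ennreal (1 / c ^ DIM('a)) * (\<integral>\<^sup>+x. f x \<partial>lborel)"
proof -
  have c0: "c \<noteq> 0" using c by simp
  have "(\<integral>\<^sup>+x. f x \<partial>lborel) = (\<integral>\<^sup>+x. ennreal (c ^ DIM('a)) * f (t + c *\<^sub>R x) \<partial>lborel)"
    by (subst lborel_affine[OF c0, of t]) (use c in \<open>simp add: nn_integral_density nn_integral_distr\<close>)
  also have "\<dots> = ennreal (c ^ DIM('a)) * (\<integral>\<^sup>+x. f (t + c *\<^sub>R x) \<partial>lborel)"
    by (rule nn_integral_cmult) measurable
  finally show ?thesis
    using c by (simp add: mult.assoc[symmetric] ennreal_mult[symmetric])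
qed

lemma lborel_integral_shift:
  fixes f :: "'a::euclidean_space \<Rightarrow> real"
  assumes [measurable]: "f \<in> borel_measurable borel"
  shows "(\<integral>x. f (a + x) \<partial>lborel) = (\<integral>x. f x \<partial>lborel)"
proof -
  have "(\<integral>x. f x \<partial>lborel) = (\<integral>x. f x \<partial>distr lborel borel ((+) a))"
    by (simp add: lborel_distr_plus)
  also have "\<dots> = (\<integral>x. f (a + x) \<partial>lborel)"
    by (rule integral_distr) auto
  finally show ?thesis by simp
qed

lemma ball_measurable [measurable]: "ball x r \<in> sets borel"
  by simp

lemma emeasure_ball_complex:
  assumes "r \<ge> 0"
  shows "emeasure lborel (ball (x::complex) r) = ennreal (pi * r\<^sup>2)"
  using emeasure_ball[OF assms, of x] by (simp add: unit_ball_vol_2 power2_eq_square)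

lemma ennreal_le_suminf: "f k \<le> (\<Sum>k. f k :: ennreal)"
  using sum_le_suminf[of f "{k}"] by simp

lemma dyadic_exists:
  assumes "0 < x" "x < (1::real)"
  shows "\<exists>k::nat. (1/2) ^ Suc k \<le> x \<and> x < (1/2) ^ k"
proof -
  obtain n where n: "(1/2::real) ^ n < x"
    using real_arch_pow_inv[of x "1/2"] assms by auto
  define m where "m = (LEAST n. (1/2::real) ^ n \<le> x)"
  have m: "(1/2::real) ^ m \<le> x"
    unfolding m_def by (rule LeastI[of _ n]) (use n in simp)
  then have "m \<noteq> 0" using assms by (intro notI) auto
  then obtain k where k: "m = Suc k" using not0_implies_Suc by blast
  have "\<not> (1/2::real) ^ k \<le> x"
    unfolding k using not_less_Least[of k "\<lambda>n. (1/2::real) ^ n \<le> x"] k m_def by auto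
  then show ?thesis using m k by auto
qed

text \<open>On the shell where |x| lies between 2^-(k+1) and 2^-k the integrand is at most its value
  on the inner circle. Extending this bound to the whole disk of radius 2^-k leaves a geometric
  series of ratio \<open>q = 2 powr (a - 2)\<close>, which converges since a < 2.\<close>

lemma nn_integral_norm_powr_unit_ball:
  assumes "0 \<le> a" "a < 2"
  shows "(\<integral>\<^sup>+x\<in>ball (0::complex) 1. ennreal (norm x powr (-a)) \<partial>lborel) < \<infinity>"
proof -
  define q where "q = 2 powr (a - 2)"
  have q: "0 \<le> q" "q < 1" using assms powr_less_mono[of "a-2" 0 2] by (auto simp: q_def)
  have le: "ennreal (norm x powr (-a)) * indicator (ball 0 1) x \<le>
      (\<Sum>k. ennreal (((1/2) ^ Suc k) powr (-a)) * indicator (ball 0 ((1/2)^k)) x)" for x :: complex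
  proof (cases "x \<noteq> 0 \<and> norm x < 1")
    case True
    then obtain k where k: "(1/2) ^ Suc k \<le> norm x" "norm x < (1/2) ^ k"
      using dyadic_exists[of "norm x"] by auto
    have "ennreal (norm x powr (-a)) * indicator (ball 0 1) x \<le>
       ennreal (((1/2) ^ Suc k) powr (-a)) * indicator (ball 0 ((1/2)^k)) x"
      using True k assms by (auto intro!: ennreal_leI powr_mono2')
    also have "\<dots> \<le> (\<Sum>k. ennreal (((1/2) ^ Suc k) powr (-a)) * indicator (ball 0 ((1/2)^k)) x)"
      by (rule ennreal_le_suminf[of "\<lambda>k. ennreal (((1/2) ^ Suc k) powr (-a)) * indicator (ball 0 ((1/2)^k)) x"])
    finally show ?thesis .
  qed auto
  have "(\<integral>\<^sup>+x\<in>ball (0::complex) 1. ennreal (norm x powr (-a)) \<partial>lborel)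
     \<le> (\<integral>\<^sup>+x. (\<Sum>k. ennreal (((1/2) ^ Suc k) powr (-a)) * indicator (ball (0::complex) ((1/2)^k)) x) \<partial>lborel)"
    by (rule nn_integral_mono) (rule le)
  also have "\<dots> = (\<Sum>k. (\<integral>\<^sup>+x. ennreal (((1/2) ^ Suc k) powr (-a)) * indicator (ball (0::complex) ((1/2)^k)) x \<partial>lborel))"
    by (rule nn_integral_suminf) auto
  also have "\<dots> = (\<Sum>k. ennreal (2 powr a * pi * q ^ k))"
  proof (rule suminf_cong)
    fix k
    have "((1/2::real) ^ Suc k) powr (-a) * (pi * ((1/2)^k)\<^sup>2) = 2 powr a * pi * q ^ k"
    proof -
      have p: "(1/2::real) ^ n = 2 powr (- real n)" for n
        by (simp add: powr_minus powr_realpow power_divide field_simps)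
      have "q ^ k = 2 powr ((a - 2) * k)" 
        by (simp add: q_def powr_powr powr_realpow[symmetric])
      moreover have "((1/2::real)^k)\<^sup>2 = 2 powr (- 2 * k)"
        unfolding p by (simp add: power2_eq_square flip: powr_add)
      ultimately show ?thesis
        unfolding p by (simp add: powr_powr powr_add[symmetric] algebra_simps)
    qed
    then show "(\<integral>\<^sup>+x. ennreal (((1/2) ^ Suc k) powr (-a)) * indicator (ball (0::complex) ((1/2)^k)) x \<partial>lborel) = ennreal (2 powr a * pi * q ^ k)"
      by (subst nn_integral_cmult_indicator)
        (simp_all only: ball_measurable sets_lborel emeasure_ball_complex ennreal_mult[symmetric]
          zero_le_power zero_le_divide_1_iff zero_le_numeral powr_ge_zero zero_le_mult_iff pi_ge_zero zero_le_power2 simp_thms)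
  qed
  also have "\<dots> < \<infinity>"
    using q by (subst suminf_ennreal2) (auto intro!: summable_mult summable_geometric)
  finally show ?thesis .
qed

text \<open>For 0 <= a < 2 the integral is finite, so that \<open>enn2real\<close> loses nothing;
  its value is then 2 \<pi> / (2 - a).\<close>

definition riesz_const :: "real \<Rightarrow> real" where
  "riesz_const a = enn2real (\<integral>\<^sup>+x\<in>ball (0::complex) 1. ennreal (norm x powr (-a)) \<partial>lborel)"

lemma riesz_const_nonneg [simp]: "0 \<le> riesz_const a"
  by (simp add: riesz_const_def)

text \<open>Homogeneity: the substitution x = w + r y contributes r^2 from the area and r^-a from
  the integrand.\<close>

lemma nn_integral_norm_powr_ball:
  assumes a: "0 \<le> a" "a < 2" and r: "r > 0"
  shows "(\<integral>\<^sup>+x\<in>ball (w::complex) r. ennreal (norm (x - w) powr (-a)) \<partial>lborel)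
           = ennreal (riesz_const a * r powr (2 - a))"
proof -
  let ?f = "\<lambda>x. ennreal (norm (x - w) powr (-a)) * indicator (ball w r) x"
  have "ennreal (1 / r\<^sup>2) * (\<integral>\<^sup>+x. ?f x \<partial>lborel) = (\<integral>\<^sup>+x. ?f (w + r *\<^sub>R x) \<partial>lborel)"
    by (subst nn_integral_affine) (use r in auto)
  also have "\<dots> = (\<integral>\<^sup>+x. ennreal (r powr (-a)) * (ennreal (norm x powr (-a)) * indicator (ball (0::complex) 1) x) \<partial>lborel)"
    using r by (intro nn_integral_cong)
      (auto simp: indicator_def dist_norm norm_mult powr_mult ennreal_mult[symmetric])
  also have "\<dots> = ennreal (r powr (-a)) * (\<integral>\<^sup>+x. ennreal (norm x powr (-a)) * indicator (ball (0::complex) 1) x \<partial>lborel)"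
    by (rule nn_integral_cmult) auto
  also have "\<dots> = ennreal (r powr (-a)) * ennreal (riesz_const a)"
    using nn_integral_norm_powr_unit_ball[OF a] by (simp add: riesz_const_def)
  finally have *: "ennreal (1 / r\<^sup>2) * (\<integral>\<^sup>+x. ?f x \<partial>lborel) = ennreal (r powr (-a) * riesz_const a)"
    by (simp add: ennreal_mult)
  have "(\<integral>\<^sup>+x. ?f x \<partial>lborel) = ennreal (r\<^sup>2) * (ennreal (1 / r\<^sup>2) * (\<integral>\<^sup>+x. ?f x \<partial>lborel))"
    using r by (simp add: mult.assoc[symmetric] ennreal_mult[symmetric])
  also have "\<dots> = ennreal (riesz_const a * r powr (2 - a))"
    using r unfolding * by (simp add: ennreal_mult[symmetric] powr_diff powr_minus field_simps)
  finally show ?thesis .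
qed

text \<open>Split the set at distance \<open>r\<close> from \<open>w\<close>.\<close>

lemma nn_integral_norm_powr_le:
  assumes a: "0 \<le> a" "a < 2" and r: "r > 0" and A [measurable]: "A \<in> sets borel"
    and m: "emeasure lborel A \<le> ennreal m"
  shows "(\<integral>\<^sup>+x\<in>A. ennreal (norm (x - (w::complex)) powr (-a)) \<partial>lborel)
           \<le> ennreal (riesz_const a * r powr (2 - a)) + ennreal (r powr (-a)) * ennreal m"
proof -
  have "(\<integral>\<^sup>+x\<in>A. ennreal (norm (x - w) powr (-a)) \<partial>lborel)
     \<le> (\<integral>\<^sup>+x. ennreal (norm (x - w) powr (-a)) * indicator (ball w r) x + ennreal (r powr (-a)) * indicator A x \<partial>lborel)"
  proof (intro nn_integral_mono)
    fix x
    show "ennreal (norm (x - w) powr (-a)) * indicator A x \<le> ennreal (norm (x - w) powr (-a)) * indicator (ball w r) x + ennreal (r powr (-a)) * indicator A x"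
      using r a by (cases "x \<in> ball w r"; cases "x \<in> A")
        (auto simp: dist_norm norm_minus_commute intro!: ennreal_leI powr_mono2')
  qed
  also have "\<dots> = ennreal (riesz_const a * r powr (2 - a)) + ennreal (r powr (-a)) * emeasure lborel A"
    by (subst nn_integral_add) (auto simp: nn_integral_norm_powr_ball a r nn_integral_cmult_indicator)
  also have "\<dots> \<le> ennreal (riesz_const a * r powr (2 - a)) + ennreal (r powr (-a)) * ennreal m"
    by (intro add_mono mult_left_mono m) auto
  finally show ?thesis .
qed

text \<open>The disk and the pole \<open>w\<close> are unrelated, so the bound is uniform in the
  pole; such a bound survives averaging over a charge. The splitting distance is the radius of the
  disk.\<close>

lemma nn_integral_norm_powr_ball_le:
  assumes a: "0 \<le> a" "a < 2" and r: "r > 0"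
  shows "(\<integral>\<^sup>+x\<in>ball q r. ennreal (norm (x - (w::complex)) powr (-a)) \<partial>lborel)
           \<le> ennreal ((riesz_const a + pi) * r powr (2 - a))"
proof -
  have "(\<integral>\<^sup>+x\<in>ball q r. ennreal (norm (x - (w::complex)) powr (-a)) \<partial>lborel) \<le> 
     ennreal (riesz_const a * r powr (2 - a)) + ennreal (r powr (-a)) * ennreal (pi * r\<^sup>2)"
    by (rule nn_integral_norm_powr_le) (use a r in \<open>auto simp: emeasure_ball_complex\<close>)
  also have "\<dots> = ennreal ((riesz_const a + pi) * r powr (2 - a))"
    using r by (simp add: ennreal_mult[symmetric] ennreal_plus[symmetric] powr_diff powr_minus field_simps del: ennreal_plus)
  finally show ?thesis .
qed

section \<open>The approximate identity behind the regularised logarithm\<close>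

text \<open>A point with |x| >= 1 is charged to the disk of radius 2^m with m minimal; then 2^(m-1)
  <= |x| bounds the density by 2 / 16^(m-1) = 32 / 16^m. Against the areas \<pi> 4^m this gives a
  geometric series of ratio 1/4.\<close>

lemma cauchy_density_integrable:
  "integrable lborel (\<lambda>x::complex. 2 / (1 + (norm x)\<^sup>2)\<^sup>2)"
proof (rule integrableI_nonneg)
  have le: "ennreal (2 / (1 + (norm x)\<^sup>2)\<^sup>2) \<le>
      (\<Sum>k. ennreal (32 * (1/16) ^ k) * indicator (ball 0 (2^k)) x)" for x :: complex
  proof -
    have "\<exists>k::nat. norm x < 2 ^ k \<and> 2 / (1 + (norm x)\<^sup>2)\<^sup>2 \<le> 32 * (1/16) ^ k"
    proof (cases "norm x < 1")
      case True
      have "1 \<le> (1 + (norm x)\<^sup>2)\<^sup>2" by (simp add: one_le_power)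
      then have "2 / (1 + (norm x)\<^sup>2)\<^sup>2 \<le> 2" by (simp add: divide_le_eq)
      then show ?thesis using True by (intro exI[of _ 0]) simp
    next
      case False
      define m where "m = (LEAST n. norm x < 2 ^ n)"
      obtain n where n: "norm x < 2 ^ n" using real_arch_pow[of 2 "norm x"] by auto
      have m: "norm x < 2 ^ m"
        unfolding m_def by (rule LeastI[of _ n]) (use n in simp)
      then have "m \<noteq> 0" using False by (intro notI) auto
      then obtain k where k: "m = Suc k" using not0_implies_Suc by blast
      have "\<not> norm x < 2 ^ k"
        unfolding k using not_less_Least[of k "\<lambda>n. norm x < 2 ^ n"] k m_def by auto
      then have "(2^k) * (2^k) \<le> norm x * norm x" by (intro mult_mono) auto
      then have "4^k \<le> 1 + (norm x)\<^sup>2"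
        by (simp add: power2_eq_square flip: power_mult_distrib)
      then have "4^k * 4^k \<le> (1 + (norm x)\<^sup>2) * (1 + (norm x)\<^sup>2)"
        by (intro mult_mono) auto
      then have "16^k \<le> (1 + (norm x)\<^sup>2)\<^sup>2"
        by (simp add: power2_eq_square[of "1 + _"] flip: power_mult_distrib)
      then have "2 / (1 + (norm x)\<^sup>2)\<^sup>2 \<le> 2 / 16^k"
        by (rule frac_le[OF _ order_refl, rotated 2]) simp_all
      also have "\<dots> = 32 * (1/16) ^ Suc k" by (simp add: power_divide)
      finally show ?thesis using m k by blast
    qed
    then obtain k::nat where k: "norm x < 2 ^ k" "2 / (1 + (norm x)\<^sup>2)\<^sup>2 \<le> 32 * (1/16) ^ k" by auto
    have "ennreal (2 / (1 + (norm x)\<^sup>2)\<^sup>2) \<le> ennreal (32 * (1/16) ^ k) * indicator (ball 0 (2^k)) x"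
      using k by (simp add: ennreal_leI)
    also have "\<dots> \<le> (\<Sum>k. ennreal (32 * (1/16) ^ k) * indicator (ball 0 (2^k)) x)"
      by (rule ennreal_le_suminf[of "\<lambda>k. ennreal (32 * (1/16) ^ k) * indicator (ball 0 (2^k)) x"])
    finally show ?thesis .
  qed
  have "(\<integral>\<^sup>+x. ennreal (2 / (1 + (norm (x::complex))\<^sup>2)\<^sup>2) \<partial>lborel)
     \<le> (\<integral>\<^sup>+x. (\<Sum>k. ennreal (32 * (1/16) ^ k) * indicator (ball (0::complex) (2^k)) x) \<partial>lborel)"
    by (rule nn_integral_mono) (rule le)
  also have "\<dots> = (\<Sum>k. (\<integral>\<^sup>+x. ennreal (32 * (1/16) ^ k) * indicator (ball (0::complex) (2^k)) x \<partial>lborel))"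
    by (rule nn_integral_suminf) auto
  also have "\<dots> = (\<Sum>k. ennreal (32 * pi * (1/4) ^ k))"
  proof (rule suminf_cong)
    fix k
    have "((2::real)^k)\<^sup>2 = 4 ^ k"
      by (simp add: power2_eq_square flip: power_mult_distrib)
    then have "32 * (1/16) ^ k * (pi * (2^k)\<^sup>2) = 32 * pi * ((1/16) ^ k * 4 ^ k)"
      by simp
    also have "(1/16::real) ^ k * 4 ^ k = (1/4) ^ k"
      by (simp flip: power_mult_distrib)
    finally show "(\<integral>\<^sup>+x. ennreal (32 * (1/16) ^ k) * indicator (ball (0::complex) (2^k)) x \<partial>lborel)
        = ennreal (32 * pi * (1/4) ^ k)"
      by (subst nn_integral_cmult_indicator) (auto simp: emeasure_ball_complex simp flip: ennreal_mult)
  qed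
  also have "\<dots> < \<infinity>"
    by (subst suminf_ennreal2) (auto intro!: summable_mult summable_geometric)
  finally show "(\<integral>\<^sup>+x. ennreal (2 / (1 + (norm (x::complex))\<^sup>2)\<^sup>2) \<partial>lborel) < \<infinity>" .
qed auto

text \<open>The integrand is the Laplacian of ln (1 + |x|^2) / 2, the regularised logarithm with
  parameter d = 1; rescaled, it becomes an approximate identity of this total mass.\<close>

definition cauchy_mass :: real where
  "cauchy_mass = integral\<^sup>L lborel (\<lambda>x::complex. 2 / (1 + (norm x)\<^sup>2)\<^sup>2)"

lemma cauchy_mass_pos: "cauchy_mass > 0"
proof -
  have "cauchy_mass \<noteq> 0"
  proof
    assume "cauchy_mass = 0"
    then have "AE x in lborel. 2 / (1 + (norm (x::complex))\<^sup>2)\<^sup>2 = 0"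
      using integral_nonneg_eq_0_iff_AE[OF cauchy_density_integrable] by (auto simp: cauchy_mass_def)
    moreover have "2 / (1 + (norm (x::complex))\<^sup>2)\<^sup>2 \<noteq> 0" for x
      by (simp add: add_nonneg_eq_0_iff)
    ultimately have "AE x::complex in lborel. False" by simp
    then show False
      by (simp add: eventually_False ae_filter_eq_bot_iff)
  qed
  moreover have "cauchy_mass \<ge> 0" unfolding cauchy_mass_def by (rule integral_nonneg_AE) auto
  ultimately show ?thesis by simp
qed

section \<open>The logarithmic potential representation\<close>

lemma integrable_continuous_compact_support:
  fixes f :: "'a::euclidean_space \<Rightarrow> 'b::euclidean_space"
  assumes "continuous_on UNIV f" "\<And>x. norm x \<ge> 1 \<Longrightarrow> f x = 0"
  shows "integrable lborel f"
proof -
  have "integrable lborel (\<lambda>x. indicator (cball 0 1) x *\<^sub>R f x)"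
    by (rule borel_integrable_compact) (auto intro: continuous_on_subset[OF assms(1)])
  moreover have "(\<lambda>x. indicator (cball 0 1) x *\<^sub>R f x) = f"
    by (rule ext) (auto simp: indicator_def assms(2))
  ultimately show ?thesis by simp
qed

lemma bounded_continuous_compact_support:
  fixes f :: "'a::euclidean_space \<Rightarrow> 'b::real_normed_vector"
  assumes "continuous_on UNIV f" "\<And>x. norm x \<ge> 1 \<Longrightarrow> f x = 0"
  obtains B where "B > 0" "\<And>x. norm (f x) \<le> B"
proof -
  have "bounded (f ` cball 0 1)"
    by (intro compact_imp_bounded compact_continuous_image continuous_on_subset[OF assms(1)]) auto
  then obtain B where B: "B > 0" "\<And>x. x \<in> cball 0 1 \<Longrightarrow> norm (f x) \<le> B"
    unfolding bounded_pos by auto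
  have "norm (f x) \<le> B" for x
    using B assms(2)[of x] by (cases "norm x \<ge> 1") auto
  with B that show ?thesis by blast
qed

text \<open>By translation invariance, the difference quotients have integral zero.\<close>

lemma integral_directional_derivative_eq_0:
  fixes g g' :: "complex \<Rightarrow> real"
  assumes D: "\<And>x. ((\<lambda>t. g (x + t *\<^sub>R b)) has_real_derivative g' x) (at 0)"
    and g: "continuous_on UNIV g" and g': "continuous_on UNIV g'"
    and supp: "\<And>x. norm x \<ge> 1 \<Longrightarrow> g x = 0" and b: "norm b = 1"
  shows "(\<integral>x. g' x \<partial>lborel) = 0"
proof -
  have [measurable]: "g \<in> borel_measurable borel" "g' \<in> borel_measurable borel"
    using g g' by (auto intro: borel_measurable_continuous_onI)
  define h where "h n = 1 / real (Suc n)" for n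
  have h: "0 < h n" "h n \<le> 1" for n by (auto simp: h_def)
  have h0: "h \<longlonglongrightarrow> 0" unfolding h_def by (rule LIMSEQ_Suc[OF lim_1_over_n])
  define s where "s n x = (g (x + h n *\<^sub>R b) - g x) / h n" for n x
  have [measurable]: "s n \<in> borel_measurable borel" for n
    unfolding s_def[abs_def] by measurable
  have Dt: "((\<lambda>t. g (x + t *\<^sub>R b)) has_real_derivative g' (x + t *\<^sub>R b)) (at t)" for x t
  proof -
    have "((\<lambda>r. g ((x + t *\<^sub>R b) + (r + (- t)) *\<^sub>R b)) has_real_derivative g' (x + t *\<^sub>R b)) (at t)"
      using D[of "x + t *\<^sub>R b"] DERIV_shift[of "\<lambda>r. g ((x + t *\<^sub>R b) + r *\<^sub>R b)" _ t "- t"] by simp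
    moreover have "(x + t *\<^sub>R b) + (r + (- t)) *\<^sub>R b = x + r *\<^sub>R b" for r
      by (simp add: algebra_simps)
    ultimately show ?thesis by (simp only:)
  qed
  have "bounded (g' ` cball 0 3)"
    by (intro compact_imp_bounded compact_continuous_image continuous_on_subset[OF g']) auto
  then obtain B where B: "B > 0" "\<And>x. x \<in> cball 0 3 \<Longrightarrow> norm (g' x) \<le> B"
    unfolding bounded_pos by auto
  \<comment> \<open>Domination: for |x| <= 2 the mean value theorem turns the quotient into a value
    of \<open>g'\<close> within distance 3 of the origin, as the step is at most 1; for |x| > 2 both
    values of \<open>g\<close> vanish.\<close>
  have s_bound: "norm (s n x) \<le> B * indicator (cball 0 2) x" for n x
  proof (cases "norm x \<le> 2")
    case True
    obtain t where t: "t > 0" "t < h n" "g (x + h n *\<^sub>R b) - g (x + 0 *\<^sub>R b) = (h n - 0) * g' (x + t *\<^sub>R b)"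
      using MVT2[of 0 "h n" "\<lambda>t. g (x + t *\<^sub>R b)" "\<lambda>t. g' (x + t *\<^sub>R b)"] Dt h by blast
    have "norm (x + t *\<^sub>R b) \<le> 2 + 1"
      using True t h(2)[of n] b by (intro norm_triangle_mono) auto
    then have "norm (g' (x + t *\<^sub>R b)) \<le> B" by (intro B(2)) simp
    moreover have "s n x = g' (x + t *\<^sub>R b)" using t(3) h(1)[of n] by (simp add: s_def)
    ultimately show ?thesis using True by simp
  next
    case False
    have "norm x \<le> norm (x + h n *\<^sub>R b) + norm (h n *\<^sub>R b)"
      by (metis norm_triangle_ineq4 add_diff_cancel)
    then have "norm (x + h n *\<^sub>R b) \<ge> 1" using False h[of n] b by simp
    then show ?thesis using False supp by (simp add: s_def)
  qed
  have "(\<lambda>n. integral\<^sup>L lborel (s n)) \<longlonglongrightarrow> (\<integral>x. g' x \<partial>lborel)"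
  proof (rule integral_dominated_convergence[where w="\<lambda>x. B * indicator (cball 0 2) x"])
    show "integrable lborel (\<lambda>x::complex. B * indicator (cball 0 2) x)"
      by (intro integrable_mult_right) (auto simp: emeasure_cball intro!: integrable_real_indicator)
    show "AE x in lborel. (\<lambda>n. s n x) \<longlonglongrightarrow> g' x"
    proof (rule AE_I2)
      fix x
      have "((\<lambda>t. (g (x + t *\<^sub>R b) - g x) / t) \<longlongrightarrow> g' x) (at 0)"
        using D[of x] by (simp add: DERIV_def)
      then show "(\<lambda>n. s n x) \<longlonglongrightarrow> g' x"
        unfolding s_def by (rule filterlim_compose) (use h h0 in \<open>auto simp: filterlim_at order_less_imp_not_eq2\<close>)
    qed
  qed (use s_bound in auto)
  moreover have "integral\<^sup>L lborel (s n) = 0" for n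
  proof -
    have i: "integrable lborel g" by (rule integrable_continuous_compact_support[OF g supp])
    have "integrable (distr lborel borel ((+) (h n *\<^sub>R b))) g" by (simp add: lborel_distr_plus i)
    then have i': "integrable lborel (\<lambda>x. g (x + h n *\<^sub>R b))"
      by (subst (asm) integrable_distr_eq) (auto simp: add.commute)
    have "integral\<^sup>L lborel (s n) = ((\<integral>x. g (x + h n *\<^sub>R b) \<partial>lborel) - (\<integral>x. g x \<partial>lborel)) / h n"
      unfolding s_def by (subst integral_divide_zero) (simp add: Bochner_Integration.integral_diff[OF i' i])
    also have "(\<integral>x. g (x + h n *\<^sub>R b) \<partial>lborel) = (\<integral>x. g x \<partial>lborel)"
      using lborel_integral_shift[of g "h n *\<^sub>R b"] by (simp add: add.commute)
    finally show ?thesis by simp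
  qed
  ultimately show ?thesis by (simp add: LIMSEQ_const_iff)
qed

section \<open>Cutoffs and directional derivatives\<close>

text \<open>The quotient m(b - t) / (m(b - t) + m(t - a)) with m(t) = max(0, t)^2; as a < b, the two
  summands never vanish together. The result is C^1, which suits Green's formula below, where a
  single derivative falls on the cutoff.\<close>

lemma smooth_step_exists:
  fixes a b :: real
  assumes "a < b"
  obtains q q' :: "real \<Rightarrow> real" where
    "\<And>t. (q has_real_derivative q' t) (at t)" "continuous_on UNIV q'"
    "\<And>t. t \<le> a \<Longrightarrow> q t = 1" "\<And>t. b \<le> t \<Longrightarrow> q t = 0" "\<And>t. 0 \<le> q t \<and> q t \<le> 1"
    "\<And>t. t \<le> a \<Longrightarrow> q' t = 0" "\<And>t. b \<le> t \<Longrightarrow> q' t = 0"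
proof -
  define m where "m t = (max 0 t)\<^sup>2" for t :: real
  have m: "(m has_real_derivative 2 * max 0 t) (at t)" for t
  proof -
    consider "t > 0" | "t < 0" | "t = 0" by linarith
    then show ?thesis
    proof cases
      case 1
      have "((\<lambda>t. t\<^sup>2) has_real_derivative 2 * max 0 t) (at t)"
        using 1 by (auto intro!: derivative_eq_intros)
      then show ?thesis
        by (rule has_field_derivative_transform_within_open[of _ _ _ "{0<..}"]) (use 1 in \<open>auto simp: m_def\<close>)
    next
      case 2
      have "((\<lambda>t. 0) has_real_derivative 2 * max 0 t) (at t)"
        using 2 by (auto intro!: derivative_eq_intros)
      then show ?thesis
        by (rule has_field_derivative_transform_within_open[of _ _ _ "{..<0}"]) (use 2 in \<open>auto simp: m_def\<close>)
    next
      case 3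
      have "((\<lambda>h. (m (0 + h) - m 0) / h) \<longlongrightarrow> 0) (at 0)"
      proof (rule Lim_null_comparison)
        show "\<forall>\<^sub>F h in at 0. norm ((m (0 + h) - m 0) / h) \<le> \<bar>h\<bar>"
          by (intro always_eventually) (auto simp: m_def max_def power2_eq_square)
        show "((\<lambda>h. \<bar>h\<bar>) \<longlongrightarrow> 0) (at (0::real))"
          by (rule tendsto_rabs_zero) (rule tendsto_ident_at)
      qed
      then show ?thesis using 3 by (simp add: DERIV_def)
    qed
  qed
  have bt: "((\<lambda>t. b - t) has_real_derivative - 1) (at t)" and ta: "((\<lambda>t. t - a) has_real_derivative 1) (at t)" for t
    by (auto intro!: derivative_eq_intros)
  define S where "S t = m (b - t) + m (t - a)" for t
  have S: "S t > 0" for t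
  proof (cases "t < b")
    case True
    then show ?thesis by (auto simp: S_def m_def intro!: add_pos_nonneg)
  next
    case False
    then show ?thesis using assms by (auto simp: S_def m_def intro!: add_nonneg_pos)
  qed
  define q where "q t = m (b - t) / S t" for t
  define q' where "q' t = ((- 2 * max 0 (b - t)) * S t - m (b - t) * (2 * max 0 (t - a) - 2 * max 0 (b - t))) / (S t * S t)" for t
  have mb: "((\<lambda>t. m (b - t)) has_real_derivative - 2 * max 0 (b - t)) (at t)" for t
    using DERIV_chain2[where f=m and g="\<lambda>t. b - t" and s=UNIV and x=t and Db="- 1", OF m bt] by simp
  have ma: "((\<lambda>t. m (t - a)) has_real_derivative 2 * max 0 (t - a)) (at t)" for t
    using DERIV_chain2[where f=m and g="\<lambda>t. t - a" and s=UNIV and x=t and Db=1, OF m ta] by simp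
  have DS: "(S has_real_derivative (2 * max 0 (t - a) - 2 * max 0 (b - t))) (at t)" for t
    unfolding S_def using DERIV_add[OF mb ma, of t] by (simp add: algebra_simps)
  have cS: "continuous_on UNIV S" "continuous_on UNIV (\<lambda>t. m (b - t))"
    by (rule DERIV_continuous_on[OF DS], rule DERIV_continuous_on[OF mb])
  show ?thesis
  proof (rule that[of q q'])
    show "(q has_real_derivative q' t) (at t)" for t
      unfolding q_def q'_def using S[of t] by (intro DERIV_divide mb DS) auto
    show "continuous_on UNIV q'"
      unfolding q'_def using S by (intro continuous_intros cS) (auto simp: order_less_imp_not_eq2)
    show "q t = 1" if "t \<le> a" for t
      using that S[of t] by (auto simp: q_def S_def m_def)
    show "q t = 0" if "b \<le> t" for t
      using that by (auto simp: q_def m_def)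
    show "0 \<le> q t \<and> q t \<le> 1" for t
      using S[of t] by (auto simp: q_def S_def m_def divide_le_eq)
    show "q' t = 0" if "t \<le> a" for t
      using that by (auto simp: q'_def S_def m_def algebra_simps)
    show "q' t = 0" if "b \<le> t" for t
      using that by (auto simp: q'_def m_def)
  qed
qed

lemma has_directional_derivative:
  fixes f :: "'a::real_normed_vector \<Rightarrow> real"
  assumes "f differentiable (at x)"
  shows "((\<lambda>t. f (x + t *\<^sub>R b)) has_real_derivative frechet_derivative f (at x) b) (at 0)"
proof -
  have D: "(f has_derivative frechet_derivative f (at x)) (at x)"
    using assms by (simp add: frechet_derivative_works)
  then interpret bounded_linear "frechet_derivative f (at x)" by (rule has_derivative_bounded_linear)
  have "((\<lambda>t::real. x + t *\<^sub>R b) has_derivative (\<lambda>t. t *\<^sub>R b)) (at 0)"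
    by (auto intro!: derivative_eq_intros)
  then have "((\<lambda>t. f (x + t *\<^sub>R b)) has_derivative (\<lambda>t. frechet_derivative f (at x) (t *\<^sub>R b))) (at 0)"
    by (rule has_derivative_compose) (use D in simp)
  then show ?thesis
    by (simp add: has_field_derivative_def scaleR mult.commute[of _ "frechet_derivative f (at x) b"])
qed

lemma norm_power2_directional_derivative:
  fixes y b :: "'a::real_inner"
  shows "((\<lambda>t. (norm (y + t *\<^sub>R b))\<^sup>2) has_real_derivative 2 * (y \<bullet> b)) (at 0)"
  unfolding power2_norm_eq_inner
  by (auto intro!: derivative_eq_intros simp: inner_commute has_field_derivative_def algebra_simps)

section \<open>Limits of the regularised kernels\<close>

lemma integrable_inverse_norm:
  "integrable lborel (\<lambda>x. indicator (ball q r) x * (1 / norm (x - z :: complex)))"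
proof (cases "r > 0")
  case True
  show ?thesis
  proof (rule integrableI_nonneg)
    have "(\<integral>\<^sup>+x. ennreal (indicator (ball q r) x * (1 / norm (x - z))) \<partial>lborel)
       = (\<integral>\<^sup>+x\<in>ball q r. ennreal (norm (x - z) powr (-1)) \<partial>lborel)"
      by (intro nn_integral_cong) (auto simp: indicator_def powr_minus_divide)
    also have "\<dots> \<le> ennreal ((riesz_const 1 + pi) * r powr (2 - 1))"
      by (rule nn_integral_norm_powr_ball_le) (use True in auto)
    also have "\<dots> < \<infinity>" by simp
    finally show "(\<integral>\<^sup>+x. ennreal (indicator (ball q r) x * (1 / norm (x - z))) \<partial>lborel) < \<infinity>" .
  qed auto
qed (simp add: not_less ball_empty)

text \<open>Serves both kernels of Green's formula, the logarithm and its gradient: 1 / |x - z| is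
  locally integrable in the plane and controls the singularity of either; the summand 2 takes care
  of the logarithm away from its pole. The pole itself is a null set.\<close>

lemma integral_limit_inverse_norm_dominated:
  fixes a :: "complex \<Rightarrow> real"
  assumes a: "continuous_on UNIV a" "\<And>x. norm x \<ge> 1 \<Longrightarrow> a x = 0"
    and [measurable]: "\<And>n. k n \<in> borel_measurable borel" "l \<in> borel_measurable borel"
    and lim: "\<And>x. x \<noteq> z \<Longrightarrow> (\<lambda>n. k n x) \<longlonglongrightarrow> l x"
    and bd: "\<And>n x. x \<noteq> z \<Longrightarrow> norm x < 1 \<Longrightarrow> \<bar>k n x\<bar> \<le> 2 + 1 / norm (x - z)"
  shows "(\<lambda>n. \<integral>x. a x * k n x \<partial>lborel) \<longlonglongrightarrow> (\<integral>x. a x * l x \<partial>lborel)"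
proof -
  have [measurable]: "a \<in> borel_measurable borel" using a(1) by (rule borel_measurable_continuous_onI)
  obtain B where B: "B > 0" "\<And>x. norm (a x) \<le> B"
    using bounded_continuous_compact_support[OF a] by blast
  have AE: "AE x in lborel. x \<noteq> z" by (rule AE_lborel_singleton)
  show ?thesis
  proof (rule integral_dominated_convergence[where w="\<lambda>x. B * (2 * indicator (ball 0 1) x + indicator (ball 0 1) x * (1 / norm (x - z)))"])
    show "integrable lborel (\<lambda>x. B * (2 * indicator (ball 0 1) x + indicator (ball 0 1) x * (1 / norm (x - z))))"
      by (intro integrable_mult_right Bochner_Integration.integrable_add integrable_inverse_norm)
         (auto simp: emeasure_ball intro!: integrable_real_indicator)
    show "AE x in lborel. (\<lambda>n. a x * k n x) \<longlonglongrightarrow> a x * l x"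
      using AE by eventually_elim (intro tendsto_intros lim)
    show "AE x in lborel. norm (a x * k n x) \<le> B * (2 * indicator (ball 0 1) x + indicator (ball 0 1) x * (1 / norm (x - z)))" for n
      using AE
    proof eventually_elim
      case (elim x)
      show ?case
      proof (cases "norm x < 1")
        case True
        then show ?thesis
          using mult_mono[OF B(2)[of x] bd[OF elim True, of n]] B by (simp add: abs_mult)
      qed (use a(2)[of x] B in simp)
    qed
  qed measurable
qed

text \<open>Upper bound from ln t <= t - 1 with t <= 5; lower bound by dropping d and applying the
  same inequality to 1 / r.\<close>

lemma abs_log_regularized_le:
  fixes r d :: real
  assumes "0 < r" "r \<le> 2" "0 \<le> d" "d \<le> 1"
  shows "\<bar>ln (r\<^sup>2 + d\<^sup>2) / 2\<bar> \<le> 2 + 1 / r"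
proof -
  have "r\<^sup>2 \<le> 2\<^sup>2" using assms by (intro power_mono) auto
  moreover have "d\<^sup>2 \<le> 1\<^sup>2" using assms by (intro power_mono) auto
  moreover have pos: "r\<^sup>2 > 0" using assms by simp
  moreover have "ln (r\<^sup>2 + d\<^sup>2) \<le> r\<^sup>2 + d\<^sup>2 - 1" by (rule ln_le_minus_one) (use pos in \<open>simp add: add_pos_nonneg\<close>)
  ultimately have 1: "ln (r\<^sup>2 + d\<^sup>2) / 2 \<le> 2" by simp
  have "- ln r = ln (1 / r)" using assms by (simp add: ln_div)
  also have "\<dots> \<le> 1 / r - 1" by (rule ln_le_minus_one) (use assms in simp)
  finally have "- (1 / r) \<le> ln r" by simp
  also have "\<dots> = ln (r\<^sup>2) / 2" using assms by (simp add: ln_realpow)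
  also have "\<dots> \<le> ln (r\<^sup>2 + d\<^sup>2) / 2" using pos by (simp add: add_pos_nonneg)
  finally have 2: "- (1 / r) \<le> ln (r\<^sup>2 + d\<^sup>2) / 2" .
  have "1 / r \<ge> 0" using assms by simp
  then show ?thesis unfolding abs_le_iff using 1 2 by linarith
qed

lemma integral_log_regularized_tendsto:
  fixes a :: "complex \<Rightarrow> real" and z :: complex
  assumes a: "continuous_on UNIV a" "\<And>x. norm x \<ge> 1 \<Longrightarrow> a x = 0" and z: "norm z < 1"
  shows "(\<lambda>n. \<integral>x. a x * (ln ((norm (x - z))\<^sup>2 + (1 / real (Suc n))\<^sup>2) / 2) \<partial>lborel)
           \<longlonglongrightarrow> (\<integral>x. a x * ln (norm (x - z)) \<partial>lborel)"
proof (rule integral_limit_inverse_norm_dominated[OF a])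
  fix x assume x: "x \<noteq> z"
  have "(\<lambda>n. ln ((norm (x - z))\<^sup>2 + (1 / real (Suc n))\<^sup>2) / 2) \<longlonglongrightarrow> ln ((norm (x - z))\<^sup>2 + 0\<^sup>2) / 2"
    by (intro tendsto_intros LIMSEQ_Suc[OF lim_1_over_n]) (use x in auto)
  then show "(\<lambda>n. ln ((norm (x - z))\<^sup>2 + (1 / real (Suc n))\<^sup>2) / 2) \<longlonglongrightarrow> ln (norm (x - z))"
    using x by (simp add: ln_realpow)
next
  fix n x assume x: "x \<noteq> z" "norm x < 1"
  have "norm (x - z) \<le> 2" using norm_triangle_ineq4[of x z] x z by simp
  then show "\<bar>ln ((norm (x - z))\<^sup>2 + (1 / real (Suc n))\<^sup>2) / 2\<bar> \<le> 2 + 1 / norm (x - z)"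
    by (intro abs_log_regularized_le) (use x in auto)
qed measurable

lemma integral_gradient_regularized_tendsto:
  fixes a :: "complex \<Rightarrow> real" and z :: complex
  assumes a: "continuous_on UNIV a" "\<And>x. norm x \<ge> 1 \<Longrightarrow> a x = 0" and b: "norm b = 1"
  shows "(\<lambda>n. \<integral>x. a x * (((x - z) \<bullet> b) / ((norm (x - z))\<^sup>2 + (1 / real (Suc n))\<^sup>2)) \<partial>lborel)
           \<longlonglongrightarrow> (\<integral>x. a x * (((x - z) \<bullet> b) / (norm (x - z))\<^sup>2) \<partial>lborel)"
proof (rule integral_limit_inverse_norm_dominated[OF a])
  fix x assume x: "x \<noteq> z"
  have "(\<lambda>n. ((x - z) \<bullet> b) / ((norm (x - z))\<^sup>2 + (1 / real (Suc n))\<^sup>2)) \<longlonglongrightarrow> ((x - z) \<bullet> b) / ((norm (x - z))\<^sup>2 + 0\<^sup>2)"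
    by (intro tendsto_intros LIMSEQ_Suc[OF lim_1_over_n]) (use x in auto)
  then show "(\<lambda>n. ((x - z) \<bullet> b) / ((norm (x - z))\<^sup>2 + (1 / real (Suc n))\<^sup>2)) \<longlonglongrightarrow> ((x - z) \<bullet> b) / (norm (x - z))\<^sup>2"
    by simp
next
  fix n x assume x: "x \<noteq> z" "norm x < 1"
  have "\<bar>((x - z) \<bullet> b) / ((norm (x - z))\<^sup>2 + (1 / real (Suc n))\<^sup>2)\<bar> \<le> norm (x - z) / (norm (x - z))\<^sup>2"
    unfolding abs_divide
    by (rule frac_le) (use x Cauchy_Schwarz_ineq2[of "x - z" b] b in auto)
  also have "\<dots> = 1 / norm (x - z)" by (simp add: power2_eq_square)
  finally show "\<bar>((x - z) \<bullet> b) / ((norm (x - z))\<^sup>2 + (1 / real (Suc n))\<^sup>2)\<bar> \<le> 2 + 1 / norm (x - z)"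
    by simp
qed measurable

lemma lborel_integral_affine:
  fixes f :: "'a::euclidean_space \<Rightarrow> real"
  assumes [measurable]: "f \<in> borel_measurable borel" and c: "c > 0"
  shows "(\<integral>x. f x \<partial>lborel) = c ^ DIM('a) * (\<integral>x. f (t + c *\<^sub>R x) \<partial>lborel)"
proof -
  have c0: "c \<noteq> 0" using c by simp
  show ?thesis
    by (subst lborel_affine[OF c0, of t]) (use c in \<open>simp add: integral_density integral_distr\<close>)
qed

text \<open>The substitution x = z + d y turns the kernel into the fixed density 2 / (1 + |y|^2)^2
  and moves the dependence on d into the bounded continuous function \<open>a\<close>.\<close>

lemma integral_approximate_identity_tendsto:
  fixes a :: "complex \<Rightarrow> real"
  assumes a: "continuous_on UNIV a" "\<And>x. norm x \<ge> 1 \<Longrightarrow> a x = 0"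
  shows "(\<lambda>n. \<integral>x. a x * (2 * (1 / real (Suc n))\<^sup>2 / ((norm (x - z))\<^sup>2 + (1 / real (Suc n))\<^sup>2)\<^sup>2) \<partial>lborel)
           \<longlonglongrightarrow> cauchy_mass * a z"
proof -
  have [measurable]: "a \<in> borel_measurable borel" using a(1) by (rule borel_measurable_continuous_onI)
  obtain B where B: "B > 0" "\<And>x. norm (a x) \<le> B"
    using bounded_continuous_compact_support[OF a] by blast
  define d where "d n = 1 / real (Suc n)" for n
  have d: "d n > 0" for n by (simp add: d_def)
  have d0: "d \<longlonglongrightarrow> 0" unfolding d_def by (rule LIMSEQ_Suc[OF lim_1_over_n])
  let ?k = "\<lambda>x::complex. 2 / (1 + (norm x)\<^sup>2)\<^sup>2"
  have eq: "(\<integral>x. a x * (2 * (d n)\<^sup>2 / ((norm (x - z))\<^sup>2 + (d n)\<^sup>2)\<^sup>2) \<partial>lborel) = (\<integral>x. a (z + d n *\<^sub>R x) * ?k x \<partial>lborel)" for n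
  proof -
    have "(d n)\<^sup>2 * (2 * (d n)\<^sup>2 / ((d n * norm x)\<^sup>2 + (d n)\<^sup>2)\<^sup>2) = ?k x" for x :: complex
    proof -
      have "((d n * norm x)\<^sup>2 + (d n)\<^sup>2)\<^sup>2 = (d n)\<^sup>2 * (d n)\<^sup>2 * (1 + (norm x)\<^sup>2)\<^sup>2"
        by (simp add: power2_eq_square algebra_simps)
      moreover have "D * (2 * D / (D * D * X)) = 2 / X" if "D > 0" for D X :: real
        using that by simp
      ultimately show ?thesis using d[of n] by (simp only: zero_less_power)
    qed
    moreover have "norm ((z + d n *\<^sub>R x) - z) = d n * norm x" for x
      using d[of n] by simp
    ultimately have "(d n)\<^sup>2 * (a (z + d n *\<^sub>R x) * (2 * (d n)\<^sup>2 / ((norm ((z + d n *\<^sub>R x) - z))\<^sup>2 + (d n)\<^sup>2)\<^sup>2)) = a (z + d n *\<^sub>R x) * ?k x" for x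
      by (metis mult.left_commute)
    then show ?thesis
      by (subst lborel_integral_affine[OF _ d[of n], of _ z]) (simp_all flip: integral_mult_right_zero)
  qed
  have "(\<lambda>n. \<integral>x. a (z + d n *\<^sub>R x) * ?k x \<partial>lborel) \<longlonglongrightarrow> (\<integral>x. a z * ?k x \<partial>lborel)"
  proof (rule integral_dominated_convergence[where w="\<lambda>x. B * ?k x"])
    show "integrable lborel (\<lambda>x::complex. B * ?k x)"
      by (intro integrable_mult_right cauchy_density_integrable)
    show "AE x in lborel. (\<lambda>n. a (z + d n *\<^sub>R x) * ?k x) \<longlonglongrightarrow> a z * ?k x"
    proof (rule AE_I2)
      fix x :: complex
      have "(\<lambda>n. z + d n *\<^sub>R x) \<longlonglongrightarrow> z + 0 *\<^sub>R x" by (intro tendsto_intros d0)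
      then have "(\<lambda>n. a (z + d n *\<^sub>R x)) \<longlonglongrightarrow> a z"
        using continuous_on_tendsto_compose[OF a(1), of "\<lambda>n. z + d n *\<^sub>R x" z sequentially] by simp
      then show "(\<lambda>n. a (z + d n *\<^sub>R x) * ?k x) \<longlonglongrightarrow> a z * ?k x" by (intro tendsto_intros)
    qed
    show "AE x in lborel. norm (a (z + d n *\<^sub>R x) * ?k x) \<le> B * ?k x" for n
      using B(2) by (intro AE_I2) (auto simp: abs_mult intro!: divide_right_mono mult_right_mono)
  qed measurable
  also have "(\<integral>x. a z * ?k x \<partial>lborel) = cauchy_mass * a z"
    unfolding cauchy_mass_def by (subst integral_mult_right_zero) (rule mult.commute)
  finally show ?thesis unfolding eq[symmetric] unfolding d_def .
qed

section \<open>Green's formula with a cutoff\<close>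

text \<open>\<open>f\<close> is arbitrary outside the unit disk. The product is still continuous
  everywhere, because the open sets |x| < 1 and |x| > 19/20 cover the space and the product is zero
  on the second.\<close>

lemma continuous_on_cutoff_mult:
  fixes e f :: "'a::real_normed_vector \<Rightarrow> real"
  assumes "continuous_on UNIV e" "continuous_on (ball 0 1) f" "\<And>x. norm x \<ge> 19/20 \<Longrightarrow> e x = 0"
  shows "continuous_on UNIV (\<lambda>x. e x * f x)"
proof -
  have U: "UNIV = ball 0 1 \<union> {x::'a. 19/20 < norm x}" by (auto simp: not_less)
  have "open {x::'a. 19/20 < norm x}" by (intro open_Collect_less continuous_intros)
  moreover have "continuous_on (ball 0 1) (\<lambda>x. e x * f x)"
    by (intro continuous_intros assms(2) continuous_on_subset[OF assms(1)]) auto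
  moreover have "continuous_on {x::'a. 19/20 < norm x} (\<lambda>x. e x * f x)"
    by (rule continuous_on_eq[of _ "\<lambda>_. 0"]) (auto simp: assms(3))
  ultimately show ?thesis unfolding U by (intro continuous_on_open_Un) auto
qed

text \<open>The step function is composed with |x|^2 rather than |x| to stay differentiable at the
  origin. The derivatives of \<open>e\<close> live in 9/10 <= |x| <= 19/20, hence off the disk of
  radius 7/8 on which the remainder has to be holomorphic.\<close>

lemma cutoff_exists:
  obtains e :: "complex \<Rightarrow> real" and e1 :: "complex \<Rightarrow> complex \<Rightarrow> real" where
    "continuous_on UNIV e" "\<And>b. continuous_on UNIV (e1 b)"
    "\<And>x b. ((\<lambda>t. e (x + t *\<^sub>R b)) has_real_derivative e1 b x) (at 0)"
    "\<And>x. norm x \<le> 9/10 \<Longrightarrow> e x = 1" "\<And>x. norm x \<ge> 19/20 \<Longrightarrow> e x = 0"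
    "\<And>x. 0 \<le> e x \<and> e x \<le> 1"
    "\<And>x b. norm x \<le> 9/10 \<Longrightarrow> e1 b x = 0" "\<And>x b. norm x \<ge> 19/20 \<Longrightarrow> e1 b x = 0"
proof -
  have lt: "(9/10)\<^sup>2 < (19/20::real)\<^sup>2" by (simp add: power2_eq_square)
  obtain q q' :: "real \<Rightarrow> real" where q:
    "\<And>t. (q has_real_derivative q' t) (at t)" "continuous_on UNIV q'"
    "\<And>t. t \<le> (9/10)\<^sup>2 \<Longrightarrow> q t = 1" "\<And>t. (19/20)\<^sup>2 \<le> t \<Longrightarrow> q t = 0" "\<And>t. 0 \<le> q t \<and> q t \<le> 1"
    "\<And>t. t \<le> (9/10)\<^sup>2 \<Longrightarrow> q' t = 0" "\<And>t. (19/20)\<^sup>2 \<le> t \<Longrightarrow> q' t = 0"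
    using smooth_step_exists[OF lt] by blast
  have cq: "continuous_on UNIV q" by (rule DERIV_continuous_on[OF q(1)])
  have small: "(norm x)\<^sup>2 \<le> (9/10)\<^sup>2" if "norm x \<le> 9/10" for x :: complex
    using that by (intro power_mono) auto
  have large: "(19/20)\<^sup>2 \<le> (norm x)\<^sup>2" if "norm x \<ge> 19/20" for x :: complex
    using that by (intro power_mono) auto
  show ?thesis
  proof (rule that[of "\<lambda>x. q ((norm x)\<^sup>2)" "\<lambda>b x. q' ((norm x)\<^sup>2) * (2 * (x \<bullet> b))"])
    show "continuous_on UNIV (\<lambda>x::complex. q ((norm x)\<^sup>2))"
      by (intro continuous_on_compose2[OF cq] continuous_intros) auto
    show "continuous_on UNIV (\<lambda>x::complex. q' ((norm x)\<^sup>2) * (2 * (x \<bullet> b)))" for b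
      by (intro continuous_intros continuous_on_compose2[OF q(2)]) auto
    show "((\<lambda>t. q ((norm (x + t *\<^sub>R b))\<^sup>2)) has_real_derivative q' ((norm x)\<^sup>2) * (2 * (x \<bullet> b))) (at 0)" for x b :: complex
      using DERIV_chain2[where f=q and g="\<lambda>t. (norm (x + t *\<^sub>R b))\<^sup>2" and x=0 and s=UNIV,
          OF q(1) norm_power2_directional_derivative] by simp
  qed (use q small large in auto)
qed

lemma sum_inner_Basis_power2: "(\<Sum>b\<in>Basis. ((y::'a::euclidean_space) \<bullet> b)\<^sup>2) = (norm y)\<^sup>2"
  unfolding power2_norm_eq_inner by (subst euclidean_inner) (simp add: power2_eq_square)

lemma Ck_on_2D:
  assumes "Ck_on 2 u (ball 0 1)"
  shows "\<And>x. norm x < 1 \<Longrightarrow> u differentiable (at x)"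
    and "\<And>x b. norm x < 1 \<Longrightarrow> b \<in> Basis \<Longrightarrow> (\<lambda>y. frechet_derivative u (at y) b) differentiable (at x)"
    and "\<And>b. b \<in> Basis \<Longrightarrow> continuous_on (ball 0 1) (\<lambda>x. frechet_derivative (\<lambda>y. frechet_derivative u (at y) b) (at x) b)"
    and "continuous_on (ball 0 1) u"
    and "\<And>b. b \<in> Basis \<Longrightarrow> continuous_on (ball 0 1) (\<lambda>y. frechet_derivative u (at y) b)"
    and "continuous_on (ball 0 1) (laplacian u)"
proof -
  show 1: "\<And>x. norm x < 1 \<Longrightarrow> u differentiable (at x)"
    and 2: "\<And>x b. norm x < 1 \<Longrightarrow> b \<in> Basis \<Longrightarrow> (\<lambda>y. frechet_derivative u (at y) b) differentiable (at x)"
    and 3: "\<And>b. b \<in> Basis \<Longrightarrow> continuous_on (ball 0 1) (\<lambda>x. frechet_derivative (\<lambda>y. frechet_derivative u (at y) b) (at x) b)"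
    using assms by (auto simp: numeral_2_eq_2)
  show "continuous_on (ball 0 1) u"
    by (intro continuous_at_imp_continuous_on ballI differentiable_imp_continuous_within 1) simp
  show "\<And>b. b \<in> Basis \<Longrightarrow> continuous_on (ball 0 1) (\<lambda>y. frechet_derivative u (at y) b)"
    by (intro continuous_at_imp_continuous_on ballI differentiable_imp_continuous_within 2) simp_all
  show "continuous_on (ball 0 1) (laplacian u)"
    unfolding laplacian_def[abs_def] by (intro continuous_on_sum 3)
qed

text \<open>Integrate the divergence of \<open>e u \<nabla>L - e L \<nabla>u\<close>, where \<open>L x = ln (|x - z|\<^sup>2 + d\<^sup>2) / 2\<close>.\<close>

lemma green_identity_regularized:
  fixes u :: "complex \<Rightarrow> real" and z :: complex
  assumes u: "Ck_on 2 u (ball 0 1)"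
    and e: "continuous_on UNIV e" "\<And>b. continuous_on UNIV (e1 b)"
      "\<And>x b. ((\<lambda>t. e (x + t *\<^sub>R b)) has_real_derivative e1 b x) (at 0)"
      "\<And>x. norm x \<ge> 19/20 \<Longrightarrow> e x = 0" "\<And>x b. norm x \<ge> 19/20 \<Longrightarrow> e1 b x = 0"
    and d: "d > 0"
  shows "(\<integral>x. (e x * u x) * (2 * d\<^sup>2 / ((norm (x - z))\<^sup>2 + d\<^sup>2)\<^sup>2) \<partial>lborel)
       = (\<integral>x. (e x * laplacian u x) * (ln ((norm (x - z))\<^sup>2 + d\<^sup>2) / 2) \<partial>lborel)
       - (\<Sum>b\<in>Basis. \<integral>x. (e1 b x * u x) * (((x - z) \<bullet> b) / ((norm (x - z))\<^sup>2 + d\<^sup>2)) \<partial>lborel)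
       + (\<integral>x. (\<Sum>b\<in>Basis. e1 b x * frechet_derivative u (at x) b) * (ln ((norm (x - z))\<^sup>2 + d\<^sup>2) / 2) \<partial>lborel)"
proof -
  define u1 where "u1 b x = frechet_derivative u (at x) b" for b x
  define u2 where "u2 b x = frechet_derivative (u1 b) (at x) b" for b x
  define N where "N x = (norm (x - z))\<^sup>2 + d\<^sup>2" for x
  define L where "L x = ln (N x) / 2" for x
  define L1 where "L1 b x = ((x - z) \<bullet> b) / N x" for b x
  define L2 where "L2 b x = 1 / N x - 2 * ((x - z) \<bullet> b)\<^sup>2 / (N x)\<^sup>2" for b x
  note uD = Ck_on_2D[OF u]
  have u': "\<And>x. norm x < 1 \<Longrightarrow> u differentiable (at x)"
    "\<And>x b. norm x < 1 \<Longrightarrow> b \<in> Basis \<Longrightarrow> u1 b differentiable (at x)"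
    "\<And>b. b \<in> Basis \<Longrightarrow> continuous_on (ball 0 1) (u2 b)"
    "continuous_on (ball 0 1) u"
    "\<And>b. b \<in> Basis \<Longrightarrow> continuous_on (ball 0 1) (u1 b)"
    using uD by (simp_all add: u1_def[abs_def] u2_def[abs_def])
  have N: "N x > 0" for x using d by (simp add: N_def add_nonneg_pos)
  have cN: "continuous_on UNIV N" unfolding N_def by (intro continuous_intros)
  have cL: "continuous_on UNIV L"
    unfolding L_def by (intro continuous_intros cN) (use N in \<open>auto simp: order_less_imp_not_eq2\<close>)
  have cL1: "continuous_on UNIV (L1 b)" for b
    unfolding L1_def by (intro continuous_intros cN) (use N in \<open>auto simp: order_less_imp_not_eq2\<close>)
  have cL2: "continuous_on UNIV (L2 b)" for b
    unfolding L2_def by (intro continuous_intros cN) (use N in \<open>auto simp: order_less_imp_not_eq2\<close>)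
  note cut = continuous_on_cutoff_mult[OF e(1) _ e(4)] continuous_on_cutoff_mult[OF e(2) _ e(5)]
  \<comment> \<open>\<open>g b\<close> is the b-component of the vector field. In its derivative the
    two terms \<open>e * u1 * L1\<close> cancel, which leaves the four terms of
    \<open>g'\<close>.\<close>
  define g where "g b x = (e x * u x) * L1 b x - L x * (e x * u1 b x)" for b x
  define g' where "g' b x = (e1 b x * u x) * L1 b x + (e x * u x) * L2 b x
      - L x * (e1 b x * u1 b x) - L x * (e x * u2 b x)" for b x
  have supp: "g b x = 0" "g' b x = 0" if "norm x \<ge> 19/20" for b x
    using that e by (auto simp: g_def g'_def)
  have cg: "continuous_on UNIV (g b)" if "b \<in> Basis" for b
    unfolding g_def using that by (intro continuous_intros cut cL cL1 u')
  have cg': "continuous_on UNIV (g' b)" if "b \<in> Basis" for b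
    unfolding g'_def using that by (intro continuous_intros cut cL cL1 cL2 u')
  have dN: "((\<lambda>t. N (x + t *\<^sub>R b)) has_real_derivative 2 * ((x - z) \<bullet> b)) (at 0)" for x b
  proof -
    have "N (x + t *\<^sub>R b) = (norm ((x - z) + t *\<^sub>R b))\<^sup>2 + d\<^sup>2" for t
      by (simp add: N_def algebra_simps)
    moreover have "((\<lambda>t. (norm ((x - z) + t *\<^sub>R b))\<^sup>2 + d\<^sup>2) has_real_derivative 2 * ((x - z) \<bullet> b) + 0) (at 0)"
      by (intro DERIV_add norm_power2_directional_derivative DERIV_const)
    ultimately show ?thesis by simp
  qed
  have dL: "((\<lambda>t. L (x + t *\<^sub>R b)) has_real_derivative L1 b x) (at 0)" for x b
    unfolding L_def L1_def using N[of x]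
    by (auto intro!: derivative_eq_intros dN)
  have dL1: "((\<lambda>t. L1 b (x + t *\<^sub>R b)) has_real_derivative L2 b x) (at 0)" if b: "b \<in> Basis" for x b
  proof -
    have "((\<lambda>t. (x + t *\<^sub>R b - z) \<bullet> b) has_real_derivative 1) (at 0)"
      using b by (auto intro!: derivative_eq_intros simp: has_field_derivative_def)
    from DERIV_divide[OF this dN] N[of x] show ?thesis
      unfolding L1_def L2_def by (simp add: power2_eq_square field_simps)
  qed
  have int0: "(\<integral>x. g' b x \<partial>lborel) = 0" if b: "b \<in> Basis" for b
  proof (rule integral_directional_derivative_eq_0[OF _ cg[OF b] cg'[OF b]])
    show "((\<lambda>t. g b (x + t *\<^sub>R b)) has_real_derivative g' b x) (at 0)" for x
    proof (cases "norm x < 1")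
      case True
      have du: "((\<lambda>t. u (x + t *\<^sub>R b)) has_real_derivative u1 b x) (at 0)"
        unfolding u1_def by (rule has_directional_derivative[OF u'(1)[OF True]])
      have du1: "((\<lambda>t. u1 b (x + t *\<^sub>R b)) has_real_derivative u2 b x) (at 0)"
        unfolding u2_def by (rule has_directional_derivative[OF u'(2)[OF True b]])
      show ?thesis
        unfolding g_def
        by (rule DERIV_cong, rule DERIV_diff[OF DERIV_mult[OF DERIV_mult[OF e(3) du] dL1[OF b]] DERIV_mult[OF dL DERIV_mult[OF e(3) du1]]])
           (simp add: g'_def algebra_simps)
    next
      case False
      \<comment> \<open>Here \<open>u\<close> may fail to be differentiable, but \<open>g\<close>
        vanishes on a neighbourhood of x.\<close>
      have "((\<lambda>t. 0) has_real_derivative g' b x) (at 0)"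
        using False supp(2)[of x b] by simp
      then show ?thesis
      proof (rule has_field_derivative_transform_within_open[of _ _ _ "{t. 19/20 < norm (x + t *\<^sub>R b)}"])
        show "open {t. 19/20 < norm (x + t *\<^sub>R b)}"
          by (intro open_Collect_less continuous_intros)
      qed (use False supp(1) in auto)
    qed
  qed (use supp b in auto)
  have supp1: "e x = 0" "e1 b x = 0" if "norm x \<ge> 1" for x b
    using that e(4)[of x] e(5)[of x b] by simp_all
  note int = integrable_continuous_compact_support
  have i1: "integrable lborel (\<lambda>x. (e x * u x) * L2 b x)" for b
    by (rule int) (auto simp: supp1 intro!: continuous_intros cut u' cL2)
  have i2: "integrable lborel (\<lambda>x. (e1 b x * u x) * L1 b x)" for b
    by (rule int) (auto simp: supp1 intro!: continuous_intros cut u' cL1)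
  have i3: "integrable lborel (\<lambda>x. (e1 b x * u1 b x) * L x)" if "b \<in> Basis" for b
    by (rule int) (use that in \<open>auto simp: supp1 intro!: continuous_intros cut u' cL\<close>)
  have i4: "integrable lborel (\<lambda>x. (e x * u2 b x) * L x)" if "b \<in> Basis" for b
    by (rule int) (use that in \<open>auto simp: supp1 intro!: continuous_intros cut u' cL\<close>)
  have "0 = (\<integral>x. (e1 b x * u x) * L1 b x \<partial>lborel) + (\<integral>x. (e x * u x) * L2 b x \<partial>lborel)
      - (\<integral>x. (e1 b x * u1 b x) * L x \<partial>lborel) - (\<integral>x. (e x * u2 b x) * L x \<partial>lborel)" if b: "b \<in> Basis" for b
    unfolding int0[OF b, symmetric] g'_def
    by (simp add: mult.commute[of "L _"] i1 i2 i3[OF b] i4[OF b])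
  then have "0 = (\<Sum>b\<in>Basis. (\<integral>x. (e1 b x * u x) * L1 b x \<partial>lborel) + (\<integral>x. (e x * u x) * L2 b x \<partial>lborel)
      - (\<integral>x. (e1 b x * u1 b x) * L x \<partial>lborel) - (\<integral>x. (e x * u2 b x) * L x \<partial>lborel))"
    by simp
  also have "\<dots> = (\<Sum>b\<in>Basis. \<integral>x. (e1 b x * u x) * L1 b x \<partial>lborel)
      + (\<integral>x. (\<Sum>b\<in>Basis. (e x * u x) * L2 b x) \<partial>lborel)
      - (\<integral>x. (\<Sum>b\<in>Basis. (e1 b x * u1 b x) * L x) \<partial>lborel)
      - (\<integral>x. (\<Sum>b\<in>Basis. (e x * u2 b x) * L x) \<partial>lborel)"
    by (simp add: sum.distrib sum_subtractf i1 i3 i4 Bochner_Integration.integral_sum)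
  also have "(\<integral>x. (\<Sum>b\<in>Basis. (e x * u x) * L2 b x) \<partial>lborel) = (\<integral>x. (e x * u x) * (2 * d\<^sup>2 / (N x)\<^sup>2) \<partial>lborel)"
  proof (rule Bochner_Integration.integral_cong[OF refl])
    fix x
    \<comment> \<open>The Laplacian of \<open>L\<close>. The two basis vectors of the plane
      contribute 2 / N, whose leading part cancels against 2 |x - z|^2 / N^2; what remains is the
      approximate identity.\<close>
    have "(\<Sum>b\<in>Basis. L2 b x) = 2 / N x - (\<Sum>b\<in>Basis. 2 * ((x - z) \<bullet> b)\<^sup>2) / (N x)\<^sup>2"
      unfolding L2_def by (simp add: sum_subtractf sum_divide_distrib)
    also have "(\<Sum>b\<in>Basis. 2 * ((x - z) \<bullet> b)\<^sup>2) = 2 * (N x - d\<^sup>2)"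
      by (simp add: sum_distrib_left[symmetric] sum_inner_Basis_power2 N_def del: Basis_complex_def)
    also have "2 / N x - 2 * (N x - d\<^sup>2) / (N x)\<^sup>2 = 2 * d\<^sup>2 / (N x)\<^sup>2"
      using N[of x] by (simp add: power2_eq_square field_simps)
    finally show "(\<Sum>b\<in>Basis. (e x * u x) * L2 b x) = (e x * u x) * (2 * d\<^sup>2 / (N x)\<^sup>2)"
      by (simp add: sum_distrib_left[symmetric])
  qed
  also have "(\<lambda>x. \<Sum>b\<in>Basis. (e1 b x * u1 b x) * L x) = (\<lambda>x. (\<Sum>b\<in>Basis. e1 b x * u1 b x) * L x)"
    by (simp add: sum_distrib_right)
  also have "(\<lambda>x. \<Sum>b\<in>Basis. (e x * u2 b x) * L x) = (\<lambda>x. (e x * laplacian u x) * L x)"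
    by (simp add: sum_distrib_right[symmetric] sum_distrib_left[symmetric] laplacian_def u2_def u1_def[abs_def])
  finally show ?thesis by (simp add: L_def L1_def N_def u1_def)
qed

section \<open>The remainder as the real part of a holomorphic function\<close>

lemma continuous_on_Pair_right: "continuous_on S (Pair z)"
  by (intro continuous_on_Pair[of S "\<lambda>_. z" "\<lambda>x. x"] continuous_intros)

text \<open>Gluing in two variables: for |z| < 7/8 the kernel is under control only when |x| > 7/8,
  and for |x| < 9/10 the product is zero; these two open conditions on x overlap and cover
  everything.\<close>

lemma continuous_on_exterior_kernel:
  fixes k :: "complex \<times> complex \<Rightarrow> complex" and c :: "complex \<Rightarrow> complex"
  assumes k: "continuous_on (ball 0 (7/8) \<times> {x. 7/8 < norm x}) k"
    and c: "continuous_on UNIV c" "\<And>x. norm x \<le> 9/10 \<Longrightarrow> c x = 0"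
  shows "continuous_on (ball 0 (7/8) \<times> UNIV) (\<lambda>p. c (snd p) * k p)"
proof -
  let ?B = "ball (0::complex) (7/8)"
  have eq: "?B \<times> UNIV = (?B \<times> {x. 7/8 < norm x}) \<union> (?B \<times> {x. norm x < 9/10})" by auto
  have "continuous_on (?B \<times> {x. 7/8 < norm x}) (\<lambda>p. c (snd p) * k p)"
    by (intro continuous_intros k continuous_on_compose2[OF c(1)]) auto
  moreover have "continuous_on (?B \<times> {x. norm x < 9/10}) (\<lambda>p. c (snd p) * k p)"
    by (rule continuous_on_eq[of _ "\<lambda>_. 0"]) (auto simp: c(2))
  moreover have "open {x::complex. 7/8 < norm x}" "open {x::complex. norm x < 9/10}"
    by (intro open_Collect_less continuous_intros)+
  ultimately show ?thesis
    unfolding eq by (intro continuous_on_open_Un open_Times) auto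
qed

text \<open>For \<open>|z| < |x|\<close> the kernel \<open>ln |x - z|\<close> is the real part of \<open>ln |x| + Ln (1 - z / x)\<close>.\<close>

lemma holomorphic_exterior_potential:
  fixes a :: "complex \<Rightarrow> real" and b :: "complex \<Rightarrow> complex"
  assumes a: "continuous_on UNIV a" "\<And>x. norm x \<le> 9/10 \<Longrightarrow> a x = 0" "\<And>x. norm x \<ge> 1 \<Longrightarrow> a x = 0"
    and b: "continuous_on UNIV b" "\<And>x. norm x \<le> 9/10 \<Longrightarrow> b x = 0" "\<And>x. norm x \<ge> 1 \<Longrightarrow> b x = 0"
  obtains G where "G holomorphic_on ball 0 (7/8)"
    "\<And>z. norm z < 7/8 \<Longrightarrow>
       Re (G z) = (\<integral>x. a x * ln (norm (x - z)) \<partial>lborel) - (\<integral>x. (b x \<bullet> (x - z)) / (norm (x - z))\<^sup>2 \<partial>lborel)"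
proof -
  let ?B = "ball (0::complex) (7/8)"
  define A where "A x = complex_of_real (a x)" for x
  have A: "continuous_on UNIV A" "\<And>x. norm x \<le> 9/10 \<Longrightarrow> A x = 0"
    using a by (auto simp: A_def intro!: continuous_intros)
  define f1 where "f1 z x = A x * (of_real (ln (norm x)) + Ln (1 - z / x))" for z x
  \<comment> \<open>Reading the vector b as a complex number, the real part of b / (x - z) is the
    inner product of b with (x - z) / |x - z|^2.\<close>
  define f2 where "f2 z x = b x * (1 / (x - z))" for z x
  define f where "f z x = f1 z x - f2 z x" for z x
  define f' where "f' z x = A x * (- (1 / x) / (1 - z / x)) - b x * (1 / (x - z)\<^sup>2)" for z x
  \<comment> \<open>As |z / x| < 1, the number 1 - z / x lies in the right half-plane, away from the
    branch cut of \<open>Ln\<close>.\<close>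
  have neg: "1 - z / x \<notin> \<real>\<^sub>\<le>\<^sub>0" if "norm z < 7/8" "7/8 < norm x" for z x :: complex
  proof -
    have "norm (z / x) < 1" using that by (simp add: norm_divide divide_less_eq)
    then have "Re (z / x) < 1" using complex_Re_le_cmod[of "z / x"] by linarith
    then have "Re (1 - z / x) > 0" by simp
    then show ?thesis by (auto simp: complex_nonpos_Reals_iff)
  qed
  have nz: "x \<noteq> 0" "x \<noteq> z" "1 - z / x \<noteq> 0" if "norm z < 7/8" "7/8 < norm x" for z x :: complex
    using that neg[OF that] by auto
  have k1: "continuous_on (?B \<times> {x. 7/8 < norm x}) (\<lambda>p. of_real (ln (norm (snd p))) + Ln (1 - fst p / snd p))"
    by (intro continuous_intros) (use neg in auto)
  have k2: "continuous_on (?B \<times> {x. 7/8 < norm x}) (\<lambda>p. 1 / (snd p - fst p))"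
    by (intro continuous_intros) (use nz in auto)
  have k3: "continuous_on (?B \<times> {x. 7/8 < norm x}) (\<lambda>p. - (1 / snd p) / (1 - fst p / snd p))"
    by (intro continuous_intros) (use nz in auto)
  have k4: "continuous_on (?B \<times> {x. 7/8 < norm x}) (\<lambda>p. 1 / (snd p - fst p)\<^sup>2)"
    by (intro continuous_intros) (use nz in auto)
  have cf1: "continuous_on UNIV (f1 z)" if "z \<in> ?B" for z
    unfolding f1_def
    using continuous_on_compose2[OF continuous_on_exterior_kernel[OF k1 A] continuous_on_Pair_right[of UNIV z]] that by force
  have cf2: "continuous_on UNIV (f2 z)" if "z \<in> ?B" for z
    unfolding f2_def
    using continuous_on_compose2[OF continuous_on_exterior_kernel[OF k2 b(1,2)] continuous_on_Pair_right[of UNIV z]] that by force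
  have cf': "continuous_on (?B \<times> UNIV) (\<lambda>p. f' (fst p) (snd p))"
    unfolding f'_def by (intro continuous_on_diff continuous_on_exterior_kernel k3 k4 A b)
  have supp: "f1 z x = 0" "f2 z x = 0" if "norm x \<ge> 1" for z x
    using that a b by (simp_all add: f1_def f2_def A_def)
  \<comment> \<open>Corners of a square that contains the unit disk, outside of which the integrand
    vanishes: Leibniz's rule is applied on a box.\<close>
  define l where "l = Complex (-1) (-1)"
  define r where "r = Complex 1 1"
  have box: "x \<in> cbox l r" if "norm x < 1" for x
    using that abs_Re_le_cmod[of x] abs_Im_le_cmod[of x] by (auto simp: l_def r_def in_cbox_complex_iff)
  define G where "G z = integral (cbox l r) (f z)" for z
  have "G holomorphic_on ?B"
    unfolding G_def
  proof (rule leibniz_rule_holomorphic[where fx=f'])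
    show "f z integrable_on cbox l r" if "z \<in> ?B" for z
      unfolding f_def
      by (intro integrable_continuous continuous_on_diff continuous_on_subset[OF cf1] continuous_on_subset[OF cf2] that) auto
    show "continuous_on (?B \<times> cbox l r) (\<lambda>(x, t). f' x t)"
      unfolding case_prod_unfold by (rule continuous_on_subset[OF cf']) auto
    show "((\<lambda>z. f z x) has_field_derivative f' z x) (at z within ?B)" if z: "z \<in> ?B" for z x
    proof (cases "norm x \<le> 9/10")
      case True
      then show ?thesis by (simp add: f_def f1_def f2_def f'_def A b)
    next
      case False
      then have x: "7/8 < norm x" by simp
      have z': "norm z < 7/8" using z by simp
      have 1: "((\<lambda>z. Ln (1 - z / x)) has_field_derivative - (1 / x) / (1 - z / x)) (at z within ?B)"
      proof -
        have "((\<lambda>z. 1 - z / x) has_field_derivative - (1 / x)) (at z within ?B)"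
          using DERIV_diff[OF DERIV_const[where k=1] DERIV_cdivide[where c=x, OF DERIV_ident]] by simp
        from DERIV_chain2[where f=Ln and g="\<lambda>z. 1 - z / x", OF has_field_derivative_Ln[OF neg[OF z' x]] this]
        show ?thesis by (rule DERIV_cong) (metis divide_inverse mult.commute)
      qed
      have 2: "((\<lambda>z. 1 / (x - z)) has_field_derivative 1 / (x - z)\<^sup>2) (at z within ?B)"
        by (rule derivative_eq_intros refl)+ (use nz[OF z' x] in \<open>simp_all add: power2_eq_square\<close>)
      show ?thesis
        unfolding f_def f1_def f2_def f'_def
        by (rule DERIV_cong, rule DERIV_diff[OF DERIV_cmult[OF DERIV_add[OF DERIV_const 1]] DERIV_cmult[OF 2]]) simp
    qed
  qed auto
  moreover have "Re (G z) = (\<integral>x. a x * ln (norm (x - z)) \<partial>lborel) - (\<integral>x. (b x \<bullet> (x - z)) / (norm (x - z))\<^sup>2 \<partial>lborel)"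
    if z: "norm z < 7/8" for z
  proof -
    have zB: "z \<in> ?B" using z by simp
    have int: "integrable lborel (f1 z)" "integrable lborel (f2 z)"
      using integrable_continuous_compact_support[OF cf1[OF zB]] integrable_continuous_compact_support[OF cf2[OF zB]] supp
      by blast+
    have "G z = integral UNIV (\<lambda>x. if x \<in> cbox l r then f z x else 0)"
      unfolding G_def by (rule integral_restrict_UNIV[symmetric])
    also have "(\<lambda>x. if x \<in> cbox l r then f z x else 0) = f z"
      by (rule ext) (metis box supp diff_self f_def not_less)
    also have "integral UNIV (f z) = (\<integral>x. f z x \<partial>lborel)"
      unfolding f_def by (intro integral_lborel Bochner_Integration.integrable_diff int)
    also have "\<dots> = (\<integral>x. f1 z x \<partial>lborel) - (\<integral>x. f2 z x \<partial>lborel)"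
      unfolding f_def by (rule Bochner_Integration.integral_diff[OF int])
    finally have "Re (G z) = (\<integral>x. Re (f1 z x) \<partial>lborel) - (\<integral>x. Re (f2 z x) \<partial>lborel)" using int by simp
    also have "(\<lambda>x. Re (f1 z x)) = (\<lambda>x. a x * ln (norm (x - z)))"
    proof
      fix x
      show "Re (f1 z x) = a x * ln (norm (x - z))"
      proof (cases "norm x \<le> 9/10")
        case False
        then have x: "7/8 < norm x" by simp
        have "ln (norm x) + ln (norm (1 - z / x)) = ln (norm x * norm (1 - z / x))"
          using nz[OF z x] by (simp add: ln_mult)
        also have "norm x * norm (1 - z / x) = norm (x - z)"
          using nz[OF z x] by (simp add: norm_mult[symmetric] algebra_simps)
        finally show ?thesis using nz[OF z x] by (simp add: f1_def A_def)
      qed (simp add: f1_def A a)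
    qed
    also have "(\<lambda>x. Re (f2 z x)) = (\<lambda>x. (b x \<bullet> (x - z)) / (norm (x - z))\<^sup>2)"
      by (simp add: f2_def Re_divide inner_complex_def cmod_power2)
    finally show ?thesis .
  qed
  ultimately show ?thesis using that by blast
qed

text \<open>The constant is \<open>1 / (2 \<pi>)\<close>, but its value plays no role.\<close>

lemma log_potential_representation:
  fixes u :: "complex \<Rightarrow> real"
  assumes u: "Ck_on 2 u (ball 0 1)"
  obtains F G where "continuous_on UNIV F" "\<And>x. norm x \<ge> 1 \<Longrightarrow> F x = 0"
    "\<And>x. \<bar>F x\<bar> \<le> \<bar>laplacian u x\<bar> / cauchy_mass"
    "G holomorphic_on ball 0 (7/8)"
    "\<And>z. norm z < 7/8 \<Longrightarrow> u z = (\<integral>x. F x * ln (norm (x - z)) \<partial>lborel) + Re (G z)"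
proof -
  obtain e e1 where e: "continuous_on UNIV e" "\<And>b. continuous_on UNIV (e1 b)"
    "\<And>x b. ((\<lambda>t. e (x + t *\<^sub>R b)) has_real_derivative e1 b x) (at 0)"
    "\<And>x. norm x \<le> 9/10 \<Longrightarrow> e x = 1" "\<And>x. norm x \<ge> 19/20 \<Longrightarrow> e x = 0"
    "\<And>x. 0 \<le> e x \<and> e x \<le> (1::real)"
    "\<And>x b. norm x \<le> 9/10 \<Longrightarrow> e1 b x = 0" "\<And>x b. norm (x::complex) \<ge> 19/20 \<Longrightarrow> e1 b x = 0"
    using cutoff_exists by blast
  define u1 where "u1 b x = frechet_derivative u (at x) b" for b x
  note uD = Ck_on_2D[OF u, folded u1_def]
  note cut = continuous_on_cutoff_mult[OF e(1) _ e(5)] continuous_on_cutoff_mult[OF e(2) _ e(8)]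
  let ?M = cauchy_mass
  have M: "?M > 0" by (rule cauchy_mass_pos)
  have supp: "e x = 0" "e1 b x = 0" if "norm x \<ge> 1" for x b
    using that e(5)[of x] e(8)[of x b] by simp_all
  \<comment> \<open>\<open>P\<close> is the cut-off Laplacian, \<open>Q\<close> the inner product of
    the gradients of e and u, and \<open>R b\<close> the components of u times the gradient of e.
    \<open>Q\<close> and \<open>R\<close> vanish for |x| <= 9/10 and produce the holomorphic
    remainder; \<open>P\<close> becomes the charge.\<close>
  define P where "P x = e x * laplacian u x" for x
  define Q where "Q x = (\<Sum>b\<in>Basis. e1 b x * u1 b x)" for x
  define R where "R b x = e1 b x * u x" for b x
  have c: "continuous_on UNIV P" "continuous_on UNIV Q" "continuous_on UNIV (R b)" "continuous_on UNIV (\<lambda>x. e x * u x)" for b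
    unfolding P_def Q_def R_def by (intro continuous_on_sum cut uD; assumption)+
  have s: "P x = 0" "Q x = 0" "R b x = 0" "e x * u x = 0" if "norm x \<ge> 1" for x b
    using that by (simp_all add: P_def Q_def R_def supp)
  let ?I = "\<lambda>l g. (\<integral>x. P x * l x \<partial>lborel) - (\<Sum>b\<in>Basis. \<integral>x. R b x * g b x \<partial>lborel) + (\<integral>x. Q x * l x \<partial>lborel)"
  let ?g = "\<lambda>z b x. ((x - z) \<bullet> b) / (norm (x - z))\<^sup>2"
  \<comment> \<open>Both sides of the regularised identity as d tends to 0: the approximate identity
    on the left, dominated convergence on the right.\<close>
  have rep: "?M * (e z * u z) = ?I (\<lambda>x. ln (norm (x - z))) (?g z)" if z: "norm z < 1" for z
  proof (rule LIMSEQ_unique)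
    define d where "d n = 1 / real (Suc n)" for n
    let ?l = "\<lambda>n. \<integral>x. (e x * u x) * (2 * (d n)\<^sup>2 / ((norm (x - z))\<^sup>2 + (d n)\<^sup>2)\<^sup>2) \<partial>lborel"
    show "?l \<longlonglongrightarrow> ?M * (e z * u z)"
      unfolding d_def by (rule integral_approximate_identity_tendsto) (use c s in auto)
    have "?l = (\<lambda>n. ?I (\<lambda>x. ln ((norm (x - z))\<^sup>2 + (d n)\<^sup>2) / 2) (\<lambda>b x. ((x - z) \<bullet> b) / ((norm (x - z))\<^sup>2 + (d n)\<^sup>2)))"
      unfolding P_def Q_def R_def u1_def
      by (rule ext, rule green_identity_regularized[OF u e(1-3) e(5) e(8)]) (auto simp: d_def)
    also have "\<dots> \<longlonglongrightarrow> ?I (\<lambda>x. ln (norm (x - z))) (?g z)"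
      unfolding d_def
      by (intro tendsto_add tendsto_diff tendsto_sum integral_log_regularized_tendsto
          integral_gradient_regularized_tendsto c s z) auto
    finally show "?l \<longlonglongrightarrow> ?I (\<lambda>x. ln (norm (x - z))) (?g z)" .
  qed
  define S where "S x = (\<Sum>b\<in>Basis. (R b x / ?M) *\<^sub>R b)" for x
  have cS: "continuous_on UNIV S" unfolding S_def using M by (intro continuous_intros c) auto
  obtain G where G: "G holomorphic_on ball 0 (7/8)"
    "\<And>z. norm z < 7/8 \<Longrightarrow>
       Re (G z) = (\<integral>x. (Q x / ?M) * ln (norm (x - z)) \<partial>lborel) - (\<integral>x. (S x \<bullet> (x - z)) / (norm (x - z))\<^sup>2 \<partial>lborel)"
  proof (rule holomorphic_exterior_potential[of "\<lambda>x. Q x / ?M" S])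
    show "continuous_on UNIV (\<lambda>x. Q x / ?M)" using M by (intro continuous_intros c) auto
    show "Q x / ?M = 0" "S x = 0" if "norm x \<le> 9/10" for x
      using that by (simp_all add: Q_def S_def R_def e)
    show "Q x / ?M = 0" "S x = 0" if "norm x \<ge> 1" for x
      using that s by (simp_all add: S_def)
  qed (use cS in auto)
  show ?thesis
  proof (rule that[of "\<lambda>x. P x / ?M" G])
    show "continuous_on UNIV (\<lambda>x. P x / ?M)" using M by (intro continuous_intros c) auto
    show "P x / ?M = 0" if "norm x \<ge> 1" for x using s[OF that] by simp
    show "\<bar>P x / ?M\<bar> \<le> \<bar>laplacian u x\<bar> / ?M" for x
      using M e(6)[of x] mult_right_mono[of "\<bar>e x\<bar>" 1 "\<bar>laplacian u x\<bar>"]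
      by (simp add: P_def abs_mult divide_right_mono)
    show "G holomorphic_on ball 0 (7/8)" by (rule G)
    show "u z = (\<integral>x. (P x / ?M) * ln (norm (x - z)) \<partial>lborel) + Re (G z)" if z: "norm z < 7/8" for z
    proof -
      have iR: "integrable lborel (\<lambda>x. R b x * ?g z b x)" if b: "b \<in> Basis" for b
      proof -
        have [measurable]: "R b \<in> borel_measurable borel" using c(3) by (rule borel_measurable_continuous_onI)
        obtain B where B: "B > 0" "\<And>x. norm (R b x) \<le> B"
          using bounded_continuous_compact_support[OF c(3) s(3)] by blast
        show ?thesis
        proof (rule Bochner_Integration.integrable_bound)
          show "integrable lborel (\<lambda>x. B * (indicator (ball 0 1) x * (1 / norm (x - z))))"
            by (intro integrable_mult_right integrable_inverse_norm)
          show "AE x in lborel. norm (R b x * ?g z b x) \<le> norm (B * (indicator (ball 0 1) x * (1 / norm (x - z))))"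
          proof (rule AE_I2)
            fix x
            have "\<bar>(x - z) \<bullet> b\<bar> / (norm (x - z))\<^sup>2 \<le> norm (x - z) / (norm (x - z))\<^sup>2"
              using Cauchy_Schwarz_ineq2[of "x - z" b] norm_Basis[OF b] by (intro divide_right_mono) auto
            also have "\<dots> = 1 / norm (x - z)" by (simp add: power2_eq_square)
            finally show "norm (R b x * ?g z b x) \<le> norm (B * (indicator (ball 0 1) x * (1 / norm (x - z))))"
              using B s(3)[of x b] mult_mono[OF B(2)[of x], of "\<bar>(x - z) \<bullet> b\<bar> / (norm (x - z))\<^sup>2" "1 / norm (x - z)"]
              by (cases "norm x < 1") (auto simp: abs_mult)
          qed
        qed measurable
      qed
      have "(\<integral>x. (S x \<bullet> (x - z)) / (norm (x - z))\<^sup>2 \<partial>lborel)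
          = (\<integral>x. (\<Sum>b\<in>Basis. R b x * ?g z b x) / ?M \<partial>lborel)"
        unfolding S_def inner_sum_left
        by (intro Bochner_Integration.integral_cong refl) (simp add: sum_divide_distrib inner_commute mult.commute)
      also have "\<dots> = (\<Sum>b\<in>Basis. \<integral>x. R b x * ?g z b x \<partial>lborel) / ?M"
        by (subst integral_divide_zero, subst Bochner_Integration.integral_sum) (use iR in auto)
      finally have "Re (G z) = (\<integral>x. Q x * ln (norm (x - z)) \<partial>lborel) / ?M
         - (\<Sum>b\<in>Basis. \<integral>x. R b x * ?g z b x \<partial>lborel) / ?M"
        unfolding G(2)[OF z] by simp
      then have "(\<integral>x. (P x / ?M) * ln (norm (x - z)) \<partial>lborel) + Re (G z) = (?M * (e z * u z)) / ?M"
        using z by (simp add: rep diff_divide_distrib add_divide_distrib)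
      then show ?thesis using M z e(4)[of z] by simp
    qed
  qed
qed

section \<open>Logarithmic and Riesz potentials\<close>

lemma ennreal_integral_le_nn_integral:
  assumes "integrable M h"
  shows "ennreal (\<integral>x. h x \<partial>M) \<le> (\<integral>\<^sup>+x. ennreal (h x) \<partial>M)"
proof -
  have "ennreal (\<integral>x. h x \<partial>M) \<le> ennreal (\<integral>x. max 0 (h x) \<partial>M)"
    by (intro ennreal_leI integral_mono assms integrable_max integrable_zero) auto
  also have "\<dots> = (\<integral>\<^sup>+x. ennreal (max 0 (h x)) \<partial>M)"
    by (intro nn_integral_eq_integral[symmetric] integrable_max integrable_zero assms) auto
  also have "\<dots> = (\<integral>\<^sup>+x. ennreal (h x) \<partial>M)"
    by (simp add: max_def ennreal_neg cong: if_cong)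
       (intro nn_integral_cong, auto simp: ennreal_neg)
  finally show ?thesis .
qed

text \<open>Young's inequality with exponents p and p / (p - 1) for the product of x and b^(p-1),
  rearranged. It supplies the subgradient in Jensen's inequality for powers.\<close>

lemma powr_tangent:
  fixes x b p :: real
  assumes "x \<ge> 0" "b \<ge> 0" "p > 1"
  shows "x powr p \<ge> b powr p + p * b powr (p - 1) * (x - b)"
proof (cases "x = 0 \<or> b = 0")
  case True
  have "b powr (p - 1) * b = b powr p" if "b > 0"
    using that by (simp add: powr_diff)
  then show ?thesis using True assms by (cases "b = 0") (auto simp: algebra_simps)
next
  case False
  then have pos: "x > 0" "b > 0" using assms by auto
  have "(x powr p) powr (1 / p) * (b powr p) powr (1 - 1 / p) \<le> (1 / p) * x powr p + (1 - 1 / p) * b powr p"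
    by (rule Youngs_inequality_0) (use assms pos in auto)
  moreover have "(x powr p) powr (1 / p) = x" "(b powr p) powr (1 - 1 / p) = b powr (p - 1)"
    using assms pos by (simp_all add: powr_powr right_diff_distrib)
  ultimately have "p * (x * b powr (p - 1)) \<le> p * ((1 / p) * x powr p + (1 - 1 / p) * b powr p)"
    using assms by (intro mult_left_mono) auto
  also have "\<dots> = x powr p + (p - 1) * b powr p"
    using assms by (simp add: field_simps)
  finally have "p * (x * b powr (p - 1)) \<le> x powr p + (p - 1) * b powr p" .
  moreover have "b powr (p - 1) * b = b powr p" using pos by (simp add: powr_diff)
  then have "p * b powr (p - 1) * (x - b) = p * (x * b powr (p - 1)) - p * b powr p"
    by (metis mult.assoc mult.commute right_diff_distrib)
  moreover have "(p - 1) * b powr p = p * b powr p - b powr p" by (simp add: algebra_simps)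
  ultimately show ?thesis by linarith
qed

text \<open>The symmetric form is chosen for its use: with a and b the distances from a charge to
  the two ends of a short segment, the first factor is at most its length and the second is a sum of
  two Riesz kernels.\<close>

lemma abs_ln_diff_le:
  fixes a b :: real
  assumes "a > 0" "b > 0"
  shows "\<bar>ln a - ln b\<bar> \<le> \<bar>a - b\<bar> * (1 / a + 1 / b)"
proof -
  have *: "ln x - ln y \<le> \<bar>x - y\<bar> * (1 / x + 1 / y)" if "x > 0" "y > 0" for x y :: real
  proof -
    have "ln x - ln y = ln (x / y)" using that by (simp add: ln_div)
    also have "\<dots> \<le> x / y - 1" by (rule ln_le_minus_one) (use that in simp)
    also have "\<dots> = (x - y) * (1 / y)" using that by (simp add: field_simps)
    also have "\<dots> \<le> \<bar>x - y\<bar> * (1 / x + 1 / y)" using that by (intro mult_mono) auto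
    finally show ?thesis .
  qed
  show ?thesis unfolding abs_le_iff
    using *[of a b] *[of b a] assms by (simp add: abs_minus_commute add.commute)
qed

text \<open>All estimates on the potentials depend on the charge through \<open>m0\<close> alone;
  the supremum of \<open>F\<close> enters only to justify integrability and limits.
  \<open>m0\<close> is an upper bound for the mass, not the mass itself, so that it can be chosen
  before the metric.\<close>

locale planar_charge =
  fixes F :: "complex \<Rightarrow> real" and m0 :: real
  assumes cont: "continuous_on UNIV F" and supp: "\<And>x. norm x \<ge> 1 \<Longrightarrow> F x = 0"
    and m0: "m0 > 0" and mass: "(\<integral>\<^sup>+x. ennreal \<bar>F x\<bar> \<partial>lborel) \<le> ennreal m0"
begin

definition log_pot :: "complex \<Rightarrow> real" where
  "log_pot z = (\<integral>x. F x * ln (norm (x - z)) \<partial>lborel)"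

definition riesz_pot :: "complex \<Rightarrow> real" where
  "riesz_pot z = (\<integral>x. \<bar>F x\<bar> * (1 / norm (x - z)) \<partial>lborel)"

lemma F_measurable [measurable]: "F \<in> borel_measurable borel"
  using cont by (rule borel_measurable_continuous_onI)

lemma integrable_abs_F: "integrable lborel (\<lambda>x. \<bar>F x\<bar>)"
  using integrable_continuous_compact_support[OF cont supp] by simp

lemma mass_real: "(\<integral>x. \<bar>F x\<bar> \<partial>lborel) \<le> m0"
proof -
  have "ennreal (\<integral>x. \<bar>F x\<bar> \<partial>lborel) \<le> ennreal m0"
    using mass integrable_abs_F by (subst nn_integral_eq_integral[symmetric]) auto
  then show ?thesis using m0 by (subst (asm) ennreal_le_iff) auto
qed

lemma integrable_dominated:
  assumes [measurable]: "k \<in> borel_measurable borel"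
    and "\<And>x. x \<noteq> z \<Longrightarrow> norm x < 1 \<Longrightarrow> \<bar>k x\<bar> \<le> A + B * (1 / norm (x - z))"
  shows "integrable lborel (\<lambda>x. F x * k x)"
proof -
  obtain C where C: "C > 0" "\<And>x. norm (F x) \<le> C"
    using bounded_continuous_compact_support[OF cont supp] by blast
  show ?thesis
  proof (rule Bochner_Integration.integrable_bound)
    show "integrable lborel (\<lambda>x. C * (A * indicator (ball 0 1) x + B * (indicator (ball 0 1) x * (1 / norm (x - z)))))"
      by (intro integrable_mult_right Bochner_Integration.integrable_add integrable_inverse_norm)
         (auto simp: emeasure_ball intro!: integrable_real_indicator)
    have "AE x in lborel. x \<noteq> z" by (rule AE_lborel_singleton)
    then show "AE x in lborel. norm (F x * k x) \<le> norm (C * (A * indicator (ball 0 1) x + B * (indicator (ball 0 1) x * (1 / norm (x - z)))))"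
    proof eventually_elim
      case (elim x)
      show ?case
      proof (cases "norm x < 1")
        case True
        then show ?thesis
          using order_trans[OF mult_mono[OF C(2)[of x] assms(2)[OF elim True]]
              mult_left_mono[OF abs_ge_self less_imp_le[OF C(1)]]] C by (simp add: abs_mult)
      qed (use supp[of x] in simp)
    qed
  qed measurable
qed

lemma integrable_abs_dominated:
  assumes [measurable]: "k \<in> borel_measurable borel"
    and "\<And>x. x \<noteq> z \<Longrightarrow> norm x < 1 \<Longrightarrow> \<bar>k x\<bar> \<le> A + B * (1 / norm (x - z))"
    and "\<And>x. 0 \<le> k x"
  shows "integrable lborel (\<lambda>x. \<bar>F x\<bar> * k x)"
  using integrable_norm[OF integrable_dominated[OF assms(1,2)]] assms(3) by (simp add: abs_mult)

lemma integrable_log: "integrable lborel (\<lambda>x. F x * ln (norm (x - z)))"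
proof (rule integrable_dominated[where A="1 + norm z" and B=1 and z=z])
  fix x assume x: "x \<noteq> z" "norm x < 1"
  have 1: "ln (norm (x - z)) \<le> norm (x - z) - 1"
    by (rule ln_le_minus_one) (use x in simp)
  have "ln (1 / norm (x - z)) \<le> 1 / norm (x - z) - 1"
    by (rule ln_le_minus_one) (use x in simp)
  then have 2: "- ln (norm (x - z)) \<le> 1 / norm (x - z) - 1" using x by (simp add: ln_div)
  have 3: "norm (x - z) \<le> 1 + norm z" using norm_triangle_ineq4[of x z] x by simp
  have 4: "0 \<le> 1 / norm (x - z)" by simp
  show "\<bar>ln (norm (x - z))\<bar> \<le> 1 + norm z + 1 * (1 / norm (x - z))"
    unfolding abs_le_iff using 1 2 3 4 norm_ge_zero[of z] by (intro conjI) linarith+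
qed measurable

lemma integrable_riesz: "integrable lborel (\<lambda>x. \<bar>F x\<bar> * (1 / norm (x - z)))"
  by (rule integrable_abs_dominated[where A=0 and B=1 and z=z]) auto

lemma riesz_pot_nonneg: "0 \<le> riesz_pot z"
  unfolding riesz_pot_def by (rule integral_nonneg_AE) auto

lemma ennreal_riesz_pot: "ennreal (riesz_pot z) = (\<integral>\<^sup>+x. ennreal \<bar>F x\<bar> * ennreal (1 / norm (x - z)) \<partial>lborel)"
  unfolding riesz_pot_def
  by (subst nn_integral_eq_integral[OF integrable_riesz, symmetric]) (auto intro!: nn_integral_cong simp flip: ennreal_mult)

text \<open>Jensen's inequality for the sub-probability density \<open>|F| / m0\<close>, the missing mass being put at the value 0;
  \<open>s\<close> is a subgradient.\<close>

lemma charge_jensen: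
  fixes P :: "real \<Rightarrow> real"
  assumes k: "integrable lborel (\<lambda>x. \<bar>F x\<bar> * k x)" "\<And>x. 0 \<le> k x"
    and b: "b = (\<integral>x. \<bar>F x\<bar> * k x \<partial>lborel)"
    and tangent: "\<And>a. a \<ge> 0 \<Longrightarrow> P b + s * (a - b) \<le> P a" and P0: "P 0 \<ge> 0"
  shows "ennreal (P b) \<le> ennreal (P 0) + (\<integral>\<^sup>+x. ennreal (P (m0 * k x)) * ennreal (\<bar>F x\<bar> / m0) \<partial>lborel)"
proof -
  \<comment> \<open>The tangent line of P at b, evaluated at m0 * k and weighted by |F| / m0. The
    factor m0 makes the integral of m0 * k against this density equal to b.\<close>
  define h where "h x = (P b + s * (m0 * k x - b)) * (\<bar>F x\<bar> / m0)" for x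
  have heq: "h x = (P b - s * b) / m0 * \<bar>F x\<bar> + s * (\<bar>F x\<bar> * k x)" for x
    using m0 by (simp add: h_def field_simps)
  have hint: "integrable lborel h"
    unfolding heq[abs_def]
    by (intro Bochner_Integration.integrable_add integrable_mult_right integrable_abs_F k)
  define t where "t = (\<integral>x. \<bar>F x\<bar> \<partial>lborel) / m0"
  have t: "0 \<le> t" "t \<le> 1" using mass_real m0 by (auto simp: t_def)
  have "(\<integral>x. h x \<partial>lborel) = (P b - s * b) * t + s * b"
    unfolding heq t_def b
    by (subst Bochner_Integration.integral_add) (use integrable_abs_F k in \<open>auto\<close>)
  moreover have "(1 - t) * (P b - s * b) \<le> (1 - t) * P 0"
    using tangent[of 0] t by (intro mult_left_mono) auto
  moreover have "(1 - t) * P 0 \<le> P 0" using t P0 by (simp add: mult_left_le_one_le)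
  ultimately have "P b \<le> P 0 + (\<integral>x. h x \<partial>lborel)"
    by (simp add: algebra_simps)
  then have "ennreal (P b) \<le> ennreal (P 0 + (\<integral>x. h x \<partial>lborel))" by (rule ennreal_leI)
  also have "\<dots> \<le> ennreal (P 0) + ennreal (\<integral>x. h x \<partial>lborel)"
    using P0 by (cases "(\<integral>x. h x \<partial>lborel) \<ge> 0") (auto simp: ennreal_neg not_le intro!: ennreal_leI)
  also have "ennreal (\<integral>x. h x \<partial>lborel) \<le> (\<integral>\<^sup>+x. ennreal (h x) \<partial>lborel)"
    by (rule ennreal_integral_le_nn_integral[OF hint])
  also have "\<dots> \<le> (\<integral>\<^sup>+x. ennreal (P (m0 * k x)) * ennreal (\<bar>F x\<bar> / m0) \<partial>lborel)"
  proof (rule nn_integral_mono)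
    fix x
    have "h x \<le> P (m0 * k x) * (\<bar>F x\<bar> / m0)"
      unfolding h_def using tangent[of "m0 * k x"] k(2)[of x] m0 by (intro mult_right_mono) auto
    then have "ennreal (h x) \<le> ennreal (P (m0 * k x) * (\<bar>F x\<bar> / m0))" by (rule ennreal_leI)
    also have "\<dots> = ennreal (P (m0 * k x)) * ennreal (\<bar>F x\<bar> / m0)"
      using m0 by (intro ennreal_mult'') auto
    finally show "ennreal (h x) \<le> ennreal (P (m0 * k x)) * ennreal (\<bar>F x\<bar> / m0)" .
  qed
  finally show ?thesis by (simp add: add_mono)
qed

lemma nn_integral_charge_le:
  assumes "\<And>x. f x \<le> c"
  shows "(\<integral>\<^sup>+x. ennreal (\<bar>F x\<bar> / m0) * f x \<partial>lborel) \<le> c"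
proof -
  have "(\<integral>\<^sup>+x. ennreal (\<bar>F x\<bar> / m0) * f x \<partial>lborel) \<le> (\<integral>\<^sup>+x. c * ennreal (1 / m0) * ennreal \<bar>F x\<bar> \<partial>lborel)"
  proof (rule nn_integral_mono)
    fix x
    have "ennreal (1 / m0) * ennreal \<bar>F x\<bar> * f x \<le> ennreal (1 / m0) * ennreal \<bar>F x\<bar> * c"
      by (intro mult_left_mono assms) auto
    moreover have "ennreal (\<bar>F x\<bar> / m0) = ennreal (1 / m0) * ennreal \<bar>F x\<bar>"
      using m0 by (simp flip: ennreal_mult)
    ultimately show "ennreal (\<bar>F x\<bar> / m0) * f x \<le> c * ennreal (1 / m0) * ennreal \<bar>F x\<bar>"
      by (simp only: mult_ac)
  qed
  also have "\<dots> = c * ennreal (1 / m0) * (\<integral>\<^sup>+x. ennreal \<bar>F x\<bar> \<partial>lborel)"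
    by (rule nn_integral_cmult) measurable
  also have "\<dots> \<le> c * ennreal (1 / m0) * ennreal m0" by (intro mult_left_mono mass) auto
  also have "\<dots> = c" using m0 by (simp add: mult.assoc flip: ennreal_mult)
  finally show ?thesis .
qed

text \<open>Tonelli: a bound on the z-integral of the kernel that is uniform in the pole x passes to
  the average over the charge.\<close>

lemma nn_integral_charge_swap_le:
  fixes k :: "complex \<Rightarrow> complex \<Rightarrow> ennreal"
  assumes [measurable]: "case_prod k \<in> borel_measurable (borel \<Otimes>\<^sub>M borel)"
    and k: "\<And>x. (\<integral>\<^sup>+z. k x z \<partial>lborel) \<le> c"
  shows "(\<integral>\<^sup>+z. (\<integral>\<^sup>+x. ennreal (\<bar>F x\<bar> / m0) * k x z \<partial>lborel) \<partial>lborel) \<le> c"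
proof -
  have "(\<integral>\<^sup>+z. (\<integral>\<^sup>+x. ennreal (\<bar>F x\<bar> / m0) * k x z \<partial>lborel) \<partial>lborel)
      = (\<integral>\<^sup>+x. (\<integral>\<^sup>+z. ennreal (\<bar>F x\<bar> / m0) * k x z \<partial>lborel) \<partial>lborel)"
    by (rule lborel_pair.Fubini') measurable
  also have "\<dots> = (\<integral>\<^sup>+x. ennreal (\<bar>F x\<bar> / m0) * (\<integral>\<^sup>+z. k x z \<partial>lborel) \<partial>lborel)"
    by (intro nn_integral_cong nn_integral_cmult) measurable
  also have "\<dots> \<le> c" by (rule nn_integral_charge_le[OF k])
  finally show ?thesis .
qed

section \<open>Derivative of the logarithmic potential and norms of its Riesz majorant\<close>

text \<open>Translating the variable of integration puts the singularity at the origin for every z,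
  so that only the continuous factor \<open>F\<close> moves and dominated convergence
  applies.\<close>

lemma riesz_pot_sequence:
  assumes h: "h \<longlonglongrightarrow> 0" "\<And>n. norm (h n) \<le> 1"
  shows "(\<lambda>n. riesz_pot (z + h n)) \<longlonglongrightarrow> riesz_pot z"
proof -
  obtain C where C: "C > 0" "\<And>x. norm (F x) \<le> C"
    using bounded_continuous_compact_support[OF cont supp] by blast
  have eq: "riesz_pot w = (\<integral>y. \<bar>F (w + y)\<bar> * (1 / norm y) \<partial>lborel)" for w
    unfolding riesz_pot_def by (subst lborel_integral_shift[of _ w, symmetric]) (auto simp: algebra_simps)
  let ?r = "norm z + 3"
  show ?thesis unfolding eq
  proof (rule integral_dominated_convergence[where w="\<lambda>y. C * (indicator (ball 0 ?r) y * (1 / norm (y - 0)))"])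
    show "integrable lborel (\<lambda>y::complex. C * (indicator (ball 0 ?r) y * (1 / norm (y - 0))))"
      by (intro integrable_mult_right integrable_inverse_norm)
    show "AE y in lborel. (\<lambda>n. \<bar>F (z + h n + y)\<bar> * (1 / norm y)) \<longlonglongrightarrow> \<bar>F (z + y)\<bar> * (1 / norm y)"
    proof (rule AE_I2)
      fix y
      have "(\<lambda>n. z + h n + y) \<longlonglongrightarrow> z + 0 + y" by (intro tendsto_intros h)
      then have "(\<lambda>n. F (z + h n + y)) \<longlonglongrightarrow> F (z + y)"
        using continuous_on_tendsto_compose[OF cont, of "\<lambda>n. z + h n + y" "z + y" sequentially] by simp
      then show "(\<lambda>n. \<bar>F (z + h n + y)\<bar> * (1 / norm y)) \<longlonglongrightarrow> \<bar>F (z + y)\<bar> * (1 / norm y)"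
        by (intro tendsto_intros)
    qed
    show "AE y in lborel. norm (\<bar>F (z + h n + y)\<bar> * (1 / norm y)) \<le> C * (indicator (ball 0 ?r) y * (1 / norm (y - 0)))" for n
    proof (rule AE_I2)
      fix y
      have "F (z + h n + y) = 0" if "norm y \<ge> ?r"
      proof (rule supp)
        have "norm y \<le> norm (z + h n + y) + norm (z + h n)"
          by (metis add.commute add_diff_cancel_left' norm_triangle_ineq4)
        moreover have "norm (z + h n) \<le> norm z + 1" by (intro norm_triangle_mono h order_refl)
        ultimately show "1 \<le> norm (z + h n + y)" using that by linarith
      qed
      then show "norm (\<bar>F (z + h n + y)\<bar> * (1 / norm y)) \<le> C * (indicator (ball 0 ?r) y * (1 / norm (y - 0)))"
        using C(2)[of "z + h n + y"] by (cases "norm y < ?r") (auto intro!: divide_right_mono)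
    qed
  qed measurable
qed

lemma abs_log_pot_diff_le:
  "\<bar>log_pot (z + h) - log_pot z\<bar> \<le> norm h * (riesz_pot (z + h) + riesz_pot z)"
proof -
  have "\<bar>log_pot (z + h) - log_pot z\<bar> = \<bar>\<integral>x. F x * ln (norm (x - (z + h))) - F x * ln (norm (x - z)) \<partial>lborel\<bar>"
    unfolding log_pot_def by (subst Bochner_Integration.integral_diff[OF integrable_log integrable_log]) simp
  also have "\<dots> \<le> (\<integral>x. norm h * (\<bar>F x\<bar> * (1 / norm (x - (z + h))) + \<bar>F x\<bar> * (1 / norm (x - z))) \<partial>lborel)"
  proof (rule order_trans[OF integral_abs_bound], rule integral_mono_AE)
    have "AE x in lborel. x \<noteq> z" "AE x in lborel. x \<noteq> z + h" by (rule AE_lborel_singleton)+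
    then show "AE x in lborel. \<bar>F x * ln (norm (x - (z + h))) - F x * ln (norm (x - z))\<bar>
       \<le> norm h * (\<bar>F x\<bar> * (1 / norm (x - (z + h))) + \<bar>F x\<bar> * (1 / norm (x - z)))"
    proof eventually_elim
      case (elim x)
      have "\<bar>ln (norm (x - (z + h))) - ln (norm (x - z))\<bar>
         \<le> \<bar>norm (x - (z + h)) - norm (x - z)\<bar> * (1 / norm (x - (z + h)) + 1 / norm (x - z))"
        by (rule abs_ln_diff_le) (use elim in auto)
      also have "\<dots> \<le> norm h * (1 / norm (x - (z + h)) + 1 / norm (x - z))"
        using norm_triangle_ineq3[of "x - (z + h)" "x - z"] by (intro mult_right_mono) auto
      finally have "\<bar>F x\<bar> * \<bar>ln (norm (x - (z + h))) - ln (norm (x - z))\<bar> \<le> \<bar>F x\<bar> * (norm h * (1 / norm (x - (z + h)) + 1 / norm (x - z)))"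
        by (intro mult_left_mono) auto
      then show ?case unfolding right_diff_distrib[symmetric] abs_mult by (simp add: algebra_simps)
    qed
  qed (intro integrable_abs Bochner_Integration.integrable_diff integrable_log
      integrable_mult_right Bochner_Integration.integrable_add integrable_riesz)+
  also have "\<dots> = norm h * (riesz_pot (z + h) + riesz_pot z)"
    unfolding riesz_pot_def
    by (subst integral_mult_right_zero, subst Bochner_Integration.integral_add[OF integrable_riesz integrable_riesz]) simp
  finally show ?thesis .
qed

text \<open>Difference quotients in a unit direction are at most the sum of the Riesz potentials at
  both ends, and this sum tends to \<open>2 * riesz_pot z\<close>; hence the factor 2.
  Differentiability is assumed here and will be inferred from that of \<open>u\<close> and
  \<open>Re G\<close>.\<close>

lemma has_derivative_log_pot_le:
  assumes D: "(log_pot has_derivative D) (at z)"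
  shows "\<bar>D b\<bar> \<le> 2 * riesz_pot z * norm b"
proof -
  interpret D: bounded_linear D using D by (rule has_derivative_bounded_linear)
  have unit: "\<bar>D v\<bar> \<le> 2 * riesz_pot z" if v: "norm v = 1" for v
  proof (rule LIMSEQ_le)
    define h where "h n = 1 / real (Suc n)" for n
    have h: "0 < h n" "h n \<le> 1" for n by (auto simp: h_def)
    have h0: "h \<longlonglongrightarrow> 0" unfolding h_def by (rule LIMSEQ_Suc[OF lim_1_over_n])
    have "((\<lambda>t::real. z + t *\<^sub>R v) has_derivative (\<lambda>t. t *\<^sub>R v)) (at 0)"
      by (auto intro!: derivative_eq_intros)
    then have "((\<lambda>t. log_pot (z + t *\<^sub>R v)) has_derivative (\<lambda>t. D (t *\<^sub>R v))) (at 0)"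
      by (rule has_derivative_compose) (use D in simp)
    then have "((\<lambda>t. log_pot (z + t *\<^sub>R v)) has_real_derivative D v) (at 0)"
      by (simp add: has_field_derivative_def D.scaleR mult.commute[of _ "D v"])
    then have "((\<lambda>t. (log_pot (z + t *\<^sub>R v) - log_pot z) / t) \<longlongrightarrow> D v) (at 0)"
      by (simp add: DERIV_def)
    then have "(\<lambda>n. (log_pot (z + h n *\<^sub>R v) - log_pot z) / h n) \<longlonglongrightarrow> D v"
      by (rule filterlim_compose) (use h h0 in \<open>auto simp: filterlim_at order_less_imp_not_eq2\<close>)
    then show "(\<lambda>n. \<bar>(log_pot (z + h n *\<^sub>R v) - log_pot z) / h n\<bar>) \<longlonglongrightarrow> \<bar>D v\<bar>"
      by (rule tendsto_rabs)
    have "(\<lambda>n. h n *\<^sub>R v) \<longlonglongrightarrow> 0 *\<^sub>R v" by (intro tendsto_intros h0)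
    then have "(\<lambda>n. riesz_pot (z + h n *\<^sub>R v)) \<longlonglongrightarrow> riesz_pot z"
      by (intro riesz_pot_sequence) (use h v in \<open>auto simp: less_imp_le\<close>)
    then have "(\<lambda>n. riesz_pot (z + h n *\<^sub>R v) + riesz_pot z) \<longlonglongrightarrow> riesz_pot z + riesz_pot z"
      by (intro tendsto_intros)
    then show "(\<lambda>n. riesz_pot (z + h n *\<^sub>R v) + riesz_pot z) \<longlonglongrightarrow> 2 * riesz_pot z" by simp
    show "\<exists>N. \<forall>n\<ge>N. \<bar>(log_pot (z + h n *\<^sub>R v) - log_pot z) / h n\<bar> \<le> riesz_pot (z + h n *\<^sub>R v) + riesz_pot z"
    proof (intro exI allI impI)
      fix n
      show "\<bar>(log_pot (z + h n *\<^sub>R v) - log_pot z) / h n\<bar> \<le> riesz_pot (z + h n *\<^sub>R v) + riesz_pot z"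
        using abs_log_pot_diff_le[of z "h n *\<^sub>R v"] h(1)[of n] v
        by (simp add: abs_divide divide_le_eq mult.commute)
    qed
  qed
  show ?thesis
  proof (cases "b = 0")
    case False
    have "D b = norm b * D (b /\<^sub>R norm b)" using False by (simp add: D.scaleR)
    then have "\<bar>D b\<bar> = norm b * \<bar>D (b /\<^sub>R norm b)\<bar>" by (simp add: abs_mult)
    also have "\<dots> \<le> norm b * (2 * riesz_pot z)" by (intro mult_left_mono unit) (use False in auto)
    finally show ?thesis by (simp add: mult_ac)
  qed (simp add: D.zero)
qed

lemma riesz_pot_measurable [measurable]: "riesz_pot \<in> borel_measurable borel"
  unfolding riesz_pot_def[abs_def] by measurable

text \<open>By Fubini, integrating the potential over the superlevel set bounds its area.\<close>

lemma riesz_pot_weak_L2: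
  assumes s: "s > 0" and E [measurable]: "E \<in> sets borel" and fin: "emeasure lborel E < \<infinity>"
    and ge: "\<And>z. z \<in> E \<Longrightarrow> s \<le> riesz_pot z"
  shows "s * sqrt (measure lborel E) \<le> m0 * (riesz_const 1 + 1)"
proof (cases "measure lborel E = 0")
  case True
  then show ?thesis using m0 by (simp add: add_nonneg_pos less_imp_le)
next
  case False
  define e where "e = measure lborel E"
  have e: "e > 0" "emeasure lborel E = ennreal e"
    using False fin by (auto simp: e_def emeasure_eq_ennreal_measure less_top zero_less_measure_iff)
  \<comment> \<open>This radius balances the split integral: the inner part is a multiple of r, and
    the outer part e / r equals r.\<close>
  define r where "r = sqrt e"
  have r: "r > 0" "e = r * r" using e by (auto simp: r_def)
  have "ennreal (s * e) = (\<integral>\<^sup>+z\<in>E. ennreal s \<partial>lborel)"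
    using s e by (simp add: nn_integral_cmult_indicator ennreal_mult)
  also have "\<dots> \<le> (\<integral>\<^sup>+z. (\<integral>\<^sup>+x. ennreal (\<bar>F x\<bar> / m0) * (ennreal m0 * (ennreal (norm (z - x) powr (-1)) * indicator E z)) \<partial>lborel) \<partial>lborel)"
  proof (rule nn_integral_mono)
    fix z
    have "ennreal s * indicator E z \<le> ennreal (riesz_pot z) * indicator E z"
      using ge by (auto simp: indicator_def intro!: ennreal_leI)
    also have "\<dots> = (\<integral>\<^sup>+x. ennreal \<bar>F x\<bar> * ennreal (1 / norm (x - z)) * indicator E z \<partial>lborel)"
      unfolding ennreal_riesz_pot by (rule nn_integral_multc[symmetric]) measurable
    also have "\<dots> = (\<integral>\<^sup>+x. ennreal (\<bar>F x\<bar> / m0) * (ennreal m0 * (ennreal (norm (z - x) powr (-1)) * indicator E z)) \<partial>lborel)"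
      using m0 by (intro nn_integral_cong)
        (simp add: powr_minus_divide norm_minus_commute mult.assoc[symmetric] ennreal_mult[symmetric])
    finally show "ennreal s * indicator E z \<le> \<dots>" .
  qed
  also have "\<dots> \<le> ennreal m0 * (ennreal (riesz_const 1 * r powr (2 - 1)) + ennreal (r powr (-1)) * ennreal e)"
  proof (rule nn_integral_charge_swap_le)
    show "(\<integral>\<^sup>+z. ennreal m0 * (ennreal (norm (z - x) powr (-1)) * indicator E z) \<partial>lborel)
        \<le> ennreal m0 * (ennreal (riesz_const 1 * r powr (2 - 1)) + ennreal (r powr (-1)) * ennreal e)" for x
      by (subst nn_integral_cmult, measurable, intro mult_left_mono nn_integral_norm_powr_le) (use r e in auto)
  qed measurable
  also have "\<dots> = ennreal (m0 * ((riesz_const 1 + 1) * r))"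
    using r m0 e by (simp add: powr_minus_divide algebra_simps flip: ennreal_mult ennreal_plus)
  finally have "s * e \<le> m0 * ((riesz_const 1 + 1) * r)"
    using m0 r by (subst (asm) ennreal_le_iff) auto
  then have "r * (s * r) \<le> r * (m0 * (riesz_const 1 + 1))" using r by (simp add: mult_ac)
  then have "s * r \<le> m0 * (riesz_const 1 + 1)" using r by simp
  then show ?thesis by (simp add: r_def e_def)
qed

text \<open>Jensen's inequality for the convex function a powr p moves the power onto the kernel,
  and |z - x| powr (-p) is integrable over a disk since p < 2.\<close>

lemma riesz_pot_Lp:
  assumes p: "1 < p" "p < 2"
  shows "(\<integral>\<^sup>+z\<in>ball 0 (1/2). ennreal (riesz_pot z powr p) \<partial>lborel)
    \<le> ennreal (m0 powr p * ((riesz_const p + pi) * (1/2) powr (2 - p)))"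
proof -
  let ?B = "ball (0::complex) (1/2)"
  let ?k = "\<lambda>x z. ennreal (m0 powr p) * (ennreal (norm (z - x) powr (-p)) * indicator ?B z)"
  have "(\<integral>\<^sup>+z\<in>?B. ennreal (riesz_pot z powr p) \<partial>lborel)
     \<le> (\<integral>\<^sup>+z. (\<integral>\<^sup>+x. ennreal (\<bar>F x\<bar> / m0) * ?k x z \<partial>lborel) \<partial>lborel)"
  proof (rule nn_integral_mono)
    fix z
    have "ennreal (riesz_pot z powr p) \<le> ennreal (0 powr p) + (\<integral>\<^sup>+x. ennreal ((m0 * (1 / norm (x - z))) powr p) * ennreal (\<bar>F x\<bar> / m0) \<partial>lborel)"
      by (rule charge_jensen[OF integrable_riesz, where P="\<lambda>a. a powr p" and s="p * riesz_pot z powr (p - 1)"])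
        (use p riesz_pot_nonneg[of z] powr_tangent in \<open>auto simp: riesz_pot_def\<close>)
    also have "\<dots> = (\<integral>\<^sup>+x. ennreal (\<bar>F x\<bar> / m0) * (ennreal (m0 powr p) * ennreal (norm (z - x) powr (-p))) \<partial>lborel)"
    proof -
      have "(m0 * (1 / norm (x - z))) powr p = m0 powr p * norm (z - x) powr (-p)" for x
        using m0 by (simp add: powr_divide powr_minus_divide norm_minus_commute)
      then show ?thesis by (simp add: ennreal_mult mult_ac)
    qed
    finally show "ennreal (riesz_pot z powr p) * indicator ?B z \<le> (\<integral>\<^sup>+x. ennreal (\<bar>F x\<bar> / m0) * ?k x z \<partial>lborel)"
      by (cases "z \<in> ?B") simp_all
  qed
  also have "\<dots> \<le> ennreal (m0 powr p) * ennreal ((riesz_const p + pi) * (1/2) powr (2 - p))"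
  proof (rule nn_integral_charge_swap_le)
    show "(\<integral>\<^sup>+z. ?k x z \<partial>lborel) \<le> ennreal (m0 powr p) * ennreal ((riesz_const p + pi) * (1/2) powr (2 - p))" for x
      by (subst nn_integral_cmult, measurable, intro mult_left_mono nn_integral_norm_powr_ball_le) (use p in auto)
  qed measurable
  also have "\<dots> = ennreal (m0 powr p * ((riesz_const p + pi) * (1/2) powr (2 - p)))"
    by (rule ennreal_mult[symmetric]) auto
  finally show ?thesis .
qed

end

section \<open>Exponential integrability around means\<close>

text \<open>The 5 is the constant part of the pointwise exponential estimate, integrated over a disk
  of area \<pi> s^2; the other term comes from its kernel 4 (s / |x - y|)^(1/2).\<close>

definition exp_const :: real where
  "exp_const = 5 * pi + 4 * (riesz_const (1/2) + pi)"

lemma exp_const_pos: "exp_const > 0"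
  unfolding exp_const_def by (intro add_pos_nonneg) (auto simp: pi_gt_zero)

context planar_charge
begin

text \<open>By Fubini this is the mean of \<open>log_pot\<close> over the circle of radius \<rho>
  about z0, since the circular mean of ln |x - z| is ln max(|x - z0|, \<rho>).\<close>

definition log_mean :: "complex \<Rightarrow> real \<Rightarrow> real" where
  "log_mean z0 \<rho> = (\<integral>x. F x * ln (max (norm (x - z0)) \<rho>) \<partial>lborel)"

lemma integrable_log_mean:
  assumes "\<rho> > 0"
  shows "integrable lborel (\<lambda>x. F x * ln (max (norm (x - z0)) \<rho>))"
proof (rule integrable_dominated[where A="\<bar>ln \<rho>\<bar> + 1 + norm z0" and B=0 and z=0])
  fix x :: complex assume x: "norm x < 1"
  have le: "norm (x - z0) \<le> 1 + norm z0" using norm_triangle_ineq4[of x z0] x by simp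
  have "ln (norm (x - z0)) \<le> norm (x - z0) - 1" "ln \<rho> \<le> ln (norm (x - z0))" if "norm (x - z0) > \<rho>"
  proof -
    have "norm (x - z0) > 0" using that assms by linarith
    then show "ln (norm (x - z0)) \<le> norm (x - z0) - 1" "ln \<rho> \<le> ln (norm (x - z0))"
      using that assms ln_le_cancel_iff[of \<rho> "norm (x - z0)"] by (auto intro: ln_le_minus_one simp del: zero_less_norm_iff)
  qed
  note norms = this
  have ge: "0 \<le> norm z0" "ln \<rho> \<le> \<bar>ln \<rho>\<bar>" "- ln \<rho> \<le> \<bar>ln \<rho>\<bar>" by auto
  show "\<bar>ln (max (norm (x - z0)) \<rho>)\<bar> \<le> \<bar>ln \<rho>\<bar> + 1 + norm z0 + 0 * (1 / norm (x - 0))"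
  proof (cases "\<rho> < norm (x - z0)")
    case True
    then have m: "max (norm (x - z0)) \<rho> = norm (x - z0)" by simp
    show ?thesis unfolding m abs_le_iff using le norms[OF True] ge by (intro conjI) linarith+
  next
    case False
    then have m: "max (norm (x - z0)) \<rho> = \<rho>" by simp
    show ?thesis unfolding m abs_le_iff using ge by (intro conjI) linarith+
  qed
qed measurable

lemma integrable_log_excess:
  assumes "\<rho> > 0"
  shows "integrable lborel (\<lambda>x. \<bar>F x\<bar> * ln (max 2 (2 * \<rho> / norm (x - y))))"
proof (rule integrable_abs_dominated[where A=1 and B="2 * \<rho>" and z=y])
  fix x
  have "ln (max 2 (2 * \<rho> / norm (x - y))) \<le> max 2 (2 * \<rho> / norm (x - y)) - 1"
    by (rule ln_le_minus_one) auto
  also have "\<dots> \<le> 1 + 2 * \<rho> * (1 / norm (x - y))"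
    using assms by (auto simp: max_def)
  finally show "\<bar>ln (max 2 (2 * \<rho> / norm (x - y)))\<bar> \<le> 1 + 2 * \<rho> * (1 / norm (x - y))"
    by simp
qed auto

text \<open>Compare |x - y| with M = max(|x - z0|, \<rho>): always |x - y| <= 2 M, while M <= 2 |x -
  y| if x has distance at least 2 \<rho> from z0, and M <= 2 \<rho> otherwise. So only charge near y
  is weighted by more than ln 2.\<close>

lemma abs_log_pot_minus_mean_le:
  assumes \<rho>: "\<rho> > 0" and y: "norm (y - z0) < \<rho>"
  shows "\<bar>log_pot y - log_mean z0 \<rho>\<bar> \<le> (\<integral>x. \<bar>F x\<bar> * ln (max 2 (2 * \<rho> / norm (x - y))) \<partial>lborel)"
proof -
  have "\<bar>log_pot y - log_mean z0 \<rho>\<bar> = \<bar>\<integral>x. F x * ln (norm (x - y)) - F x * ln (max (norm (x - z0)) \<rho>) \<partial>lborel\<bar>"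
    unfolding log_pot_def log_mean_def
    by (subst Bochner_Integration.integral_diff[OF integrable_log integrable_log_mean[OF \<rho>]]) simp
  also have "\<dots> \<le> (\<integral>x. \<bar>F x\<bar> * ln (max 2 (2 * \<rho> / norm (x - y))) \<partial>lborel)"
  proof (rule order_trans[OF integral_abs_bound], rule integral_mono_AE)
    have "AE x in lborel. x \<noteq> y" by (rule AE_lborel_singleton)
    then show "AE x in lborel. \<bar>F x * ln (norm (x - y)) - F x * ln (max (norm (x - z0)) \<rho>)\<bar>
       \<le> \<bar>F x\<bar> * ln (max 2 (2 * \<rho> / norm (x - y)))"
    proof eventually_elim
      case (elim x)
      define M where "M = max (norm (x - z0)) \<rho>"
      define r where "r = norm (x - y)"
      have pos: "r > 0" "M > 0" using elim \<rho> by (auto simp: r_def M_def)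
      have tri: "r \<le> norm (x - z0) + norm (y - z0)" "norm (x - z0) \<le> r + norm (y - z0)"
        using norm_triangle_ineq4[of "x - z0" "y - z0"] norm_triangle_ineq[of "x - y" "y - z0"]
        by (auto simp: r_def)
      have "ln r \<le> ln (2 * M)" using tri y pos by (auto simp: M_def max_def)
      then have 1: "ln r - ln M \<le> ln (max 2 (2 * \<rho> / r))"
        using pos by (simp add: ln_mult) (smt (verit) ln_le_cancel_iff max.cobounded1 pos)
      have "M \<le> r * max 2 (2 * \<rho> / r)"
      proof (cases "norm (x - z0) \<ge> 2 * \<rho>")
        case True
        then have "M \<le> r * 2" using tri y \<rho> by (auto simp: M_def max_def)
        also have "\<dots> \<le> r * max 2 (2 * \<rho> / r)" using pos by (intro mult_left_mono) auto
        finally show ?thesis .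
      next
        case False
        then have "M \<le> r * (2 * \<rho> / r)" using \<rho> pos by (auto simp: M_def)
        also have "\<dots> \<le> r * max 2 (2 * \<rho> / r)" using pos by (intro mult_left_mono) auto
        finally show ?thesis .
      qed
      then have "ln M \<le> ln (r * max 2 (2 * \<rho> / r))" using pos by (subst ln_le_cancel_iff) auto
      also have "\<dots> = ln r + ln (max 2 (2 * \<rho> / r))" using pos by (simp add: ln_mult less_max_iff_disj order_less_imp_not_eq2)
      finally have 2: "ln M - ln r \<le> ln (max 2 (2 * \<rho> / r))" by simp
      have "\<bar>F x\<bar> * \<bar>ln r - ln M\<bar> \<le> \<bar>F x\<bar> * ln (max 2 (2 * \<rho> / r))"
        using 1 2 by (intro mult_left_mono) (auto simp: abs_le_iff)
      then show ?case
        unfolding right_diff_distrib[symmetric] abs_mult by (simp add: r_def M_def)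
    qed
  qed (intro integrable_abs Bochner_Integration.integrable_diff integrable_log integrable_log_mean \<rho> integrable_log_excess)+
  finally show ?thesis .
qed

text \<open>Smallness of the charge enters here. The enlargement factor R is split off and costs
  \<open>R powr (2 * m0) \<le> 2\<close>; the remaining base is at least 2, so its exponent 2 * m0
  may be raised to 1/2. The result depends neither on R nor on m0, and its kernel r^(-1/2) is
  integrable.\<close>

lemma powr_log_excess_le:
  fixes r s R :: real
  assumes "r \<ge> 0" "s > 0" "R \<ge> 1" "2 * m0 \<le> 1/2" "R powr (2 * m0) \<le> 2"
  shows "max 2 (2 * (R * s) / r) powr (2 * m0) \<le> 4 + 4 * s powr (1/2) * r powr (-1/2)"
proof -
  define w where "w = max 2 (2 * s / r)"
  have w: "w \<ge> 2" by (simp add: w_def)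
  have "2 * (R * s) / r = R * (2 * s / r)" by simp
  also have "\<dots> \<le> R * w" unfolding w_def using assms by (intro mult_left_mono) auto
  finally have "max 2 (2 * (R * s) / r) \<le> R * w"
    using assms mult_mono[of 1 R 2 w] w by simp
  then have "max 2 (2 * (R * s) / r) powr (2 * m0) \<le> (R * w) powr (2 * m0)"
    using m0 by (intro powr_mono2) auto
  also have "\<dots> = R powr (2 * m0) * w powr (2 * m0)"
    using assms w by (simp add: powr_mult)
  also have "\<dots> \<le> 2 * w powr (1/2)"
    using assms w by (intro mult_mono powr_mono) auto
  also have "w powr (1/2) \<le> 2 + 2 * (s powr (1/2) * r powr (-1/2))"
  proof (cases "2 * s / r \<le> 2")
    \<comment> \<open>This case includes r = 0, where the quotient is 0 by convention.\<close>
    case True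
    have "sqrt 2 \<le> sqrt 4" by (rule real_sqrt_le_mono) simp
    then have "w powr (1/2) \<le> 2" using True by (simp add: w_def powr_half_sqrt max_def)
    moreover have "0 \<le> 2 * (s powr (1/2) * r powr (-1/2))" by simp
    ultimately show ?thesis by linarith
  next
    case False
    have "sqrt 2 \<le> sqrt 4" by (rule real_sqrt_le_mono) simp
    then have s2: "2 powr (1/2) \<le> (2::real)" by (simp add: powr_half_sqrt)
    have r: "r > 0" using False assms by (cases "r = 0") auto
    have "w powr (1/2) = 2 powr (1/2) * (s powr (1/2) * r powr (-1/2))"
      using False assms r by (simp add: w_def powr_mult powr_divide powr_minus_divide)
    also have "\<dots> \<le> 2 * (s powr (1/2) * r powr (-1/2))"
      by (intro mult_right_mono s2) simp
    finally show ?thesis by simp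
  qed
  finally show ?thesis by simp
qed

text \<open>Jensen's inequality for exp (2 a): the exponential of the averaged logarithm is at most
  the average of max(2, 2 R s / |x - y|) powr (2 * m0), which the preceding bound controls. The
  constant 5 is the 4 of that bound plus exp 0 = 1 for the missing mass.\<close>

lemma exp_log_pot_le:
  assumes s: "s > 0" and R: "R \<ge> 1" "2 * m0 \<le> 1/2" "R powr (2 * m0) \<le> 2"
    and y: "norm (y - z0) < R * s"
  shows "ennreal (exp (2 * \<bar>log_pot y - log_mean z0 (R * s)\<bar>))
    \<le> 5 + (\<integral>\<^sup>+x. ennreal (\<bar>F x\<bar> / m0) * ennreal (4 * s powr (1/2) * norm (x - y) powr (-1/2)) \<partial>lborel)"
proof -
  let ?k = "\<lambda>x. ln (max 2 (2 * (R * s) / norm (x - y)))"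
  have Rs: "R * s > 0" using s R by simp
  have "ennreal (exp (2 * \<bar>log_pot y - log_mean z0 (R * s)\<bar>)) \<le> ennreal (exp (2 * (\<integral>x. \<bar>F x\<bar> * ?k x \<partial>lborel)))"
    using abs_log_pot_minus_mean_le[OF Rs y] by (intro ennreal_leI) simp
  also have "\<dots> \<le> ennreal (exp (2 * 0)) + (\<integral>\<^sup>+x. ennreal (exp (2 * (m0 * ?k x))) * ennreal (\<bar>F x\<bar> / m0) \<partial>lborel)"
  proof (rule charge_jensen[OF integrable_log_excess[OF Rs], where P="\<lambda>a. exp (2 * a)"])
    fix a :: real
    let ?b = "\<integral>x. \<bar>F x\<bar> * ?k x \<partial>lborel"
    have "exp (2 * ?b) * (1 + 2 * (a - ?b)) \<le> exp (2 * ?b) * exp (2 * (a - ?b))"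
      by (intro mult_left_mono exp_ge_add_one_self) auto
    also have "\<dots> = exp (2 * a)" by (simp add: exp_add[symmetric] algebra_simps)
    finally show "exp (2 * ?b) + (2 * exp (2 * ?b)) * (a - ?b) \<le> exp (2 * a)"
      by (simp add: algebra_simps)
  qed auto
  also have "\<dots> \<le> 1 + (\<integral>\<^sup>+x. ennreal (\<bar>F x\<bar> / m0) * 4 + ennreal (\<bar>F x\<bar> / m0) * ennreal (4 * s powr (1/2) * norm (x - y) powr (-1/2)) \<partial>lborel)"
  proof (intro add_mono nn_integral_mono)
    fix x
    have "exp (2 * (m0 * ?k x)) = max 2 (2 * (R * s) / norm (x - y)) powr (2 * m0)"
    proof -
      have "max 2 (2 * (R * s) / norm (x - y)) > 0" by (simp add: less_max_iff_disj)
      then show ?thesis by (simp add: powr_def mult_ac)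
    qed
    also have "\<dots> \<le> 4 + 4 * s powr (1/2) * norm (x - y) powr (-1/2)"
      by (rule powr_log_excess_le) (use s R in auto)
    finally have "ennreal (exp (2 * (m0 * ?k x))) \<le> ennreal (4 + 4 * s powr (1/2) * norm (x - y) powr (-1/2))"
      by (rule ennreal_leI)
    also have "\<dots> = 4 + ennreal (4 * s powr (1/2) * norm (x - y) powr (-1/2))"
      by (subst ennreal_plus) auto
    finally show "ennreal (exp (2 * (m0 * ?k x))) * ennreal (\<bar>F x\<bar> / m0) \<le>
       ennreal (\<bar>F x\<bar> / m0) * 4 + ennreal (\<bar>F x\<bar> / m0) * ennreal (4 * s powr (1/2) * norm (x - y) powr (-1/2))"
      by (subst mult.commute) (simp add: distrib_left[symmetric] mult_left_mono)
  qed auto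
  also have "\<dots> = 1 + ((\<integral>\<^sup>+x. ennreal (\<bar>F x\<bar> / m0) * 4 \<partial>lborel)
     + (\<integral>\<^sup>+x. ennreal (\<bar>F x\<bar> / m0) * ennreal (4 * s powr (1/2) * norm (x - y) powr (-1/2)) \<partial>lborel))"
    by (subst nn_integral_add) auto
  also have "\<dots> \<le> 1 + (4 + (\<integral>\<^sup>+x. ennreal (\<bar>F x\<bar> / m0) * ennreal (4 * s powr (1/2) * norm (x - y) powr (-1/2)) \<partial>lborel))"
    by (intro add_mono order_refl nn_integral_charge_le)
  also have "\<dots> = 5 + (\<integral>\<^sup>+x. ennreal (\<bar>F x\<bar> / m0) * ennreal (4 * s powr (1/2) * norm (x - y) powr (-1/2)) \<partial>lborel)"
    by (simp add: add.assoc[symmetric])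
  finally show ?thesis .
qed

text \<open>For varying t the points p + t (m - p) run through the segment from p to m, so this is
  the exponential moment at a fixed fraction of all segments issuing from p. The homothety scales
  distances to a pole by t, and the resulting factor t^(-1/2) is integrable over (0, 1].\<close>

lemma nn_integral_exp_log_pot_le:
  assumes s: "s > 0" and R: "R \<ge> 1" "2 * m0 \<le> 1/2" "R powr (2 * m0) \<le> 2"
    and t: "0 < t" "t \<le> 1"
    and y: "\<And>m. m \<in> ball y0 s \<Longrightarrow> norm (p + t *\<^sub>R (m - p) - z0) < R * s"
  shows "(\<integral>\<^sup>+m\<in>ball y0 s. ennreal (exp (2 * \<bar>log_pot (p + t *\<^sub>R (m - p)) - log_mean z0 (R * s)\<bar>)) \<partial>lborel)
     \<le> ennreal (exp_const * s\<^sup>2 * t powr (-1/2))"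
proof -
  let ?B = "ball y0 s"
  let ?K = "\<lambda>x m. ennreal (4 * s powr (1/2) * norm (x - (p + t *\<^sub>R (m - p))) powr (-1/2))"
  have "(\<integral>\<^sup>+m\<in>?B. ennreal (exp (2 * \<bar>log_pot (p + t *\<^sub>R (m - p)) - log_mean z0 (R * s)\<bar>)) \<partial>lborel)
    \<le> (\<integral>\<^sup>+m. 5 * indicator ?B m + (\<integral>\<^sup>+x. ennreal (\<bar>F x\<bar> / m0) * (?K x m * indicator ?B m) \<partial>lborel) \<partial>lborel)"
  proof (rule nn_integral_mono)
    fix m
    show "ennreal (exp (2 * \<bar>log_pot (p + t *\<^sub>R (m - p)) - log_mean z0 (R * s)\<bar>)) * indicator ?B m
      \<le> 5 * indicator ?B m + (\<integral>\<^sup>+x. ennreal (\<bar>F x\<bar> / m0) * (?K x m * indicator ?B m) \<partial>lborel)"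
      using exp_log_pot_le[OF s R y[of m]] by (cases "m \<in> ?B") auto
  qed
  also have "\<dots> = (\<integral>\<^sup>+m. 5 * indicator ?B m \<partial>lborel)
      + (\<integral>\<^sup>+m. (\<integral>\<^sup>+x. ennreal (\<bar>F x\<bar> / m0) * (?K x m * indicator ?B m) \<partial>lborel) \<partial>lborel)"
    by (rule nn_integral_add) measurable
  also have "(\<integral>\<^sup>+m. 5 * indicator ?B m \<partial>lborel) = ennreal (5 * (pi * s\<^sup>2))"
    using s by (subst nn_integral_cmult_indicator) (auto simp: emeasure_ball_complex ennreal_mult)
  also have "(\<integral>\<^sup>+m. (\<integral>\<^sup>+x. ennreal (\<bar>F x\<bar> / m0) * (?K x m * indicator ?B m) \<partial>lborel) \<partial>lborel)
    \<le> ennreal (4 * (riesz_const (1/2) + pi) * s\<^sup>2 * t powr (-1/2))"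
  proof (rule nn_integral_charge_swap_le)
    fix x
    \<comment> \<open>The preimage of the pole x under the homothety.\<close>
    define w where "w = p + (1 / t) *\<^sub>R (x - p)"
    have "x - (p + t *\<^sub>R (m - p)) = - (t *\<^sub>R (m - w))" for m
      using t by (simp add: w_def algebra_simps)
    then have nrm: "norm (x - (p + t *\<^sub>R (m - p))) = t * norm (m - w)" for m
      using t by simp
    have "(\<integral>\<^sup>+m. ?K x m * indicator ?B m \<partial>lborel)
       = (\<integral>\<^sup>+m. ennreal (4 * s powr (1/2) * t powr (-1/2)) * (ennreal (norm (m - w) powr (-(1/2))) * indicator ?B m) \<partial>lborel)"
    proof (rule nn_integral_cong)
      fix m
      have "4 * s powr (1/2) * (t * norm (m - w)) powr (-1/2) = (4 * s powr (1/2) * t powr (-1/2)) * norm (m - w) powr (-(1/2))"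
        using t by (simp add: powr_mult)
      then have "?K x m = ennreal (4 * s powr (1/2) * t powr (-1/2)) * ennreal (norm (m - w) powr (-(1/2)))"
        unfolding nrm by (subst ennreal_mult[symmetric]) (auto simp only: zero_le_mult_iff powr_ge_zero zero_le_numeral simp_thms)
      then show "?K x m * indicator ?B m = ennreal (4 * s powr (1/2) * t powr (-1/2)) * (ennreal (norm (m - w) powr (-(1/2))) * indicator ?B m)"
        by (simp only: mult.assoc)
    qed
    also have "\<dots> = ennreal (4 * s powr (1/2) * t powr (-1/2)) * (\<integral>\<^sup>+m\<in>?B. ennreal (norm (m - w) powr (-(1/2))) \<partial>lborel)"
      by (rule nn_integral_cmult) measurable
    also have "\<dots> \<le> ennreal (4 * s powr (1/2) * t powr (-1/2)) * ennreal ((riesz_const (1/2) + pi) * s powr (2 - 1/2))"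
      by (intro mult_left_mono nn_integral_norm_powr_ball_le) (use s in auto)
    also have "\<dots> = ennreal (4 * (riesz_const (1/2) + pi) * (s powr (1/2) * s powr (2 - 1/2)) * t powr (-1/2))"
      by (subst ennreal_mult[symmetric]) (auto simp: mult_ac)
    also have "s powr (1/2) * s powr (2 - 1/2) = s\<^sup>2"
      using s by (simp add: powr_add[symmetric])
    finally show "(\<integral>\<^sup>+m. ?K x m * indicator ?B m \<partial>lborel) \<le> ennreal (4 * (riesz_const (1/2) + pi) * s\<^sup>2 * t powr (-1/2))" .
  qed measurable
  also have "ennreal (5 * (pi * s\<^sup>2)) + ennreal (4 * (riesz_const (1/2) + pi) * s\<^sup>2 * t powr (-1/2))
    = ennreal (5 * (pi * s\<^sup>2) + 4 * (riesz_const (1/2) + pi) * s\<^sup>2 * t powr (-1/2))"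
    by (rule ennreal_plus[symmetric]) auto
  also have "\<dots> \<le> ennreal (exp_const * s\<^sup>2 * t powr (-1/2))"
  proof (rule ennreal_leI)
    have "1 \<le> t powr (-1/2)" using t powr_mono2'[of "-1/2" t 1] by simp
    then have "5 * (pi * s\<^sup>2) * 1 \<le> 5 * (pi * s\<^sup>2) * t powr (-1/2)" by (intro mult_left_mono) auto
    then show "5 * (pi * s\<^sup>2) + 4 * (riesz_const (1/2) + pi) * s\<^sup>2 * t powr (-1/2) \<le> exp_const * s\<^sup>2 * t powr (-1/2)"
      by (simp add: exp_const_def algebra_simps)
  qed
  finally show ?thesis by (simp add: add_left_mono)
qed

end

section \<open>Lengths and distances\<close>

lemma AE_lborel_notin_finite: "finite (s :: real set) \<Longrightarrow> AE t in lborel. t \<notin> s"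
  using finite_imp_null_set_lborel[of s] by (rule AE_not_in)

text \<open>\<open>vector_derivative\<close> is uncontrolled at the finitely many bad parameters, so
  the integrand is replaced by a Borel function that vanishes there; the affine substitutions for
  joined paths rest on its measurability.\<close>

lemma curve_length_representation:
  assumes "valid_path \<gamma>" "path_image \<gamma> \<subseteq> S" "continuous_on S u"
  obtains s D g where "finite s" "g \<in> borel_measurable borel"
    "\<And>t. t \<in> {0..1} - s \<Longrightarrow> (\<gamma> has_vector_derivative D t) (at t)"
    "\<And>t. t \<in> {0..1} - s \<Longrightarrow> g t = ennreal (exp (u (\<gamma> t)) * norm (D t))"
    "\<And>t. t \<notin> {0..1} - s \<Longrightarrow> g t = 0"
    "curve_length u \<gamma> = (\<integral>\<^sup>+t. g t \<partial>lborel)"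
proof -
  obtain s where s: "finite s" "\<gamma> C1_differentiable_on ({0..1} - s)" "continuous_on {0..1} \<gamma>"
    using assms(1) by (auto simp: valid_path_def piecewise_C1_differentiable_on_def)
  then obtain D where D: "\<And>t. t \<in> {0..1} - s \<Longrightarrow> (\<gamma> has_vector_derivative D t) (at t)"
    "continuous_on ({0..1} - s) D"
    unfolding C1_differentiable_on_def by blast
  define A where "A = {0..1} - s"
  define f where "f t = exp (u (\<gamma> t)) * norm (D t)" for t
  define g where "g t = ennreal (indicator A t *\<^sub>R f t)" for t
  have "continuous_on A \<gamma>" using s(3) by (rule continuous_on_subset) (auto simp: A_def)
  then have "continuous_on A (\<lambda>t. u (\<gamma> t))"
    by (rule continuous_on_compose2[OF assms(3)]) (use assms(2) in \<open>auto simp: A_def path_image_def\<close>)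
  then have "continuous_on A f"
    unfolding f_def by (intro continuous_intros) (use D(2) in \<open>simp_all add: A_def\<close>)
  moreover have "A \<in> sets borel"
    unfolding A_def using finite_imp_closed[OF s(1)] by (intro sets.Diff borel_closed) auto
  ultimately have "(\<lambda>t. indicator A t *\<^sub>R f t) \<in> borel_measurable borel"
    by (intro borel_measurable_continuous_on_indicator)
  then have meas: "g \<in> borel_measurable borel" unfolding g_def by measurable
  have "curve_length u \<gamma> = (\<integral>\<^sup>+t. g t \<partial>lborel)"
    unfolding curve_length_def
  proof (rule nn_integral_cong_AE)
    show "AE t in lborel. ennreal (exp (u (\<gamma> t)) * norm (vector_derivative \<gamma> (at t))) * indicator {0..1} t = g t"
      using AE_lborel_notin_finite[OF s(1)]
    proof eventually_elim
      case (elim t)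
      show ?case
      proof (cases "t \<in> {0..1}")
        case True
        then have "vector_derivative \<gamma> (at t) = D t"
          using D(1)[of t] elim by (intro vector_derivative_at) auto
        then show ?thesis using True elim by (simp add: g_def A_def f_def)
      qed (auto simp: g_def A_def)
    qed
  qed
  then show ?thesis
    using that[of s g D] s(1) meas D(1) by (simp add: g_def flip: A_def) (simp add: f_def)
qed

text \<open>On each half of the parameter interval the joined path runs through one of the two paths
  at double speed; the factor 2 is undone by the substitutions 2 t and 2 t - 1.\<close>

lemma curve_length_join:
  assumes g1: "valid_path \<gamma>1" "path_image \<gamma>1 \<subseteq> S" and g2: "valid_path \<gamma>2" "path_image \<gamma>2 \<subseteq> S"
    and u: "continuous_on S u"
  shows "curve_length u (\<gamma>1 +++ \<gamma>2) \<le> curve_length u \<gamma>1 + curve_length u \<gamma>2"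
proof -
  obtain s1 D1 f1 where 1: "finite s1" "f1 \<in> borel_measurable borel"
    "\<And>t. t \<in> {0..1} - s1 \<Longrightarrow> (\<gamma>1 has_vector_derivative D1 t) (at t)"
    "\<And>t. t \<in> {0..1} - s1 \<Longrightarrow> f1 t = ennreal (exp (u (\<gamma>1 t)) * norm (D1 t))"
    "\<And>t. t \<notin> {0..1} - s1 \<Longrightarrow> f1 t = 0"
    "curve_length u \<gamma>1 = (\<integral>\<^sup>+t. f1 t \<partial>lborel)"
    using curve_length_representation[OF g1 u] by metis
  obtain s2 D2 f2 where 2: "finite s2" "f2 \<in> borel_measurable borel"
    "\<And>t. t \<in> {0..1} - s2 \<Longrightarrow> (\<gamma>2 has_vector_derivative D2 t) (at t)"
    "\<And>t. t \<in> {0..1} - s2 \<Longrightarrow> f2 t = ennreal (exp (u (\<gamma>2 t)) * norm (D2 t))"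
    "\<And>t. t \<notin> {0..1} - s2 \<Longrightarrow> f2 t = 0"
    "curve_length u \<gamma>2 = (\<integral>\<^sup>+t. f2 t \<partial>lborel)"
    using curve_length_representation[OF g2 u] by metis
  note [measurable] = 1(2) 2(2)
  \<comment> \<open>Preimages of the bad parameters of both paths, and the junction.\<close>
  let ?s = "(\<lambda>t. t / 2) ` s1 \<union> (\<lambda>t. (t + 1) / 2) ` s2 \<union> {1/2}"
  have fin: "finite ?s" using 1(1) 2(1) by simp
  have "curve_length u (\<gamma>1 +++ \<gamma>2) \<le> (\<integral>\<^sup>+t. 2 * f1 (0 + 2 * t) + 2 * f2 (-1 + 2 * t) \<partial>lborel)"
    unfolding curve_length_def
  proof (rule nn_integral_mono_AE)
    show "AE t in lborel. ennreal (exp (u ((\<gamma>1 +++ \<gamma>2) t)) * norm (vector_derivative (\<gamma>1 +++ \<gamma>2) (at t))) * indicator {0..1} t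
       \<le> 2 * f1 (0 + 2 * t) + 2 * f2 (-1 + 2 * t)"
      using AE_lborel_notin_finite[OF fin]
    proof eventually_elim
      case (elim t)
      have t: "t \<noteq> 1/2" "2 * t \<notin> s1" "2 * t - 1 \<notin> s2"
        using elim by (auto simp: image_iff field_simps)
      consider "0 \<le> t" "t < 1/2" | "1/2 < t" "t \<le> 1" | "t \<notin> {0..1}" using t(1) by fastforce
      then show ?case
      proof cases
        case l: 1
        have "((\<lambda>t. 2 * t) has_vector_derivative 2) (at t)"
          by (auto intro!: derivative_eq_intros simp: has_vector_derivative_def)
        moreover have "(\<gamma>1 has_vector_derivative D1 (2 * t)) (at (2 * t))" using l t by (intro 1(3)) auto
        ultimately have "((\<gamma>1 \<circ> (\<lambda>t. 2 * t)) has_vector_derivative 2 *\<^sub>R D1 (2 * t)) (at t)"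
          by (rule vector_diff_chain_at)
        then have "((\<gamma>1 +++ \<gamma>2) has_vector_derivative 2 *\<^sub>R D1 (2 * t)) (at t)"
          by (rule has_vector_derivative_transform_within_open[of _ _ _ "{..<1/2}"]) (use l in \<open>auto simp: joinpaths_def\<close>)
        then have "vector_derivative (\<gamma>1 +++ \<gamma>2) (at t) = 2 *\<^sub>R D1 (2 * t)" by (rule vector_derivative_at)
        moreover have "(\<gamma>1 +++ \<gamma>2) t = \<gamma>1 (2 * t)" using l by (simp add: joinpaths_def)
        moreover have "f1 (2 * t) = ennreal (exp (u (\<gamma>1 (2 * t))) * norm (D1 (2 * t)))"
          using l t by (intro 1(4)) auto
        ultimately show ?thesis using l by (simp add: ennreal_mult mult_ac)
      next
        case r: 2
        have "((\<lambda>t. 2 * t - 1) has_vector_derivative 2) (at t)"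
          by (auto intro!: derivative_eq_intros simp: has_vector_derivative_def)
        moreover have "(\<gamma>2 has_vector_derivative D2 (2 * t - 1)) (at (2 * t - 1))" using r t by (intro 2(3)) auto
        ultimately have "((\<gamma>2 \<circ> (\<lambda>t. 2 * t - 1)) has_vector_derivative 2 *\<^sub>R D2 (2 * t - 1)) (at t)"
          by (rule vector_diff_chain_at)
        then have "((\<gamma>1 +++ \<gamma>2) has_vector_derivative 2 *\<^sub>R D2 (2 * t - 1)) (at t)"
          by (rule has_vector_derivative_transform_within_open[of _ _ _ "{1/2<..}"]) (use r in \<open>auto simp: joinpaths_def\<close>)
        then have "vector_derivative (\<gamma>1 +++ \<gamma>2) (at t) = 2 *\<^sub>R D2 (2 * t - 1)" by (rule vector_derivative_at)
        moreover have "(\<gamma>1 +++ \<gamma>2) t = \<gamma>2 (2 * t - 1)" using r by (simp add: joinpaths_def)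
        moreover have "f2 (2 * t - 1) = ennreal (exp (u (\<gamma>2 (2 * t - 1))) * norm (D2 (2 * t - 1)))"
          using r t by (intro 2(4)) auto
        ultimately show ?thesis using r by (simp add: ennreal_mult mult_ac)
      qed auto
    qed
  qed
  also have "\<dots> = 2 * (\<integral>\<^sup>+t. f1 (0 + 2 * t) \<partial>lborel) + 2 * (\<integral>\<^sup>+t. f2 (-1 + 2 * t) \<partial>lborel)"
    by (subst nn_integral_add) (auto simp: nn_integral_cmult)
  also have "2 * (\<integral>\<^sup>+t. f1 (0 + 2 * t) \<partial>lborel) = (\<integral>\<^sup>+t. f1 t \<partial>lborel)"
    by (subst nn_integral_real_affine[of f1 2 0]) auto
  also have "2 * (\<integral>\<^sup>+t. f2 (-1 + 2 * t) \<partial>lborel) = (\<integral>\<^sup>+t. f2 t \<partial>lborel)"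
    by (subst nn_integral_real_affine[of f2 2 "-1"]) auto
  finally show ?thesis by (simp add: 1(6) 2(6))
qed

lemma geodesic_dist_le_curve_length:
  assumes "valid_path \<gamma>" "path_image \<gamma> \<subseteq> S" "pathstart \<gamma> = z" "pathfinish \<gamma> = w"
  shows "geodesic_dist S u z w \<le> curve_length u \<gamma>"
  unfolding geodesic_dist_def by (rule INF_lower) (use assms in auto)

lemma geodesic_dist_less:
  assumes "geodesic_dist S u z w < c"
  obtains \<gamma> where "valid_path \<gamma>" "path_image \<gamma> \<subseteq> S" "pathstart \<gamma> = z" "pathfinish \<gamma> = w" "curve_length u \<gamma> < c"
  using assms unfolding geodesic_dist_def INF_less_iff by auto

lemma geodesic_dist_triangle_less:
  assumes u: "continuous_on S u" and "geodesic_dist S u z m < a" "geodesic_dist S u m w < b"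
  shows "geodesic_dist S u z w < a + b"
proof -
  obtain \<gamma>1 where 1: "valid_path \<gamma>1" "path_image \<gamma>1 \<subseteq> S" "pathstart \<gamma>1 = z" "pathfinish \<gamma>1 = m" "curve_length u \<gamma>1 < a"
    using geodesic_dist_less[OF assms(2)] .
  obtain \<gamma>2 where 2: "valid_path \<gamma>2" "path_image \<gamma>2 \<subseteq> S" "pathstart \<gamma>2 = m" "pathfinish \<gamma>2 = w" "curve_length u \<gamma>2 < b"
    using geodesic_dist_less[OF assms(3)] .
  have "geodesic_dist S u z w \<le> curve_length u (\<gamma>1 +++ \<gamma>2)"
    using 1 2 by (intro geodesic_dist_le_curve_length valid_path_join) (auto simp: path_image_join)
  also have "\<dots> \<le> curve_length u \<gamma>1 + curve_length u \<gamma>2"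
    by (rule curve_length_join[OF 1(1,2) 2(1,2) u])
  also have "\<dots> < a + b" using 1(5) 2(5) by (rule add_strict_mono)
  finally show ?thesis .
qed

text \<open>The infima may fail to be attained, so each leg is granted e / 2 of slack.\<close>

lemma geodesic_dist_triangle:
  assumes u: "continuous_on S u"
  shows "geodesic_dist S u z w \<le> geodesic_dist S u z m + geodesic_dist S u m w"
proof (cases "geodesic_dist S u z m + geodesic_dist S u m w = \<infinity>")
  case False
  then have fin: "geodesic_dist S u z m < \<infinity>" "geodesic_dist S u m w < \<infinity>"
    by (auto simp: less_top)
  show ?thesis
  proof (rule ennreal_le_epsilon)
    fix e :: real assume e: "0 < e"
    have "geodesic_dist S u z w < (geodesic_dist S u z m + ennreal (e/2)) + (geodesic_dist S u m w + ennreal (e/2))"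
      using e fin ennreal_add_left_cancel_less[of _ 0 "ennreal (e/2)"]
      by (intro geodesic_dist_triangle_less[OF u, of z m _ w]) auto
    also have "\<dots> = geodesic_dist S u z m + geodesic_dist S u m w + (ennreal (e/2) + ennreal (e/2))"
      by (simp add: add_ac)
    also have "ennreal (e/2) + ennreal (e/2) = ennreal e" using e by (simp flip: ennreal_plus)
    finally show "geodesic_dist S u z w \<le> geodesic_dist S u z m + geodesic_dist S u m w + ennreal e" by simp
  qed
qed (auto simp: top_unique)

lemma curve_length_linepath:
  "curve_length u (linepath a b) = (\<integral>\<^sup>+t\<in>{0..1}. ennreal (exp (u (a + t *\<^sub>R (b - a))) * norm (b - a)) \<partial>lborel)"
  unfolding curve_length_def
  by (intro nn_integral_cong) (simp add: vector_derivative_linepath_at linepath_def algebra_simps)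

lemma curve_length_linepath_le:
  assumes "\<And>x. x \<in> closed_segment a b \<Longrightarrow> u x \<le> c"
  shows "curve_length u (linepath a b) \<le> ennreal (exp c * norm (b - a))"
proof -
  have "curve_length u (linepath a b) \<le> (\<integral>\<^sup>+t\<in>{0..1::real}. ennreal (exp c * norm (b - a)) \<partial>lborel)"
    unfolding curve_length_linepath
  proof (rule nn_integral_mono)
    fix t :: real
    have "u (a + t *\<^sub>R (b - a)) \<le> c" if "t \<in> {0..1}"
      using that by (intro assms) (auto simp: in_segment algebra_simps)
    then show "ennreal (exp (u (a + t *\<^sub>R (b - a))) * norm (b - a)) * indicator {0..1} t \<le> ennreal (exp c * norm (b - a)) * indicator {0..1} t"
      by (auto simp: indicator_def intro!: ennreal_leI mult_right_mono)
  qed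
  also have "\<dots> = ennreal (exp c * norm (b - a))"
    by (subst nn_integral_cmult_indicator) auto
  finally show ?thesis .
qed

text \<open>Measurability matters: a non-measurable ball would have the junk measure 0.\<close>

lemma open_geodesic_ball:
  assumes S: "open S" and u: "continuous_on S u"
  shows "open (geodesic_ball S u z r)"
  unfolding open_contains_ball
proof
  fix w assume w: "w \<in> geodesic_ball S u z r"
  then have wS: "w \<in> S" and wr: "geodesic_dist S u z w < ennreal r" by (auto simp: geodesic_ball_def)
  obtain e1 where e1: "e1 > 0" "ball w e1 \<subseteq> S" using S wS open_contains_ball by blast
  obtain e2 where e2: "e2 > 0" "\<And>x. x \<in> S \<Longrightarrow> dist x w < e2 \<Longrightarrow> dist (u x) (u w) < 1"
    using u wS unfolding continuous_on_iff by (metis zero_less_one)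
  obtain c where c: "geodesic_dist S u z w < c" "c < ennreal r" using dense[OF wr] by blast
  then obtain d where "c = ennreal d" "0 \<le> d" by (cases c rule: ennreal_cases) auto
  with c have d: "geodesic_dist S u z w < ennreal d" "ennreal d < ennreal r" "0 \<le> d" by simp_all
  then have dr: "d < r" by (simp add: ennreal_less_iff)
  \<comment> \<open>Small enough for the segment to stay in S, for u to stay below u w + 1 along it,
    and for its length to be less than the margin r - d.\<close>
  define e where "e = min (min e1 e2) ((r - d) / exp (u w + 1))"
  have e: "e > 0" using e1 e2 dr by (simp add: e_def)
  show "\<exists>e>0. ball w e \<subseteq> geodesic_ball S u z r"
  proof (intro exI[of _ e] conjI e subsetI)
    fix y assume y: "y \<in> ball w e"
    have seg: "closed_segment w y \<subseteq> ball w e"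
      using y e by (intro closed_segment_subset convex_ball) auto
    have segS: "closed_segment w y \<subseteq> S" 
    proof -
      have "e \<le> e1" by (simp add: e_def)
      then show ?thesis using seg e1(2) subset_ball[of e e1 w] by blast
    qed
    have "geodesic_dist S u w y \<le> curve_length u (linepath w y)"
      by (rule geodesic_dist_le_curve_length) (use segS in auto)
    also have "\<dots> \<le> ennreal (exp (u w + 1) * norm (y - w))"
    proof (rule curve_length_linepath_le)
      fix x assume x: "x \<in> closed_segment w y"
      then have "x \<in> S" "dist x w < e2" using segS seg by (auto simp: e_def dist_commute)
      then have "dist (u x) (u w) < 1" by (rule e2)
      then show "u x \<le> u w + 1" by (simp add: dist_real_def)
    qed
    also have "\<dots> < ennreal (r - d)"
    proof (rule ennreal_lessI)
      have "norm (y - w) < (r - d) / exp (u w + 1)" using y by (simp add: e_def dist_norm norm_minus_commute)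
      then show "exp (u w + 1) * norm (y - w) < r - d" by (simp add: field_simps)
    qed (use dr in simp)
    finally have "geodesic_dist S u z y < ennreal d + ennreal (r - d)"
      using d(1) by (intro geodesic_dist_triangle_less[OF u])
    also have "\<dots> = ennreal r" using d dr by (simp flip: ennreal_plus)
    finally show "y \<in> geodesic_ball S u z r"
      using segS by (auto simp: geodesic_ball_def)
  qed
qed

section \<open>Distances and areas inside a disk, by averaging\<close>

lemma nn_integral_powr_minus_half:
  "(\<integral>\<^sup>+t\<in>{0<..1}. ennreal (t powr (-1/2)) \<partial>lborel) = 2"
proof -
  let ?f = "\<lambda>t::real. if t \<in> {0..1} then t powr (-1/2) else 0"
  have "((\<lambda>t. t powr (-1/2)) has_integral (1 powr (-1/2 + 1) / (-1/2 + 1))) {0..(1::real)}"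
    by (rule has_integral_powr_from_0) auto
  then have "(?f has_integral 2) UNIV" by (subst has_integral_restrict_UNIV) simp
  then have "(\<integral>\<^sup>+t. ennreal (?f t) \<partial>lborel) = ennreal 2"
    by (intro nn_integral_has_integral_lborel) auto
  also have "(\<integral>\<^sup>+t. ennreal (?f t) \<partial>lborel) = (\<integral>\<^sup>+t\<in>{0<..1}. ennreal (t powr (-1/2)) \<partial>lborel)"
    by (intro nn_integral_cong) (auto simp: indicator_def)
  finally show ?thesis by simp
qed

text \<open>Reversal t -> 1 - t. Averages are taken over segments issuing from a fixed end point,
  whereas the second leg of a broken line runs towards it.\<close>

lemma curve_length_linepath_commute:
  assumes "closed_segment a b \<subseteq> S" "continuous_on S u"
  shows "curve_length u (linepath a b) = curve_length u (linepath b a)"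
proof -
  define f where "f t = exp (u (a + t *\<^sub>R (b - a))) * norm (b - a)" for t
  have in_seg: "a + t *\<^sub>R (b - a) \<in> closed_segment a b" if "t \<in> {0..1}" for t
    using that by (auto simp: in_segment algebra_simps intro!: exI[of _ t])
  have "continuous_on {0..1} f"
    unfolding f_def
    by (intro continuous_intros continuous_on_compose2[OF assms(2)]) (use in_seg assms(1) in auto)
  then have "(\<lambda>t. indicator {0..1} t *\<^sub>R f t) \<in> borel_measurable borel"
    by (intro borel_measurable_continuous_on_indicator) auto
  note [measurable] = this
  define g where "g t = ennreal (indicator {0..1} t *\<^sub>R f t)" for t
  have g: "g \<in> borel_measurable borel" unfolding g_def[abs_def] by measurable
  have 1: "curve_length u (linepath a b) = (\<integral>\<^sup>+t. g t \<partial>lborel)"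
    unfolding curve_length_linepath g_def by (intro nn_integral_cong) (simp add: f_def indicator_def)
  also have "\<dots> = (\<integral>\<^sup>+t. g (1 + (-1) * t) \<partial>lborel)"
    by (subst nn_integral_real_affine[OF g, of "-1" 1]) auto
  also have "\<dots> = curve_length u (linepath b a)"
    unfolding curve_length_linepath g_def
  proof (intro nn_integral_cong)
    fix t :: real
    have "a + (1 + (-1) * t) *\<^sub>R (b - a) = b + t *\<^sub>R (a - b)" by (simp add: algebra_simps)
    then show "ennreal (indicator {0..1} (1 + (-1) * t) *\<^sub>R f (1 + (-1) * t))
       = ennreal (exp (u (b + t *\<^sub>R (a - b))) * norm (a - b)) * indicator {0..1} t"
      by (auto simp: f_def indicator_def norm_minus_commute)
  qed
  finally show ?thesis .
qed

text \<open>Two legs, each contributing 4 * exp_const: a factor 2 from |m - p| <= 2 s and a factor 2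
  from the integral of t^(-1/2).\<close>

definition dist_const :: real where "dist_const = 8 * exp_const"

text \<open>The maximum over \<tau> of 2 \<tau> \<pi> / 16 - \<tau>^2 * exp_const, where \<pi> / 16
  is the area of a disk of radius 1/4.\<close>

definition area_const :: real where "area_const = (pi / 16)\<^sup>2 / exp_const"

lemma dist_const_pos: "dist_const > 0" and area_const_pos: "area_const > 0"
  using exp_const_pos by (auto simp: dist_const_def area_const_def pi_gt_zero)

context planar_charge
begin

lemma log_pot_measurable [measurable]: "log_pot \<in> borel_measurable borel"
  unfolding log_pot_def[abs_def] by measurable

text \<open>Lengths of segments from a to m are to be integrated over m, but \<open>u\<close> is
  controlled only on the disk. The envelope replaces it by \<open>log_pot\<close>, which is
  measurable on the whole plane, so that Tonelli applies: first m for fixed t, where exponential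
  moments are known, then t.\<close>

lemma segment_length_envelope:
  assumes s: "s > 0" and R: "R \<ge> 1" "2 * m0 \<le> 1/2" "R powr (2 * m0) \<le> 2"
    and B: "ball y0 s \<subseteq> ball z0 (R * s)"
    and a: "a \<in> ball y0 s" and u: "\<And>y. y \<in> ball y0 s \<Longrightarrow> u y \<le> log_pot y + h"
  obtains E where "E \<in> borel_measurable borel" "\<And>m. m \<in> ball y0 s \<Longrightarrow> curve_length u (linepath a m) \<le> E m"
    "(\<integral>\<^sup>+m\<in>ball y0 s. E m \<partial>lborel) \<le> ennreal (4 * exp_const * s ^ 3 * exp (log_mean z0 (R * s) + h))"
proof -
  define c where "c = log_mean z0 (R * s)"
  define A where "A = 2 * s * exp (c + h)"
  have A: "A > 0" using s by (simp add: A_def)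
  let ?V = "\<lambda>t m. \<bar>log_pot (a + t *\<^sub>R (m - a)) - c\<bar>"
  define E where "E m = (\<integral>\<^sup>+t. ennreal A * ennreal (exp (2 * ?V t m)) * indicator {0<..1} t \<partial>lborel)" for m
  have inB: "a + t *\<^sub>R (m - a) \<in> ball y0 s" if "m \<in> ball y0 s" "0 \<le> t" "t \<le> 1" for t m
  proof -
    have "a + t *\<^sub>R (m - a) = (1 - t) *\<^sub>R a + t *\<^sub>R m" by (simp add: algebra_simps)
    then show ?thesis using convexD_alt[OF convex_ball[of y0 s] a that(1), of t] that by simp
  qed
  \<comment> \<open>The factor 2 brings the length integrand to the same exponential moment that is
    used for areas.\<close>
  have aux: "v \<le> c + 2 * \<bar>v - c\<bar>" for v
    by (cases "v \<ge> c") auto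
  have le: "curve_length u (linepath a m) \<le> E m" if m: "m \<in> ball y0 s" for m
    unfolding curve_length_linepath E_def
  proof (rule nn_integral_mono_AE)
    have "AE t in lborel. t \<noteq> (0::real)" by (rule AE_lborel_singleton)
    then show "AE t in lborel. ennreal (exp (u (a + t *\<^sub>R (m - a))) * norm (m - a)) * indicator {0..1} t
       \<le> ennreal A * ennreal (exp (2 * ?V t m)) * indicator {0<..1} t"
    proof eventually_elim
      case (elim t)
      show ?case
      proof (cases "t \<in> {0..1}")
        case True
        have "norm (m - a) \<le> norm (m - y0) + norm (a - y0)"
          using norm_triangle_ineq4[of "m - y0" "a - y0"] by simp
        then have 1: "norm (m - a) \<le> 2 * s"
          using m a by (simp add: dist_norm norm_minus_commute)
        have "u (a + t *\<^sub>R (m - a)) \<le> log_pot (a + t *\<^sub>R (m - a)) + h"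
          using True by (intro u inB m) auto
        then have "exp (u (a + t *\<^sub>R (m - a))) \<le> exp (c + h) * exp (2 * ?V t m)"
          unfolding exp_add[symmetric] using aux[of "log_pot (a + t *\<^sub>R (m - a))"] by simp
        then have "exp (u (a + t *\<^sub>R (m - a))) * norm (m - a) \<le> (exp (c + h) * exp (2 * ?V t m)) * (2 * s)"
          using 1 by (intro mult_mono) auto
        also have "\<dots> = A * exp (2 * ?V t m)" by (simp add: A_def)
        finally have "ennreal (exp (u (a + t *\<^sub>R (m - a))) * norm (m - a)) \<le> ennreal (A * exp (2 * ?V t m))"
          by (rule ennreal_leI)
        then show ?thesis using True elim A by (simp add: ennreal_mult)
      qed auto
    qed
  qed
  have E_meas [measurable]: "E \<in> borel_measurable borel"
    unfolding E_def by measurable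
  have "(\<integral>\<^sup>+m\<in>ball y0 s. E m \<partial>lborel)
     = (\<integral>\<^sup>+m. (\<integral>\<^sup>+t. ennreal A * ennreal (exp (2 * ?V t m)) * indicator {0<..1} t * indicator (ball y0 s) m \<partial>lborel) \<partial>lborel)"
    unfolding E_def by (intro nn_integral_cong nn_integral_multc[symmetric]) measurable
  also have "\<dots> = (\<integral>\<^sup>+t. (\<integral>\<^sup>+m. ennreal A * ennreal (exp (2 * ?V t m)) * indicator {0<..1} t * indicator (ball y0 s) m \<partial>lborel) \<partial>lborel)"
    by (rule lborel_pair.Fubini') measurable
  also have "\<dots> \<le> (\<integral>\<^sup>+t. ennreal (A * (exp_const * s\<^sup>2)) * (ennreal (t powr (-1/2)) * indicator {0<..1} t) \<partial>lborel)"
  proof (rule nn_integral_mono)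
    fix t :: real
    show "(\<integral>\<^sup>+m. ennreal A * ennreal (exp (2 * ?V t m)) * indicator {0<..1} t * indicator (ball y0 s) m \<partial>lborel)
       \<le> ennreal (A * (exp_const * s\<^sup>2)) * (ennreal (t powr (-1/2)) * indicator {0<..1} t)"
    proof (cases "t \<in> {0<..1}")
      case True
      have "(\<integral>\<^sup>+m. ennreal A * ennreal (exp (2 * ?V t m)) * indicator {0<..1} t * indicator (ball y0 s) m \<partial>lborel)
         = ennreal A * (\<integral>\<^sup>+m\<in>ball y0 s. ennreal (exp (2 * ?V t m)) \<partial>lborel)"
        using True by (simp add: mult.assoc nn_integral_cmult)
      also have "\<dots> \<le> ennreal A * ennreal (exp_const * s\<^sup>2 * t powr (-1/2))"
        unfolding c_def
      proof (intro mult_left_mono nn_integral_exp_log_pot_le s R)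
        show "norm (a + t *\<^sub>R (m - a) - z0) < R * s" if "m \<in> ball y0 s" for m
        proof -
          have "a + t *\<^sub>R (m - a) \<in> ball z0 (R * s)" using inB[OF that, of t] True B by auto
          then show ?thesis by (simp add: dist_norm norm_minus_commute)
        qed
      qed (use True in auto)
      also have "\<dots> = ennreal (A * (exp_const * s\<^sup>2)) * (ennreal (t powr (-1/2)) * indicator {0<..1} t)"
        using True A exp_const_pos by (simp add: mult_ac flip: ennreal_mult)
      finally show ?thesis .
    qed simp
  qed
  also have "\<dots> = ennreal (A * (exp_const * s\<^sup>2)) * (\<integral>\<^sup>+t\<in>{0<..1}. ennreal (t powr (-1/2)) \<partial>lborel)"
    by (rule nn_integral_cmult) measurable
  also have "\<dots> = ennreal (A * (exp_const * s\<^sup>2) * 2)"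
    unfolding nn_integral_powr_minus_half using A exp_const_pos by (subst ennreal_mult) auto
  also have "A * (exp_const * s\<^sup>2) * 2 = 4 * exp_const * s ^ 3 * exp (log_mean z0 (R * s) + h)"
    by (simp add: A_def c_def power2_eq_square power3_eq_cube)
  finally show ?thesis using that[of E] le E_meas by blast
qed

text \<open>Average the length of the broken line \<open>p, m, q\<close> over all \<open>m\<close> in the disk.\<close>

lemma geodesic_dist_le_in_ball:
  assumes s: "s > 0" and R: "R \<ge> 1" "2 * m0 \<le> 1/2" "R powr (2 * m0) \<le> 2"
    and B: "ball y0 s \<subseteq> ball z0 (R * s)" and BS: "ball y0 s \<subseteq> S"
    and p: "p \<in> ball y0 s" and q: "q \<in> ball y0 s"
    and cont_u: "continuous_on S u" and u: "\<And>y. y \<in> ball y0 s \<Longrightarrow> u y \<le> log_pot y + h"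
  shows "geodesic_dist S u p q \<le> ennreal (dist_const * s * exp (log_mean z0 (R * s) + h))"
proof -
  let ?B = "ball y0 s"
  define K where "K = 8 * exp_const * s ^ 3 * exp (log_mean z0 (R * s) + h)"
  have K: "K > 0" using s exp_const_pos by (simp add: K_def)
  have K2: "K / 2 = 4 * exp_const * s ^ 3 * exp (log_mean z0 (R * s) + h)" by (simp add: K_def)
  obtain Ep where Ep: "Ep \<in> borel_measurable borel" "\<And>m. m \<in> ?B \<Longrightarrow> curve_length u (linepath p m) \<le> Ep m"
    "(\<integral>\<^sup>+m\<in>?B. Ep m \<partial>lborel) \<le> ennreal (K / 2)"
    unfolding K2 using segment_length_envelope[where u=u and h=h, OF s R B p u] by blast
  obtain Eq where Eq: "Eq \<in> borel_measurable borel" "\<And>m. m \<in> ?B \<Longrightarrow> curve_length u (linepath q m) \<le> Eq m"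
    "(\<integral>\<^sup>+m\<in>?B. Eq m \<partial>lborel) \<le> ennreal (K / 2)"
    unfolding K2 using segment_length_envelope[where u=u and h=h, OF s R B q u] by blast
  note [measurable] = Ep(1) Eq(1)
  \<comment> \<open>Otherwise the sum would exceed K / s^2 on a disk of area \<pi> s^2, while its
    integral is at most K.\<close>
  have "\<exists>m\<in>?B. Ep m + Eq m \<le> ennreal (K / s\<^sup>2)"
  proof (rule ccontr)
    assume neg: "\<not> (\<exists>m\<in>?B. Ep m + Eq m \<le> ennreal (K / s\<^sup>2))"
    have "ennreal (K * pi) = (\<integral>\<^sup>+m. ennreal (K / s\<^sup>2) * indicator ?B m \<partial>lborel)"
      using s K by (subst nn_integral_cmult_indicator) (auto simp: emeasure_ball_complex simp flip: ennreal_mult)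
    also have "\<dots> \<le> (\<integral>\<^sup>+m. Ep m * indicator ?B m + Eq m * indicator ?B m \<partial>lborel)"
      using neg by (intro nn_integral_mono) (auto simp: indicator_def not_le less_imp_le)
    also have "\<dots> = (\<integral>\<^sup>+m\<in>?B. Ep m \<partial>lborel) + (\<integral>\<^sup>+m\<in>?B. Eq m \<partial>lborel)"
      by (rule nn_integral_add) measurable
    also have "\<dots> \<le> ennreal (K / 2) + ennreal (K / 2)" by (intro add_mono Ep Eq)
    also have "\<dots> = ennreal K" using K by (simp flip: ennreal_plus)
    finally have "K * pi \<le> K" using K by (subst (asm) ennreal_le_iff) auto
    then show False using K pi_gt3 by simp
  qed
  then obtain m where m: "m \<in> ?B" "Ep m + Eq m \<le> ennreal (K / s\<^sup>2)" by blast
  have seg: "closed_segment p m \<subseteq> S" "closed_segment q m \<subseteq> S"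
    using closed_segment_subset[OF p m(1) convex_ball] closed_segment_subset[OF q m(1) convex_ball] BS by auto
  have "geodesic_dist S u p q \<le> geodesic_dist S u p m + geodesic_dist S u m q"
    by (rule geodesic_dist_triangle[OF cont_u])
  also have "\<dots> \<le> curve_length u (linepath p m) + curve_length u (linepath m q)"
    using seg by (intro add_mono geodesic_dist_le_curve_length) (auto simp: closed_segment_commute)
  also have "curve_length u (linepath m q) = curve_length u (linepath q m)"
    using seg cont_u by (intro curve_length_linepath_commute[where S=S]) (auto simp: closed_segment_commute)
  also have "curve_length u (linepath p m) + curve_length u (linepath q m) \<le> Ep m + Eq m"
    by (intro add_mono Ep Eq m)
  also have "\<dots> \<le> ennreal (K / s\<^sup>2)" by (rule m)
  also have "K / s\<^sup>2 = dist_const * s * exp (log_mean z0 (R * s) + h)"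
    using s by (simp add: K_def dist_const_def power2_eq_square power3_eq_cube)
  finally show ?thesis .
qed

lemma nn_integral_exp_abs_log_pot_le:
  assumes s: "s > 0" and R: "R \<ge> 1" "2 * m0 \<le> 1/2" "R powr (2 * m0) \<le> 2"
    and B: "ball y0 s \<subseteq> ball z0 (R * s)"
  shows "(\<integral>\<^sup>+y\<in>ball y0 s. ennreal (exp (2 * \<bar>log_pot y - log_mean z0 (R * s)\<bar>)) \<partial>lborel) \<le> ennreal (exp_const * s\<^sup>2)"
proof -
  have "norm (0 + 1 *\<^sub>R (m - 0) - z0) < R * s" if "m \<in> ball y0 s" for m
    using subsetD[OF B that] by (simp add: dist_norm norm_minus_commute)
  then show ?thesis
    using nn_integral_exp_log_pot_le[OF s R zero_less_one order_refl, of y0 0 z0] by simp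
qed

text \<open>Uses \<open>e\<^sup>2\<^sup>x \<ge> 2 \<tau> - \<tau>\<^sup>2 e\<^sup>2\<^sup>|\<^sup>x\<^sup>|\<close> with the optimal \<open>\<tau>\<close>.\<close>

lemma nn_integral_exp_log_pot_ge:
  assumes s: "s > 0" and R: "R \<ge> 1" "2 * m0 \<le> 1/2" "R powr (2 * m0) \<le> 2"
    and B: "ball y0 s \<subseteq> ball z0 (R * s)"
  shows "ennreal (area_const * s\<^sup>2 * exp (2 * log_mean z0 (R * s))) \<le> (\<integral>\<^sup>+y\<in>ball y0 (s/4). ennreal (exp (2 * log_pot y)) \<partial>lborel)"
proof -
  define c where "c = log_mean z0 (R * s)"
  define T where "T = (pi / 16) / exp_const"
  have T: "T > 0" using exp_const_pos by (simp add: T_def)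
  let ?B = "ball y0 (s/4)"
  let ?I = "\<integral>\<^sup>+y\<in>?B. ennreal (exp (2 * (log_pot y - c))) \<partial>lborel"
  \<comment> \<open>The main term lives on the quarter disk, while the error is taken over the full
    one, where its integral is known. Quarter disks are the ones that will be packed
    disjointly.\<close>
  have sub: "?B \<subseteq> ball y0 s" using s by (intro subset_ball) auto
  have "ennreal (2 * T * (pi * (s/4)\<^sup>2)) = (\<integral>\<^sup>+y. ennreal (2 * T) * indicator ?B y \<partial>lborel)"
    using s T by (subst nn_integral_cmult_indicator) (auto simp: emeasure_ball_complex ennreal_mult)
  also have "\<dots> \<le> (\<integral>\<^sup>+y. ennreal (exp (2 * (log_pot y - c))) * indicator ?B y
      + ennreal (T\<^sup>2) * (ennreal (exp (2 * \<bar>log_pot y - c\<bar>)) * indicator (ball y0 s) y) \<partial>lborel)"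
  proof (rule nn_integral_mono)
    fix y
    show "ennreal (2 * T) * indicator ?B y \<le> ennreal (exp (2 * (log_pot y - c))) * indicator ?B y
      + ennreal (T\<^sup>2) * (ennreal (exp (2 * \<bar>log_pot y - c\<bar>)) * indicator (ball y0 s) y)"
    proof (cases "y \<in> ?B")
      case True
      define x where "x = log_pot y - c"
      have "0 \<le> (exp x - T * exp (- x))\<^sup>2" by simp
      also have "\<dots> = exp (2 * x) - 2 * T * (exp x * exp (- x)) + T\<^sup>2 * exp (2 * (- x))"
        unfolding exp_double by (simp add: power2_eq_square algebra_simps)
      also have "exp x * exp (- x) = 1" by (simp add: exp_minus)
      finally have "2 * T \<le> exp (2 * x) + T\<^sup>2 * exp (2 * (- x))" by simp
      also have "\<dots> \<le> exp (2 * x) + T\<^sup>2 * exp (2 * \<bar>x\<bar>)" by (intro add_left_mono mult_left_mono) auto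
      finally have "ennreal (2 * T) \<le> ennreal (exp (2 * x) + T\<^sup>2 * exp (2 * \<bar>x\<bar>))" by (rule ennreal_leI)
      then show ?thesis using True sub by (auto simp: x_def ennreal_mult)
    qed simp
  qed
  also have "\<dots> = ?I + ennreal (T\<^sup>2) * (\<integral>\<^sup>+y\<in>ball y0 s. ennreal (exp (2 * \<bar>log_pot y - c\<bar>)) \<partial>lborel)"
    by (subst nn_integral_add) (auto simp: nn_integral_cmult)
  also have "\<dots> \<le> ?I + ennreal (T\<^sup>2) * ennreal (exp_const * s\<^sup>2)"
    unfolding c_def by (intro add_left_mono mult_left_mono nn_integral_exp_abs_log_pot_le s R B) auto
  also have "ennreal (T\<^sup>2) * ennreal (exp_const * s\<^sup>2) = ennreal (T\<^sup>2 * (exp_const * s\<^sup>2))"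
    using exp_const_pos by (subst ennreal_mult) auto
  finally have "ennreal (2 * T * (pi * (s/4)\<^sup>2)) \<le> ?I + ennreal (T\<^sup>2 * (exp_const * s\<^sup>2))" .
  moreover have "2 * T * (pi * (s/4)\<^sup>2) = area_const * s\<^sup>2 + T\<^sup>2 * (exp_const * s\<^sup>2)"
    using exp_const_pos by (simp add: T_def area_const_def power2_eq_square field_simps)
  moreover have "0 \<le> area_const * s\<^sup>2" "0 \<le> T\<^sup>2 * (exp_const * s\<^sup>2)"
    using area_const_pos exp_const_pos by auto
  ultimately have "ennreal (area_const * s\<^sup>2) + ennreal (T\<^sup>2 * (exp_const * s\<^sup>2)) \<le> ?I + ennreal (T\<^sup>2 * (exp_const * s\<^sup>2))"
    by (simp flip: ennreal_plus)
  then have I: "ennreal (area_const * s\<^sup>2) \<le> ?I" by simp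
  have "ennreal (area_const * s\<^sup>2 * exp (2 * c)) = ennreal (exp (2 * c)) * ennreal (area_const * s\<^sup>2)"
    using area_const_pos by (simp add: mult.commute flip: ennreal_mult)
  also have "\<dots> \<le> ennreal (exp (2 * c)) * ?I" by (intro mult_left_mono I) auto
  also have "\<dots> = (\<integral>\<^sup>+y. ennreal (exp (2 * c)) * (ennreal (exp (2 * (log_pot y - c))) * indicator ?B y) \<partial>lborel)"
    by (rule nn_integral_cmult[symmetric]) measurable
  also have "\<dots> = (\<integral>\<^sup>+y\<in>?B. ennreal (exp (2 * log_pot y)) \<partial>lborel)"
    by (intro nn_integral_cong) (simp add: mult.assoc[symmetric] algebra_simps flip: ennreal_mult exp_add)
  finally show ?thesis by (simp add: c_def)
qed

end

section \<open>Bounding the harmonic part\<close>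

text \<open>Cauchy's inequality on disks of radius d/4 inside ball z0 (d/2) gives |G''| <= 2 L /
  (d/4) on ball z0 (d/4); two applications of the mean value inequality yield the quadratic
  error.\<close>

lemma holomorphic_almost_affine:
  fixes G :: "complex \<Rightarrow> complex"
  assumes G: "G holomorphic_on S" "open S" "ball z0 (d/2) \<subseteq> S"
    and L: "\<And>z. z \<in> ball z0 (d/2) \<Longrightarrow> norm (deriv G z) \<le> 2 * L"
    and r: "0 < r" "r \<le> d/4" and y: "y \<in> ball z0 r"
  shows "norm (G y - G z0 - deriv G z0 * (y - z0)) \<le> 8 * L * r\<^sup>2 / d"
proof -
  have d: "d > 0" using r by simp
  have holG': "deriv G holomorphic_on S" by (rule holomorphic_deriv[OF G(1,2)])
  have L0: "L \<ge> 0" using L[of z0] d norm_ge_zero[of "deriv G z0"] unfolding mem_ball dist_self by linarith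
  have sub: "cball z (d/4) \<subseteq> ball z0 (d/2)" if "z \<in> ball z0 (d/4)" for z
  proof
    fix x assume "x \<in> cball z (d/4)"
    then show "x \<in> ball z0 (d/2)"
      using that dist_triangle[of z0 x z] by simp
  qed
  have G'': "norm (deriv (deriv G) z) \<le> 8 * L / d" if z: "z \<in> ball z0 (d/4)" for z
  proof -
    have S': "cball z (d/4) \<subseteq> S" using sub[OF z] G(3) by blast
    have "norm ((deriv ^^ 1) (deriv G) z) \<le> fact 1 * (2 * L) / (d/4) ^ 1"
    proof (rule Cauchy_inequality)
      show "deriv G holomorphic_on ball z (d/4)"
        using holG' S' ball_subset_cball by (blast intro: holomorphic_on_subset)
      show "continuous_on (cball z (d/4)) (deriv G)"
        using holG' S' by (blast intro: holomorphic_on_imp_continuous_on holomorphic_on_subset)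
      show "norm (deriv G x) \<le> 2 * L" if "norm (z - x) = d/4" for x
        using sub[OF z] that by (intro L) (auto simp: dist_norm)
    qed (use d in simp)
    then show ?thesis by simp
  qed
  have rsub: "ball z0 r \<subseteq> ball z0 (d/4)" "ball z0 r \<subseteq> S"
    using r d G(3) by (auto simp: subset_iff)
  have zS: "z \<in> S" if "z \<in> ball z0 r" for z using that rsub by blast
  have D1: "norm (deriv G z - deriv G z0) \<le> 8 * L / d * r" if z: "z \<in> ball z0 r" for z
  proof -
    have "norm (deriv G z - deriv G z0) \<le> 8 * L / d * norm (z - z0)"
    proof (rule field_differentiable_bound[OF convex_ball[of z0 r], where f'="deriv (deriv G)"])
      show "(deriv G has_field_derivative deriv (deriv G) w) (at w within ball z0 r)" if "w \<in> ball z0 r" for w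
        using holomorphic_derivI[OF holG' G(2) zS[OF that]] by (rule has_field_derivative_at_within)
      show "norm (deriv (deriv G) w) \<le> 8 * L / d" if "w \<in> ball z0 r" for w
        using G''[of w] that rsub by blast
    qed (use z r in auto)
    also have "\<dots> \<le> 8 * L / d * r"
      using z L0 d by (intro mult_left_mono) (auto simp: dist_norm norm_minus_commute)
    finally show ?thesis .
  qed
  have "norm ((G y - deriv G z0 * y) - (G z0 - deriv G z0 * z0)) \<le> 8 * L / d * r * norm (y - z0)"
  proof (rule field_differentiable_bound[OF convex_ball[of z0 r], where f="\<lambda>z. G z - deriv G z0 * z" and f'="\<lambda>z. deriv G z - deriv G z0"])
    show "((\<lambda>z. G z - deriv G z0 * z) has_field_derivative deriv G w - deriv G z0) (at w within ball z0 r)" if "w \<in> ball z0 r" for w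
      by (rule has_field_derivative_at_within)
        (auto intro!: derivative_eq_intros holomorphic_derivI[OF G(1,2) zS[OF that]])
  qed (use D1 y r in auto)
  also have "\<dots> \<le> 8 * L / d * r * r"
    using y L0 d r by (intro mult_left_mono) (auto simp: dist_norm norm_minus_commute)
  finally show ?thesis by (simp add: algebra_simps power2_eq_square)
qed

lemma borel_measurable_ennreal_indicator:
  fixes f :: "'a::euclidean_space \<Rightarrow> real"
  assumes "continuous_on A f" "A \<in> sets borel"
  shows "(\<lambda>z. ennreal (f z) * indicator A z) \<in> borel_measurable borel"
proof -
  have [measurable]: "(\<lambda>z. indicator A z *\<^sub>R f z) \<in> borel_measurable borel"
    by (intro borel_measurable_continuous_on_indicator assms)
  have "(\<lambda>z. ennreal (indicator A z *\<^sub>R f z)) \<in> borel_measurable borel" by measurable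
  also have "(\<lambda>z. ennreal (indicator A z *\<^sub>R f z)) = (\<lambda>z. ennreal (f z) * indicator A z)"
    by (auto simp: indicator_def)
  finally show ?thesis .
qed

lemma area_density_measurable:
  fixes u :: "complex \<Rightarrow> real"
  assumes "continuous_on (ball 0 1) u"
  shows "(\<lambda>z. ennreal (exp (2 * u z)) * indicator (ball 0 1) z) \<in> borel_measurable borel"
  by (intro borel_measurable_ennreal_indicator continuous_intros assms) auto

lemma emeasure_area_measure:
  assumes "continuous_on (ball 0 1) u" "X \<in> sets borel" "X \<subseteq> ball 0 1"
  shows "emeasure (area_measure (ball 0 1) u) X = (\<integral>\<^sup>+z\<in>X. ennreal (exp (2 * u z)) \<partial>lborel)"
proof -
  have "emeasure (area_measure (ball 0 1) u) X = (\<integral>\<^sup>+z. ennreal (exp (2 * u z)) * indicator (ball 0 1) z * indicator X z \<partial>lborel)"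
    unfolding area_measure_def using area_density_measurable[OF assms(1)] assms(2)
    by (subst emeasure_density) auto
  also have "\<dots> = (\<integral>\<^sup>+z\<in>X. ennreal (exp (2 * u z)) \<partial>lborel)"
    using assms(3) by (intro nn_integral_cong) (auto simp: indicator_def)
  finally show ?thesis .
qed

text \<open>Total cost of walking downhill: each step is cheaper than the previous one by a factor e
  >= 2.\<close>

lemma sum_exp_minus_le: "(\<Sum>i<n. exp (- real i)) \<le> 2"
proof -
  have "exp (- real i) \<le> (1/2) ^ i" for i
  proof -
    have "2 \<le> exp (1::real)" using exp_ge_add_one_self[of 1] by simp
    then have "exp (-1::real) \<le> 1/2" by (simp add: exp_minus field_simps)
    then have "exp (-1::real) ^ i \<le> (1/2) ^ i" by (intro power_mono) auto
    then show ?thesis by (simp flip: exp_of_nat_mult)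
  qed
  then have "(\<Sum>i<n. exp (- real i)) \<le> (\<Sum>i<n. (1/2) ^ i)" by (intro sum_mono)
  also have "\<dots> \<le> (2::real)" by (simp add: sum_gp_strict)
  finally show ?thesis .
qed

section \<open>The area density argument\<close>

context planar_charge
begin

text \<open>Otherwise \<open>Re G\<close> is nearly affine on the scale \<open>s = 2 / |G' z0|\<close> around the point \<open>z0\<close> where the
  scale-invariant quantity \<open>(3/4 - |z|) |G' z|\<close> is maximal. A path may then travel downhill for \<open>N\<close> steps, move
  sideways at little cost and climb up again, so that \<open>N\<close> disjoint disks beside \<open>z0\<close> all lie in
  one geodesic ball of radius comparable to the diameter of a single disk.\<close>

lemma holomorphic_part_bound:
  fixes G :: "complex \<Rightarrow> complex" and N :: nat
  assumes G: "G holomorphic_on ball 0 (7/8)"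
    and u: "continuous_on (ball 0 1) u"
    and rep: "\<And>z. norm z < 7/8 \<Longrightarrow> u z = log_pot z + Re (G z)"
    and area: "\<And>r z. r > 0 \<Longrightarrow> z \<in> ball 0 (3/4) \<Longrightarrow>
      emeasure (area_measure (ball 0 1) u) (geodesic_ball (ball 0 1) u z r) / ennreal (pi * r\<^sup>2) < ennreal \<Lambda>"
    and N: "N \<ge> 1" "\<Lambda> * pi * 49 * dist_const\<^sup>2 * exp 6 \<le> real N * area_const * exp (-4)"
    and R: "R = real N + 2" "2 * m0 \<le> 1/2" "R powr (2 * m0) \<le> 2"
    and z: "norm z < 3/4"
  shows "(3/4 - norm z) * norm (deriv G z) < 32 * R\<^sup>2"
proof (rule ccontr)
  assume neg: "\<not> (3/4 - norm z) * norm (deriv G z) < 32 * R\<^sup>2"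
  let ?D = "ball (0::complex) 1"
  have R1: "R \<ge> 1" "R \<ge> 3" using R N by auto
  have holG': "deriv G holomorphic_on ball 0 (7/8)" by (intro holomorphic_deriv G) auto
  \<comment> \<open>The weight makes f vanish on the boundary circle, so a positive maximum is
    attained inside, with d > 0.\<close>
  define f where "f w = (3/4 - norm w) * norm (deriv G w)" for w
  have "continuous_on (cball 0 (3/4)) f"
    unfolding f_def
    by (intro continuous_intros continuous_on_subset[OF holomorphic_on_imp_continuous_on[OF holG']]) auto
  then obtain z0 where z0: "z0 \<in> cball 0 (3/4)" "\<And>w. w \<in> cball 0 (3/4) \<Longrightarrow> f w \<le> f z0"
    using continuous_attains_sup[of "cball (0::complex) (3/4)" f] by (auto simp del: mem_cball)
  define M where "M = f z0"
  have M: "M \<ge> 32 * R\<^sup>2" using neg z0(2)[of z] z by (simp add: M_def f_def)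
  have "R\<^sup>2 > 0" using R1 by simp
  then have M0: "M > 0" using M by linarith
  define d where "d = 3/4 - norm z0"
  define L where "L = norm (deriv G z0)"
  have dL: "d * L = M" by (simp add: M_def f_def d_def L_def)
  have "d \<noteq> 0" using dL M0 by auto
  then have d: "d > 0" using z0(1) by (simp add: d_def)
  have L: "L > 0" using dL M0 d by (metis zero_less_mult_pos)
  \<comment> \<open>\<sigma> is the distance over which the linear part of \<open>Re G\<close> falls
    by 1 and will be the mesh of a lattice; disks of radius s = 2 \<sigma> contain the neighbours of
    their centre.\<close>
  define \<sigma> where "\<sigma> = 1 / L"
  define s where "s = 2 * \<sigma>"
  have \<sigma>: "\<sigma> > 0" "\<sigma> * L = 1" and s: "s > 0" using L by (auto simp: \<sigma>_def s_def)
  have \<sigma>M: "\<sigma> * M = d" using L by (simp add: \<sigma>_def flip: dL)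
  \<comment> \<open>The origin of \<open>32 * R\<^sup>2\<close>: it makes the affine error 8 L (R
    s)^2 / d at most 1 on the disk that carries the whole array.\<close>
  have RsM: "(R * s) * (4 * R) \<le> d / 4"
  proof -
    have "(R * s) * (4 * R) = \<sigma> * (8 * R\<^sup>2)" by (simp add: s_def power2_eq_square)
    also have "\<dots> \<le> \<sigma> * (M / 4)" using \<sigma> M by (intro mult_left_mono) auto
    finally show ?thesis using \<sigma>M by simp
  qed
  have Rs: "0 < R * s" "R * s \<le> d / 4"
  proof -
    show pos: "0 < R * s" using R1 s by simp
    have "R * s * 1 \<le> (R * s) * (4 * R)" using R1 pos by (intro mult_left_mono) auto
    then show "R * s \<le> d / 4" using RsM by simp
  qed
  have subD: "ball z0 (R * s) \<subseteq> ball 0 (3/4)"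
  proof
    fix y assume "y \<in> ball z0 (R * s)"
    then have "dist z0 y < d / 4" using Rs by simp
    then show "y \<in> ball 0 (3/4)" using d norm_triangle_ineq[of z0 "y - z0"] by (simp add: d_def dist_norm norm_minus_commute)
  qed
  define H0 where "H0 = Re (G z0)"
  have lin: "\<bar>Re (G y) - H0 - Re (deriv G z0 * (y - z0))\<bar> \<le> 1" if y: "y \<in> ball z0 (R * s)" for y
  proof -
    have half: "ball z0 (d/2) \<subseteq> ball 0 (7/8)"
    proof
      fix w assume "w \<in> ball z0 (d/2)"
      then show "w \<in> ball 0 (7/8)" using d norm_triangle_ineq[of z0 "w - z0"] by (simp add: d_def dist_norm norm_minus_commute)
    qed
    have "norm (G y - G z0 - deriv G z0 * (y - z0)) \<le> 8 * L * (R * s)\<^sup>2 / d"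
    proof (rule holomorphic_almost_affine[OF G open_ball half _ Rs y])
      fix w assume "w \<in> ball z0 (d/2)"
      then have "norm (w - z0) < d/2" by (simp add: dist_norm norm_minus_commute)
      moreover have "norm w \<le> norm z0 + norm (w - z0)" using norm_triangle_ineq[of z0 "w - z0"] by simp
      moreover have "norm z0 = 3/4 - d" by (simp add: d_def)
      moreover have "a \<le> 3/4 - d/2" if "e < d/2" "a \<le> b + e" "b = 3/4 - d" for a b e :: real
        using that by (simp add: field_simps)
      ultimately have w: "norm w \<le> 3/4 - d/2" by blast
      \<comment> \<open>Maximality of f, together with 3/4 - |w| >= d/2, bounds |G' w| by twice |G'
        z0|.\<close>
      then have "d/2 * norm (deriv G w) \<le> f w" unfolding f_def by (intro mult_right_mono) auto
      also have "\<dots> \<le> d * L" using z0(2)[of w] w d by (simp add: dL M_def)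
      finally show "norm (deriv G w) \<le> 2 * L" using d by (simp add: field_simps)
    qed
    also have "8 * L * (R * s)\<^sup>2 / d = (R * s) * (4 * R) * (4 * (\<sigma> * L)) / d"
      by (simp add: s_def power2_eq_square)
    also have "\<dots> \<le> d / 4 * 4 / d"
      using RsM d unfolding \<sigma>(2) by (intro divide_right_mono) auto
    also have "\<dots> = 1" using d by simp
    finally have "norm (G y - G z0 - deriv G z0 * (y - z0)) \<le> 1" .
    then show ?thesis
      using abs_Re_le_cmod[of "G y - G z0 - deriv G z0 * (y - z0)"]
      unfolding H0_def minus_complex.simps by linarith
  qed
  \<comment> \<open>The unit direction of steepest ascent of \<open>Re G\<close> at z0.\<close>
  define \<omega> where "\<omega> = cnj (deriv G z0) / of_real L"
  have \<omega>: "norm \<omega> = 1" "deriv G z0 * \<omega> = of_real L"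
  proof -
    show "norm \<omega> = 1" using L by (simp add: \<omega>_def norm_divide) (simp add: L_def)
    have "deriv G z0 * cnj (deriv G z0) = of_real (L * L)"
      by (simp add: L_def complex_norm_square[symmetric] power2_eq_square flip: of_real_mult)
    then show "deriv G z0 * \<omega> = of_real L" using L by (simp add: \<omega>_def)
  qed
  \<comment> \<open>A square lattice of mesh \<sigma>: a counts the steps downhill, b those sideways
    along a level line of the linear part.\<close>
  define P where "P a b = z0 + of_real \<sigma> * \<omega> * Complex (- real a) (real b)" for a b :: nat
  have P00: "P 0 0 = z0" by (simp add: P_def complex_eq_iff)
  have P_diff: "norm (P a b - P a' b') = \<sigma> * norm (Complex (real a' - real a) (real b - real b'))" for a b a' b'
  proof -
    have "P a b - P a' b' = of_real \<sigma> * \<omega> * (Complex (- real a) (real b) - Complex (- real a') (real b'))"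
      by (simp add: P_def algebra_simps)
    also have "Complex (- real a) (real b) - Complex (- real a') (real b') = Complex (real a' - real a) (real b - real b')"
      by (simp add: complex_eq_iff)
    finally show ?thesis using \<omega> \<sigma> by (simp add: norm_mult)
  qed
  have ReP: "Re (deriv G z0 * (P a b - z0)) = - real a" for a b
  proof -
    have "deriv G z0 * (P a b - z0) = of_real \<sigma> * (deriv G z0 * \<omega>) * Complex (- real a) (real b)"
      by (simp add: P_def)
    then show ?thesis using \<sigma>(2) by (simp add: \<omega> mult.assoc[symmetric] flip: of_real_mult)
  qed
  \<comment> \<open>R = N + 2 leaves room for this, the centre being at distance at most 2 N
    \<sigma> = N s from z0.\<close>
  have ballP: "ball (P a b) s \<subseteq> ball z0 (R * s)" if "a \<le> N" "b \<le> N" for a b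
  proof
    fix y assume y: "y \<in> ball (P a b) s"
    have "norm (P a b - z0) = \<sigma> * norm (Complex (0 - real a) (real b - 0))"
      using P_diff[of a b 0 0] by (simp add: P00)
    also have "\<dots> \<le> \<sigma> * (real a + real b)"
      using \<sigma> cmod_le[of "Complex (0 - real a) (real b - 0)"] by (intro mult_left_mono) auto
    also have "\<dots> \<le> \<sigma> * (2 * real N)" using that \<sigma> by (intro mult_left_mono) auto
    finally have "dist z0 (P a b) \<le> real N * s" by (simp add: s_def dist_norm norm_minus_commute mult_ac)
    then have "dist z0 y < real N * s + s"
      using y dist_triangle[of z0 y "P a b"] by simp
    also have "\<dots> \<le> R * s" using s by (simp add: R algebra_simps)
    finally show "y \<in> ball z0 (R * s)" by simp
  qed
  have ReG: "\<bar>Re (G y) - H0 + real a\<bar> \<le> 1 + L * t"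
    if "a \<le> N" "b \<le> N" "y \<in> ball (P a b) t" "t \<le> s" for a b y t
  proof -
    have "y \<in> ball (P a b) s" using that by simp
    then have "y \<in> ball z0 (R * s)" using ballP[OF that(1,2)] by blast
    then have "\<bar>Re (G y) - H0 - Re (deriv G z0 * (y - z0))\<bar> \<le> 1" by (rule lin)
    moreover have "deriv G z0 * (y - z0) = deriv G z0 * (P a b - z0) + deriv G z0 * (y - P a b)"
      by (simp add: algebra_simps)
    then have "Re (deriv G z0 * (y - z0)) = - real a + Re (deriv G z0 * (y - P a b))"
      by (simp only: plus_complex.simps ReP)
    moreover have "\<bar>Re (deriv G z0 * (y - P a b))\<bar> \<le> L * t"
    proof -
      have "\<bar>Re (deriv G z0 * (y - P a b))\<bar> \<le> norm (deriv G z0 * (y - P a b))" by (rule abs_Re_le_cmod)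
      also have "\<dots> = L * norm (y - P a b)" by (simp add: norm_mult L_def)
      also have "\<dots> \<le> L * t" using that L by (intro mult_left_mono) (auto simp: dist_norm norm_minus_commute)
      finally show ?thesis .
    qed
    ultimately show ?thesis by linarith
  qed
  define c where "c = log_mean z0 (R * s)"
  \<comment> \<open>The cost of crossing a disk in row 0; it falls by a factor e with each row
    downhill. The 3 is the affine error 1 plus L s = 2.\<close>
  define X where "X = dist_const * s * exp (c + H0 + 3)"
  have X: "X > 0" using dist_const_pos s by (simp add: X_def)
  let ?d = "geodesic_dist ?D u"
  have step: "?d p q \<le> ennreal (X * exp (- real a))"
    if "a \<le> N" "b \<le> N" "p \<in> ball (P a b) s" "q \<in> ball (P a b) s" for a b p q
  proof -
    have BD: "ball (P a b) s \<subseteq> ball 0 (3/4)" using ballP[OF that(1,2)] subD by blast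
    have "?d p q \<le> ennreal (dist_const * s * exp (log_mean z0 (R * s) + (H0 + 3 - real a)))"
    proof (rule geodesic_dist_le_in_ball[OF s R1(1) R(2,3) ballP[OF that(1,2)] _ that(3,4) u])
      show "ball (P a b) s \<subseteq> ball 0 1" using BD by (auto simp: subset_iff)
      show "u y \<le> log_pot y + (H0 + 3 - real a)" if y: "y \<in> ball (P a b) s" for y
      proof -
        have "norm y < 7/8" using BD y by fastforce
        moreover have "L * s = 2" using \<sigma> by (simp add: s_def mult.commute)
        ultimately show ?thesis using ReG[OF \<open>a \<le> N\<close> \<open>b \<le> N\<close> y order_refl] rep[of y] by simp
      qed
    qed
    also have "dist_const * s * exp (log_mean z0 (R * s) + (H0 + 3 - real a)) = X * exp (- real a)"
      by (simp add: X_def c_def mult.assoc flip: exp_add)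
    finally show ?thesis .
  qed
  have nbr: "P a b \<in> ball (P a b) s" "P (Suc a) b \<in> ball (P a b) s" "P a (Suc b) \<in> ball (P a b) s" for a b
    using P_diff[of a b "Suc a" b] P_diff[of a b a "Suc b"] \<sigma> s
    by (auto simp: dist_norm s_def cmod_def)
  have tri: "?d p q \<le> a + b" if "?d p m \<le> a" "?d m q \<le> b" for p q m a b
    by (rule order_trans[OF geodesic_dist_triangle[OF u] add_mono[OF that]])
  have down: "?d (P 0 b) (P j b) \<le> ennreal (X * (\<Sum>i<j. exp (- real i)))" if "j \<le> N" "b \<le> N" for j b
    using that
  proof (induction j)
    case 0
    have "P 0 b \<in> ball 0 (3/4)"
      using subsetD[OF subD subsetD[OF ballP[OF le0 0(2)] nbr(1)]] .
    then have "?d (P 0 b) (P 0 b) \<le> curve_length u (linepath (P 0 b) (P 0 b))"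
      by (intro geodesic_dist_le_curve_length) auto
    also have "\<dots> = 0" by (simp add: curve_length_linepath)
    finally show ?case by simp
  next
    case (Suc j)
    have "?d (P 0 b) (P (Suc j) b) \<le> ennreal (X * (\<Sum>i<j. exp (- real i))) + ennreal (X * exp (- real j))"
      using Suc by (intro tri[where m="P j b"] step[of j b] nbr) auto
    also have "\<dots> = ennreal (X * (\<Sum>i<Suc j. exp (- real i)))"
      using X by (simp add: sum_nonneg distrib_left flip: ennreal_plus)
    finally show ?case .
  qed
  have up: "?d (P j b) (P 0 b) \<le> ennreal (X * (\<Sum>i<j. exp (- real i)))" if "j \<le> N" "b \<le> N" for j b
    using that
  proof (induction j)
    case 0
    then show ?case using down[of 0 b] by simp
  next
    case (Suc j)
    have "?d (P (Suc j) b) (P 0 b) \<le> ennreal (X * exp (- real j)) + ennreal (X * (\<Sum>i<j. exp (- real i)))"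
      using Suc by (intro tri[where m="P j b"] step[of j b] nbr) auto
    also have "\<dots> = ennreal (X * (\<Sum>i<Suc j. exp (- real i)))"
      using X by (simp add: sum_nonneg distrib_left add.commute flip: ennreal_plus)
    finally show ?case .
  qed
  have side: "?d (P N 0) (P N k) \<le> ennreal (X * exp (- real N) * (1 + real k))" if "k \<le> N" for k
    using that
  proof (induction k)
    case 0
    \<comment> \<open>The zero distance is bounded by one crossing, whence 1 + k instead of
      k.\<close>
    show ?case using step[of N 0 "P N 0" "P N 0"] nbr by simp
  next
    case (Suc k)
    have "?d (P N 0) (P N (Suc k)) \<le> ennreal (X * exp (- real N) * (1 + real k)) + ennreal (X * exp (- real N))"
      using Suc by (intro tri[where m="P N k"] step[of N k] nbr) auto
    also have "\<dots> = ennreal (X * exp (- real N) * (1 + real (Suc k)))"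
      using X by (simp add: algebra_simps flip: ennreal_plus)
    finally show ?case .
  qed
  \<comment> \<open>Down for 2 X, sideways for X because 1 + k <= exp N pays for the steps at depth
    N, up for 2 X, and X to reach any point of the disk. The 7 in place of 6 gives the strict
    inequality of the open geodesic ball.\<close>
  have dist_all: "?d z0 q < ennreal (7 * X)" if "k < N" "q \<in> ball (P 0 k) (s/4)" for k q
  proof -
    have k: "k \<le> N" using that by simp
    have q: "q \<in> ball (P 0 k) s" using that s by simp
    have sm: "X * (\<Sum>i<N. exp (- real i)) \<le> X * 2" using X by (intro mult_left_mono sum_exp_minus_le) auto
    have "1 + real k \<le> 1 + real N" using k by simp
    then have "1 + real k \<le> exp (real N)" using exp_ge_add_one_self by (rule order_trans)
    then have "exp (- real N) * (1 + real k) \<le> exp (- real N) * exp (real N)"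
      by (intro mult_left_mono) auto
    then have "exp (- real N) * (1 + real k) \<le> 1" by (simp flip: exp_add)
    then have sd: "X * exp (- real N) * (1 + real k) \<le> X * 1"
      unfolding mult.assoc using X by (intro mult_left_mono) auto
    have "?d z0 q \<le> ennreal (X * 2) + (ennreal (X * 1) + (ennreal (X * 2) + ennreal (X * exp (- real 0))))"
    proof (rule tri[where m="P N 0"])
      show "?d z0 (P N 0) \<le> ennreal (X * 2)"
        using down[of N 0] ennreal_leI[OF sm] by (auto simp: P00 intro: order_trans)
      show "?d (P N 0) q \<le> ennreal (X * 1) + (ennreal (X * 2) + ennreal (X * exp (- real 0)))"
      proof (rule tri[where m="P N k"])
        show "?d (P N 0) (P N k) \<le> ennreal (X * 1)"
          using side[OF k] ennreal_leI[OF sd] by (rule order_trans)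
        show "?d (P N k) q \<le> ennreal (X * 2) + ennreal (X * exp (- real 0))"
        proof (rule tri[where m="P 0 k"])
          show "?d (P N k) (P 0 k) \<le> ennreal (X * 2)"
            using up[OF order_refl k] ennreal_leI[OF sm] by (rule order_trans)
          show "?d (P 0 k) q \<le> ennreal (X * exp (- real 0))"
            by (rule step[OF _ k nbr(1) q]) simp
        qed
      qed
    qed
    also have "\<dots> = ennreal (6 * X)" using X by (simp flip: ennreal_plus)
    also have "\<dots> < ennreal (7 * X)" using X by (simp add: ennreal_less_iff)
    finally show ?thesis .
  qed
  let ?A = "area_measure ?D u"
  let ?B = "\<lambda>k. ball (P 0 k) (s/4)"
  \<comment> \<open>Lower bound for the area of each quarter disk in row 0, where Re G >= H0 - 2:
    the affine error 1 plus L s / 4 = 1/2 stays below 2.\<close>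
  define W where "W = exp (2 * (H0 - 2)) * (area_const * s\<^sup>2 * exp (2 * c))"
  have W: "W > 0" using area_const_pos s by (simp add: W_def)
  have BkD: "?B k \<subseteq> ball 0 (3/4)" if "k < N" for k
  proof -
    have "?B k \<subseteq> ball (P 0 k) s" using s by (intro subset_ball) auto
    then show ?thesis using ballP[of 0 k] subD that by fastforce
  qed
  have areaB: "ennreal W \<le> emeasure ?A (?B k)" if k: "k < N" for k
  proof -
    have "ennreal W = ennreal (exp (2 * (H0 - 2))) * ennreal (area_const * s\<^sup>2 * exp (2 * log_mean z0 (R * s)))"
      using area_const_pos by (simp add: W_def c_def flip: ennreal_mult)
    also have "\<dots> \<le> ennreal (exp (2 * (H0 - 2))) * (\<integral>\<^sup>+y\<in>?B k. ennreal (exp (2 * log_pot y)) \<partial>lborel)"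
      by (intro mult_left_mono nn_integral_exp_log_pot_ge s R1 R ballP) (use k in auto)
    also have "\<dots> = (\<integral>\<^sup>+y. ennreal (exp (2 * (H0 - 2))) * (ennreal (exp (2 * log_pot y)) * indicator (?B k) y) \<partial>lborel)"
      by (rule nn_integral_cmult[symmetric]) measurable
    also have "\<dots> \<le> (\<integral>\<^sup>+y\<in>?B k. ennreal (exp (2 * u y)) \<partial>lborel)"
    proof (rule nn_integral_mono)
      fix y
      show "ennreal (exp (2 * (H0 - 2))) * (ennreal (exp (2 * log_pot y)) * indicator (?B k) y) \<le> ennreal (exp (2 * u y)) * indicator (?B k) y"
      proof (cases "y \<in> ?B k")
        case True
        have Ls: "L * (s/4) = 1/2" using \<sigma> by (simp add: s_def mult.commute)
        have "\<bar>Re (G y) - H0 + real 0\<bar> \<le> 1 + L * (s/4)"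
          using k s by (intro ReG[OF _ _ True]) auto
        then have "Re (G y) \<ge> H0 - 2" unfolding Ls of_nat_0 abs_le_iff by linarith
        moreover have "norm y < 7/8" using BkD[OF k] True by fastforce
        ultimately have "2 * (H0 - 2) + 2 * log_pot y \<le> 2 * u y" using rep[of y] by simp
        then show ?thesis using True by (simp add: ennreal_leI flip: ennreal_mult exp_add)
      qed simp
    qed
    also have "\<dots> = emeasure ?A (?B k)"
      using BkD[OF k] by (intro emeasure_area_measure[OF u, symmetric]) (auto simp: subset_iff)
    finally show ?thesis .
  qed
  \<comment> \<open>Adjacent centres are at distance \<sigma> = s / 2, exactly the sum of the two
    radii.\<close>
  have disj: "disjoint_family_on ?B {..<N}"
    unfolding disjoint_family_on_def
  proof (intro ballI impI)
    fix k l assume kl: "k \<in> {..<N}" "l \<in> {..<N}" "k \<noteq> l"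
    show "?B k \<inter> ?B l = {}"
    proof (rule disjoint_ballI)
      have "norm (P 0 k - P 0 l) = \<sigma> * \<bar>real k - real l\<bar>"
        using P_diff[of 0 k 0 l] by (simp add: cmod_def)
      moreover have "1 \<le> \<bar>real k - real l\<bar>" using kl by linarith
      ultimately have "\<sigma> * 1 \<le> norm (P 0 k - P 0 l)" using \<sigma> by (simp only: mult_left_mono less_imp_le)
      then show "s/4 + s/4 \<le> dist (P 0 k) (P 0 l)" by (simp add: s_def dist_norm)
    qed
  qed
  have z0B: "z0 \<in> ball 0 (3/4)" using d by (simp add: d_def)
  let ?g = "geodesic_ball ?D u z0 (7 * X)"
  have og: "open ?g" by (rule open_geodesic_ball[OF open_ball u])
  have sets: "sets ?A = sets borel" by (simp add: area_measure_def)
  have "ennreal (real N * W) = (\<Sum>k<N. ennreal W)" using W by (simp add: ennreal_of_nat_eq_real_of_nat ennreal_mult)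
  also have "\<dots> \<le> (\<Sum>k<N. emeasure ?A (?B k))" by (intro sum_mono areaB) auto
  also have "\<dots> = emeasure ?A (\<Union>k<N. ?B k)" by (intro sum_emeasure disj) (auto simp: sets)
  also have "\<dots> \<le> emeasure ?A ?g"
  proof (rule emeasure_mono)
    show "(\<Union>k<N. ?B k) \<subseteq> ?g"
    proof (rule UN_least)
      fix k assume "k \<in> {..<N}"
      then show "?B k \<subseteq> ?g" using dist_all[of k] BkD[of k] unfolding geodesic_ball_def by force
    qed
    show "?g \<in> sets ?A" using og by (simp add: sets)
  qed
  finally have "ennreal (real N * W) / ennreal (pi * (7 * X)\<^sup>2) \<le> emeasure ?A ?g / ennreal (pi * (7 * X)\<^sup>2)"
    by (rule divide_right_mono_ennreal)
  also have "\<dots> < ennreal \<Lambda>" by (rule area[OF _ z0B]) (use X in simp)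
  also have "ennreal (real N * W) / ennreal (pi * (7 * X)\<^sup>2) = ennreal (real N * W / (pi * (7 * X)\<^sup>2))"
    using W X by (intro divide_ennreal) auto
  finally have "real N * W / (pi * (7 * X)\<^sup>2) < \<Lambda>"
    using W by (subst (asm) ennreal_less_iff) auto
  then have "real N * W < \<Lambda> * (pi * (7 * X)\<^sup>2)"
    using X by (simp add: divide_less_eq)
  moreover have "\<Lambda> * (pi * (7 * X)\<^sup>2) \<le> real N * W"
  proof -
    \<comment> \<open>The common factor of both sides, which carries all dependence on the metric;
      what remains is the hypothesis relating N to \<Lambda>.\<close>
    define Y where "Y = s\<^sup>2 * exp (2 * c + 2 * H0)"
    have eX: "exp (c + H0 + 3) * exp (c + H0 + 3) = exp (2 * c + 2 * H0) * exp 6"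
      by (simp flip: exp_add)
    have eW: "exp (2 * (H0 - 2)) * exp (2 * c) = exp (2 * c + 2 * H0) * exp (-4)"
      by (simp flip: exp_add)
    have "\<Lambda> * (pi * (7 * X)\<^sup>2) = \<Lambda> * pi * 49 * dist_const\<^sup>2 * s\<^sup>2 * (exp (c + H0 + 3) * exp (c + H0 + 3))"
      by (simp add: X_def power2_eq_square)
    also have "\<dots> = Y * (\<Lambda> * pi * 49 * dist_const\<^sup>2 * exp 6)" unfolding eX by (simp add: Y_def)
    also have "\<dots> \<le> Y * (real N * area_const * exp (-4))" by (intro mult_left_mono N) (simp add: Y_def)
    also have "\<dots> = real N * area_const * s\<^sup>2 * (exp (2 * (H0 - 2)) * exp (2 * c))" unfolding eW by (simp add: Y_def)
    also have "\<dots> = real N * W" by (simp add: W_def)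
    finally show ?thesis .
  qed
  ultimately show False by simp
qed

end

section \<open>The estimates\<close>

text \<open>Test the derivative on the gradient itself: its value there is |grad f|^2.\<close>

lemma norm_grad_le:
  fixes f :: "'a::euclidean_space \<Rightarrow> real"
  assumes f: "f differentiable (at x)" and K: "\<And>h. \<bar>frechet_derivative f (at x) h\<bar> \<le> K * norm h"
  shows "norm (grad f x) \<le> K"
proof -
  let ?D = "frechet_derivative f (at x)"
  have "(f has_derivative ?D) (at x)" using f by (simp add: frechet_derivative_works)
  then interpret bounded_linear ?D by (rule has_derivative_bounded_linear)
  have "?D (grad f x) = (\<Sum>b\<in>Basis. ?D b * ?D b)" by (simp add: grad_def sum scaleR)
  also have "\<dots> = grad f x \<bullet> grad f x"
    by (subst euclidean_inner) (simp add: grad_def inner_sum_left inner_Basis if_distrib cong: if_cong)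
  finally have "(norm (grad f x))\<^sup>2 \<le> K * norm (grad f x)"
    using K[of "grad f x"] by (simp add: power2_norm_eq_inner)
  then show ?thesis
  proof (cases "norm (grad f x) = 0")
    case True
    obtain b :: 'a where "b \<in> Basis" using nonempty_Basis by blast
    then have "0 \<le> K" using K[of b] by (simp add: order_trans[OF abs_ge_zero])
    then show ?thesis using True by simp
  qed (simp add: power2_eq_square)
qed

lemma powr_add_le:
  fixes a b p :: real
  assumes "a \<ge> 0" "b \<ge> 0" "1 < p" "p < 2"
  shows "(a + b) powr p \<le> 4 * (a powr p + b powr p)"
proof -
  have "2 powr p \<le> 2 powr (2::real)" using assms by (intro powr_mono) auto
  then have 4: "2 powr p \<le> (4::real)" by simp
  have "(a + b) powr p \<le> (2 * max a b) powr p" using assms by (intro powr_mono2) auto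
  also have "\<dots> = 2 powr p * max a b powr p" using assms by (intro powr_mult)
  also have "\<dots> \<le> 4 * max a b powr p" by (intro mult_right_mono 4) simp
  also have "max a b powr p \<le> a powr p + b powr p" by (simp add: max_def)
  finally show ?thesis by simp
qed

text \<open>For x > 1 through x^p <= x^2 <= (exp x)^2. It lets the exponential moment of the
  potential bound its L^p norm as well.\<close>

lemma powr_le_exp:
  fixes x p :: real
  assumes "x \<ge> 0" "1 < p" "p < 2"
  shows "x powr p \<le> exp (2 * x)"
proof (cases "x \<le> 1")
  case True
  then have "x powr p \<le> 1 powr p" using assms by (intro powr_mono2) auto
  also have "\<dots> \<le> exp (2 * x)" using assms by simp
  finally show ?thesis .
next
  case False
  then have "x powr p \<le> x powr 2" using assms by (intro powr_mono) auto
  also have "\<dots> = x * x" using False by (simp add: power2_eq_square)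
  also have "x \<le> exp x" using exp_ge_add_one_self[of x] by linarith
  then have "x * x \<le> exp x * exp x" using assms by (intro mult_mono) auto
  finally show ?thesis by (simp flip: exp_add)
qed

lemma ennreal_powr_le:
  assumes "x \<le> ennreal y" "y \<ge> 0" "p \<ge> 0"
  shows "ennreal_powr x p \<le> ennreal (y powr p)"
proof -
  obtain x' where x': "x = ennreal x'" "x' \<ge> 0"
    using assms by (cases x rule: ennreal_cases) (auto simp: top_unique)
  then have "x' \<le> y" using assms by simp
  then show ?thesis using x' assms by (simp add: ennreal_powr_def powr_mono2 ennreal_leI)
qed

section \<open>Norm estimates from a potential and a holomorphic part\<close>

text \<open>What the final estimates retain of an admissible metric: a charge of mass at most m0 and
  a holomorphic part with bounded derivative on the half disk. \<open>K\<close> and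
  \<open>m0\<close> will be fixed by \<Lambda> alone, so constants built from them are uniform in
  the metric.\<close>

locale decomposed_metric = planar_charge +
  fixes u :: "complex \<Rightarrow> real" and G :: "complex \<Rightarrow> complex" and K :: real
  assumes G: "G holomorphic_on ball 0 (7/8)"
    and u_cont: "continuous_on (ball 0 1) u"
    and u_diff: "\<And>z. norm z < 1 \<Longrightarrow> u differentiable (at z)"
    and rep: "\<And>z. norm z < 7/8 \<Longrightarrow> u z = log_pot z + Re (G z)"
    and deriv_G: "\<And>z. norm z < 1/2 \<Longrightarrow> norm (deriv G z) \<le> K"
    and m0_small: "2 * m0 \<le> 1/2"
begin

lemma K_nonneg: "K \<ge> 0"
  using order_trans[OF norm_ge_zero deriv_G[of 0]] by simp

text \<open>\<open>log_pot\<close> is differentiable at z because it agrees with u - Re G nearby;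
  then the Riesz bound on its derivative applies.\<close>

lemma norm_grad_u_le:
  assumes z: "norm z < 1/2"
  shows "norm (grad u z) \<le> K + 2 * riesz_pot z"
proof (rule norm_grad_le)
  show ud: "u differentiable (at z)" using z by (intro u_diff) simp
  let ?D = "frechet_derivative u (at z)"
  have D: "(u has_derivative ?D) (at z)" using ud by (simp add: frechet_derivative_works)
  have "(G has_field_derivative deriv G z) (at z)"
    by (rule holomorphic_derivI[OF G]) (use z in auto)
  then have "((\<lambda>w. Re (G w)) has_derivative (\<lambda>h. Re (deriv G z * h))) (at z)"
    by (intro has_derivative_Re) (simp add: has_field_derivative_def)
  with D have "((\<lambda>w. u w - Re (G w)) has_derivative (\<lambda>h. ?D h - Re (deriv G z * h))) (at z)"
    by (rule has_derivative_diff)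
  then have DV: "(log_pot has_derivative (\<lambda>h. ?D h - Re (deriv G z * h))) (at z)"
    by (rule has_derivative_transform_within_open[of _ _ _ _ "ball 0 (7/8)"]) (use z rep in auto)
  show "\<bar>?D h\<bar> \<le> (K + 2 * riesz_pot z) * norm h" for h
  proof -
    have "\<bar>?D h - Re (deriv G z * h)\<bar> \<le> 2 * riesz_pot z * norm h"
      by (rule has_derivative_log_pot_le[OF DV])
    moreover have "\<bar>Re (deriv G z * h)\<bar> \<le> K * norm h"
      using abs_Re_le_cmod[of "deriv G z * h"] mult_right_mono[OF deriv_G[OF z] norm_ge_zero[of h]]
      by (simp add: norm_mult)
    ultimately show ?thesis by (simp add: distrib_right)
  qed
qed

text \<open>For s <= 2 K the area of the disk, \<pi> / 4 < 1, suffices. For s > 2 K, |grad u| > s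
  forces 2 * riesz_pot > s - K > s / 2, and the weak bound for the Riesz potential applies at level
  s / 4.\<close>

lemma weak_L2_grad_le:
  "weak_Lp_norm 2 (ball 0 (1/2)) (grad u) \<le> ennreal (2 * K + 4 * (m0 * (riesz_const 1 + 1)))"
  unfolding weak_Lp_norm_def
proof (rule SUP_least)
  fix s :: real assume "s \<in> {0<..}"
  then have s: "s > 0" by simp
  let ?B = "ball (0::complex) (1/2)"
  let ?X = "{x \<in> ?B. s < norm (grad u x)}"
  have C: "0 \<le> m0 * (riesz_const 1 + 1)" using m0 by (simp add: add_nonneg_nonneg)
  show "ennreal s * ennreal_powr (emeasure lborel ?X) (1 / 2) \<le> ennreal (2 * K + 4 * (m0 * (riesz_const 1 + 1)))"
  proof (cases "s \<le> 2 * K")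
    case True
    have "emeasure lborel ?X \<le> emeasure lborel ?B" by (rule emeasure_mono) auto
    also have "\<dots> = ennreal (pi / 4)" by (simp add: emeasure_ball_complex power2_eq_square)
    also have "\<dots> \<le> ennreal 1" using pi_less_4 by (intro ennreal_leI) simp
    finally have "ennreal_powr (emeasure lborel ?X) (1 / 2) \<le> ennreal (1 powr (1/2))"
      by (rule ennreal_powr_le) auto
    then have "ennreal s * ennreal_powr (emeasure lborel ?X) (1 / 2) \<le> ennreal (2 * K) * 1"
      using True by (intro mult_mono ennreal_leI) auto
    also have "\<dots> \<le> ennreal (2 * K + 4 * (m0 * (riesz_const 1 + 1)))"
      using C by (simp add: ennreal_leI)
    finally show ?thesis .
  next
    case False
    define E where "E = {x \<in> ?B. s / 4 \<le> riesz_pot x}"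
    have Em: "E \<in> sets borel" unfolding E_def by measurable
    have Ele: "emeasure lborel E \<le> emeasure lborel ?B" by (rule emeasure_mono) (auto simp: E_def)
    then have Efin: "emeasure lborel E < \<infinity>" by (rule order_le_less_trans) (simp add: emeasure_ball_complex)
    have "?X \<subseteq> E"
    proof
      fix x assume x: "x \<in> ?X"
      then have "s < K + 2 * riesz_pot x" using norm_grad_u_le[of x] by simp
      then show "x \<in> E" using x False by (simp add: E_def)
    qed
    then have "emeasure lborel ?X \<le> emeasure lborel E" using Em by (intro emeasure_mono) auto
    also have "\<dots> = ennreal (measure lborel E)" using Efin by (intro emeasure_eq_ennreal_measure) auto
    finally have "ennreal_powr (emeasure lborel ?X) (1 / 2) \<le> ennreal (measure lborel E powr (1/2))"
      by (rule ennreal_powr_le) auto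
    then have "ennreal s * ennreal_powr (emeasure lborel ?X) (1 / 2) \<le> ennreal s * ennreal (sqrt (measure lborel E))"
      by (intro mult_left_mono) (auto simp: powr_half_sqrt)
    also have "\<dots> = ennreal (4 * (s / 4 * sqrt (measure lborel E)))"
      using s by (simp flip: ennreal_mult)
    also have "\<dots> \<le> ennreal (4 * (m0 * (riesz_const 1 + 1)))"
      using s by (intro ennreal_leI mult_left_mono riesz_pot_weak_L2 Em Efin) (auto simp: E_def)
    also have "\<dots> \<le> ennreal (2 * K + 4 * (m0 * (riesz_const 1 + 1)))"
      using K_nonneg by (intro ennreal_leI) simp
    finally show ?thesis .
  qed
qed

text \<open>The charge lives in the unit disk, where ln max(|x|, 1) = 0. So at unit scale no mean
  has to be subtracted.\<close>

lemma log_mean_unit: "log_mean 0 1 = 0"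
proof -
  have "F x * ln (max (norm (x - 0)) 1) = 0" for x
    using supp[of x] by (cases "norm x \<ge> 1") (auto simp: max_def)
  then show ?thesis unfolding log_mean_def by (simp only: integral_zero)
qed

lemma nn_integral_exp_abs_log_pot_unit:
  "(\<integral>\<^sup>+y\<in>ball 0 1. ennreal (exp (2 * \<bar>log_pot y\<bar>)) \<partial>lborel) \<le> ennreal exp_const"
  using nn_integral_exp_abs_log_pot_le[of 1 1 0 0] m0_small by (simp add: log_mean_unit)

lemma Re_G_near:
  assumes "norm z < 1/2"
  shows "\<bar>Re (G z) - Re (G 0)\<bar> \<le> K"
proof -
  have "norm (G z - G 0) \<le> K * norm (z - 0)"
  proof (rule field_differentiable_bound[OF convex_ball[of 0 "1/2"], where f'="deriv G"])
    show "(G has_field_derivative deriv G w) (at w within ball 0 (1/2))" if "w \<in> ball 0 (1/2)" for w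
      by (rule has_field_derivative_at_within, rule holomorphic_derivI[OF G]) (use that in auto)
  qed (use assms deriv_G in auto)
  also have "\<dots> \<le> K * 1" using assms K_nonneg by (intro mult_left_mono) auto
  finally show ?thesis using abs_Re_le_cmod[of "G z - G 0"] by simp
qed

text \<open>With H = Re (G 0), u differs from log_pot + H by at most K on the half disk, so its area
  lies between area_const * exp (2 (H - K)) and exp_const * exp (2 (H + K)). In particular
  \<open>ln\<close> is taken of a positive finite area.\<close>

lemma Re_G_0_le:
  "2 * \<bar>Re (G 0)\<bar> \<le> \<bar>ln (measure (area_measure (ball 0 1) u) (ball 0 (1/2)))\<bar> + 2 * K + \<bar>ln area_const\<bar> + \<bar>ln exp_const\<bar>"
proof -
  let ?A = "area_measure (ball 0 1) u"
  let ?B = "ball (0::complex) (1/2)"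
  define H where "H = Re (G 0)"
  define \<mu> where "\<mu> = measure ?A ?B"
  have e: "emeasure ?A ?B = (\<integral>\<^sup>+z\<in>?B. ennreal (exp (2 * u z)) \<partial>lborel)"
    by (rule emeasure_area_measure[OF u_cont]) auto
  have u_le: "2 * u z \<le> 2 * (H + K) + 2 * \<bar>log_pot z\<bar>" and u_ge: "2 * (H - K) + 2 * log_pot z \<le> 2 * u z"
    if "norm z < 1/2" for z
    using Re_G_near[OF that] rep[of z] that by (auto simp: H_def abs_le_iff)
  have "emeasure ?A ?B \<le> (\<integral>\<^sup>+z. ennreal (exp (2 * (H + K))) * (ennreal (exp (2 * \<bar>log_pot z\<bar>)) * indicator (ball 0 1) z) \<partial>lborel)"
    unfolding e
  proof (rule nn_integral_mono)
    fix z
    show "ennreal (exp (2 * u z)) * indicator ?B z \<le> ennreal (exp (2 * (H + K))) * (ennreal (exp (2 * \<bar>log_pot z\<bar>)) * indicator (ball 0 1) z)"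
      using u_le[of z] by (cases "z \<in> ?B") (auto intro!: ennreal_leI simp flip: ennreal_mult exp_add)
  qed
  also have "\<dots> = ennreal (exp (2 * (H + K))) * (\<integral>\<^sup>+z\<in>ball 0 1. ennreal (exp (2 * \<bar>log_pot z\<bar>)) \<partial>lborel)"
    by (rule nn_integral_cmult) measurable
  also have "\<dots> \<le> ennreal (exp (2 * (H + K))) * ennreal exp_const"
    by (intro mult_left_mono nn_integral_exp_abs_log_pot_unit) auto
  also have "\<dots> = ennreal (exp (2 * (H + K)) * exp_const)" by (simp add: ennreal_mult')
  finally have upper: "emeasure ?A ?B \<le> ennreal (exp (2 * (H + K)) * exp_const)" .
  have "ennreal (exp (2 * (H - K)) * area_const) = ennreal (exp (2 * (H - K))) * ennreal (area_const * 1\<^sup>2 * exp (2 * log_mean 0 (1 * 1)))"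
    by (simp add: log_mean_unit ennreal_mult')
  also have "\<dots> \<le> ennreal (exp (2 * (H - K))) * (\<integral>\<^sup>+y\<in>ball 0 (1/4). ennreal (exp (2 * log_pot y)) \<partial>lborel)"
    by (intro mult_left_mono nn_integral_exp_log_pot_ge) (use m0_small in auto)
  also have "\<dots> = (\<integral>\<^sup>+y. ennreal (exp (2 * (H - K))) * (ennreal (exp (2 * log_pot y)) * indicator (ball 0 (1/4)) y) \<partial>lborel)"
    by (rule nn_integral_cmult[symmetric]) measurable
  also have "\<dots> \<le> emeasure ?A ?B"
    unfolding e
  proof (rule nn_integral_mono)
    fix z
    show "ennreal (exp (2 * (H - K))) * (ennreal (exp (2 * log_pot z)) * indicator (ball 0 (1/4)) z) \<le> ennreal (exp (2 * u z)) * indicator ?B z"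
      using u_ge[of z] by (cases "z \<in> ball 0 (1/4)") (auto intro!: ennreal_leI simp flip: ennreal_mult exp_add)
  qed
  finally have lower: "ennreal (exp (2 * (H - K)) * area_const) \<le> emeasure ?A ?B" .
  have "emeasure ?A ?B = ennreal \<mu>"
    unfolding \<mu>_def using upper by (intro emeasure_eq_ennreal_measure) (auto simp: top_unique)
  then have \<mu>: "exp (2 * (H - K)) * area_const \<le> \<mu>" "\<mu> \<le> exp (2 * (H + K)) * exp_const"
    using upper lower exp_const_pos by (auto simp: ennreal_le_iff \<mu>_def)
  have pos: "exp (2 * (H - K)) * area_const > 0" using area_const_pos by simp
  then have "\<mu> > 0" using \<mu>(1) by linarith
  have "ln (exp (2 * (H - K)) * area_const) \<le> ln \<mu>" using \<mu>(1) pos \<open>\<mu> > 0\<close> by (subst ln_le_cancel_iff) auto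
  then have 1: "2 * (H - K) + ln area_const \<le> ln \<mu>" using area_const_pos by (simp add: ln_mult)
  have "ln \<mu> \<le> ln (exp (2 * (H + K)) * exp_const)" using \<mu>(2) exp_const_pos \<open>\<mu> > 0\<close> by (subst ln_le_cancel_iff) auto
  then have 2: "ln \<mu> \<le> 2 * (H + K) + ln exp_const" using exp_const_pos by (simp add: ln_mult)
  have "2 * \<bar>H\<bar> \<le> \<bar>ln \<mu>\<bar> + 2 * K + \<bar>ln area_const\<bar> + \<bar>ln exp_const\<bar>"
  proof -
    have "2 * H \<le> ln \<mu> + 2 * K + (- ln area_const) + 0" using 1 by simp
    also have "\<dots> \<le> \<bar>ln \<mu>\<bar> + 2 * K + \<bar>ln area_const\<bar> + \<bar>ln exp_const\<bar>"
      by (intro add_mono) auto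
    finally have "2 * H \<le> \<bar>ln \<mu>\<bar> + 2 * K + \<bar>ln area_const\<bar> + \<bar>ln exp_const\<bar>" .
    moreover have "- 2 * H \<le> - ln \<mu> + 2 * K + 0 + ln exp_const" using 2 by simp
    then have "- 2 * H \<le> \<bar>ln \<mu>\<bar> + 2 * K + \<bar>ln area_const\<bar> + \<bar>ln exp_const\<bar>"
      by (rule order_trans) (intro add_mono; simp)
    ultimately show ?thesis by (cases "H \<ge> 0") simp_all
  qed
  then show ?thesis by (simp add: H_def \<mu>_def)
qed

text \<open>Only Re (G 0) escapes a uniform bound. It enters |u| additively and is itself bounded
  linearly in the logarithm of the area, so after the p-th root the whole norm is.\<close>

lemma W1p_norm_le:
  assumes p: "1 < p" "p < 2"
  defines "A \<equiv> exp_const + (K powr p + 4 * (m0 powr p * ((riesz_const p + pi) * (1/2) powr (2 - p))))"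
    and "l \<equiv> \<bar>ln (measure (area_measure (ball 0 1) u) (ball 0 (1/2)))\<bar>"
  shows "W1p_norm p (ball 0 (1/2)) u
    \<le> ennreal (4 * (A + 1) * (1 + 2 * K + \<bar>ln area_const\<bar> + \<bar>ln exp_const\<bar>) * (1 + l))"
proof -
  let ?B = "ball (0::complex) (1/2)"
  define H where "H = \<bar>Re (G 0)\<bar> + K"
  define c where "c = m0 powr p * ((riesz_const p + pi) * (1/2) powr (2 - p))"
  have H: "H \<ge> 0" using K_nonneg by (simp add: H_def)
  have c: "c \<ge> 0" by (simp add: c_def)
  have A: "A \<ge> 0" unfolding A_def c_def[symmetric] using c exp_const_pos by simp
  have pt: "\<bar>u z\<bar> powr p + norm (grad u z) powr p \<le> 4 * exp (2 * \<bar>log_pot z\<bar>) + 4 * (H powr p + K powr p) + 16 * riesz_pot z powr p"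
    if z: "norm z < 1/2" for z
  proof -
    have "\<bar>u z\<bar> \<le> \<bar>log_pot z\<bar> + H"
      using Re_G_near[OF z] rep[of z] z unfolding H_def by simp
    then have "\<bar>u z\<bar> powr p \<le> (\<bar>log_pot z\<bar> + H) powr p" using p by (intro powr_mono2) auto
    also have "\<dots> \<le> 4 * (\<bar>log_pot z\<bar> powr p + H powr p)" using p H by (intro powr_add_le) auto
    also have "\<dots> \<le> 4 * (exp (2 * \<bar>log_pot z\<bar>) + H powr p)"
      using p by (intro mult_left_mono add_right_mono powr_le_exp) auto
    finally have 1: "\<bar>u z\<bar> powr p \<le> 4 * (exp (2 * \<bar>log_pot z\<bar>) + H powr p)" .
    have "norm (grad u z) powr p \<le> (K + 2 * riesz_pot z) powr p"
      using norm_grad_u_le[OF z] p by (intro powr_mono2) auto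
    also have "\<dots> \<le> 4 * (K powr p + (2 * riesz_pot z) powr p)"
      using p K_nonneg riesz_pot_nonneg by (intro powr_add_le) auto
    also have "(2 * riesz_pot z) powr p = 2 powr p * riesz_pot z powr p"
      using riesz_pot_nonneg by (intro powr_mult)
    also have "\<dots> \<le> 4 * riesz_pot z powr p"
    proof (rule mult_right_mono)
      have "2 powr p \<le> 2 powr (2::real)" using p by (intro powr_mono) auto
      then show "2 powr p \<le> (4::real)" by simp
    qed simp
    finally have "norm (grad u z) powr p \<le> 4 * (K powr p + 4 * riesz_pot z powr p)" by simp
    with 1 show ?thesis by simp
  qed
  have "(\<integral>\<^sup>+x\<in>?B. ennreal (\<bar>u x\<bar> powr p + norm (grad u x) powr p) \<partial>lborel)
     \<le> (\<integral>\<^sup>+x. (4 * (ennreal (exp (2 * \<bar>log_pot x\<bar>)) * indicator (ball 0 1) x)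
         + ennreal (4 * (H powr p + K powr p)) * indicator ?B x)
         + 16 * (ennreal (riesz_pot x powr p) * indicator ?B x) \<partial>lborel)"
  proof (rule nn_integral_mono)
    fix z
    show "ennreal (\<bar>u z\<bar> powr p + norm (grad u z) powr p) * indicator ?B z
       \<le> (4 * (ennreal (exp (2 * \<bar>log_pot z\<bar>)) * indicator (ball 0 1) z)
         + ennreal (4 * (H powr p + K powr p)) * indicator ?B z)
         + 16 * (ennreal (riesz_pot z powr p) * indicator ?B z)"
    proof (cases "z \<in> ?B")
      case True
      then have "ennreal (\<bar>u z\<bar> powr p + norm (grad u z) powr p)
         \<le> ennreal (4 * exp (2 * \<bar>log_pot z\<bar>) + 4 * (H powr p + K powr p) + 16 * riesz_pot z powr p)"
        by (intro ennreal_leI pt) simp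
      also have "\<dots> = 4 * ennreal (exp (2 * \<bar>log_pot z\<bar>)) + ennreal (4 * (H powr p + K powr p)) + 16 * ennreal (riesz_pot z powr p)"
        by (simp add: ennreal_plus ennreal_mult' del: ennreal_plus[symmetric])
      finally show ?thesis using True by simp
    qed simp
  qed
  also have "\<dots> = (4 * (\<integral>\<^sup>+x\<in>ball 0 1. ennreal (exp (2 * \<bar>log_pot x\<bar>)) \<partial>lborel)
         + ennreal (4 * (H powr p + K powr p)) * emeasure lborel ?B)
         + 16 * (\<integral>\<^sup>+x\<in>?B. ennreal (riesz_pot x powr p) \<partial>lborel)"
    by (subst nn_integral_add, measurable)+ (simp add: nn_integral_cmult nn_integral_cmult_indicator)
  also have "\<dots> \<le> (4 * ennreal exp_const + ennreal (4 * (H powr p + K powr p)) * ennreal 1) + 16 * ennreal c"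
  proof (intro add_mono mult_left_mono)
    show "emeasure lborel ?B \<le> ennreal 1"
      using pi_less_4 by (simp add: emeasure_ball_complex power2_eq_square)
  qed (use riesz_pot_Lp[OF p] nn_integral_exp_abs_log_pot_unit in \<open>auto simp: c_def\<close>)
  also have "\<dots> = ennreal (4 * exp_const + 4 * (H powr p + K powr p) + 16 * c)"
    using exp_const_pos c by (simp add: ennreal_plus ennreal_mult')
  also have "4 * exp_const + 4 * (H powr p + K powr p) + 16 * c = 4 * (A + H powr p)"
    by (simp add: A_def c_def)
  finally have I: "(\<integral>\<^sup>+x\<in>?B. ennreal (\<bar>u x\<bar> powr p + norm (grad u x) powr p) \<partial>lborel) \<le> ennreal (4 * (A + H powr p))" .
  have "W1p_norm p ?B u \<le> ennreal ((4 * (A + H powr p)) powr (1 / p))"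
    unfolding W1p_norm_def using p A by (intro ennreal_powr_le I) auto
  also have "\<dots> \<le> ennreal (4 * (A + 1) * (1 + 2 * K + \<bar>ln area_const\<bar> + \<bar>ln exp_const\<bar>) * (1 + l))"
  proof (rule ennreal_leI)
    \<comment> \<open>4 (A + H^p) <= 4 (A + 1) w^p, and since 4 (A + 1) >= 1 its p-th root is at
      most itself; the norm is thus linear in w.\<close>
    define w where "w = 1 + H"
    have w: "w \<ge> 1" using H by (simp add: w_def)
    have "1 powr p \<le> w powr p" using w p by (intro powr_mono2) auto
    then have w1: "1 \<le> w powr p" by simp
    have "H powr p \<le> w powr p" using H p by (intro powr_mono2) (auto simp: w_def)
    moreover have "A * 1 \<le> A * w powr p" using w1 A by (intro mult_left_mono)
    ultimately have "4 * (A + H powr p) \<le> 4 * (A + 1) * w powr p" by (simp add: algebra_simps)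
    then have "(4 * (A + H powr p)) powr (1 / p) \<le> (4 * (A + 1) * w powr p) powr (1 / p)"
      using p A by (intro powr_mono2) auto
    also have "\<dots> = (4 * (A + 1)) powr (1 / p) * (w powr p) powr (1 / p)"
      using A by (intro powr_mult)
    also have "(w powr p) powr (1 / p) = w" using p w by (simp add: powr_powr)
    also have "(4 * (A + 1)) powr (1 / p) * w \<le> (4 * (A + 1)) powr 1 * w"
      using A p w by (intro mult_right_mono powr_mono) auto
    also have "\<dots> = 4 * (A + 1) * w" using A by simp
    also have "w \<le> (1 + 2 * K + \<bar>ln area_const\<bar> + \<bar>ln exp_const\<bar>) * (1 + l)"
    proof -
      define k where "k = 2 * K + \<bar>ln area_const\<bar> + \<bar>ln exp_const\<bar>"
      have k: "k \<ge> 0" "l \<ge> 0" using K_nonneg by (auto simp: k_def l_def)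
      have "2 * \<bar>Re (G 0)\<bar> \<le> l + k" using Re_G_0_le by (simp add: l_def k_def)
      then have "w \<le> 1 + k + l"
        using k K_nonneg unfolding w_def H_def k_def by linarith
      also have "\<dots> \<le> (1 + k) * (1 + l)" using k by (simp add: algebra_simps)
      finally show ?thesis by (simp add: k_def add.assoc)
    qed
    finally show "(4 * (A + H powr p)) powr (1 / p) \<le> 4 * (A + 1) * (1 + 2 * K + \<bar>ln area_const\<bar> + \<bar>ln exp_const\<bar>) * (1 + l)"
      using A by (simp add: mult.assoc)
  qed
  finally show ?thesis .
qed

end

section \<open>From the hypotheses on the metric to the decomposition\<close>

text \<open>Conformal invariance of the curvature measure: the factors exp (2 u) and exp (-2 u)
  cancel. The curvature hypothesis thus bounds the flat L^1 norm of the Laplacian.\<close>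

lemma nn_integral_gauss_curvature:
  assumes u: "Ck_on 2 u (ball 0 1)"
  shows "(\<integral>\<^sup>+z\<in>ball 0 1. ennreal \<bar>gauss_curvature u z\<bar> \<partial>area_measure (ball 0 1) u)
    = (\<integral>\<^sup>+z\<in>ball 0 1. ennreal \<bar>laplacian u z\<bar> \<partial>lborel)"
proof -
  let ?D = "ball (0::complex) 1"
  note uD = Ck_on_2D[OF u]
  have [measurable]: "(\<lambda>z. ennreal \<bar>gauss_curvature u z\<bar> * indicator ?D z) \<in> borel_measurable borel"
    unfolding gauss_curvature_def
    by (intro borel_measurable_ennreal_indicator continuous_intros uD) auto
  note [measurable] = area_density_measurable[OF uD(4)]
  have "(\<integral>\<^sup>+z\<in>?D. ennreal \<bar>gauss_curvature u z\<bar> \<partial>area_measure ?D u)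
     = (\<integral>\<^sup>+z. (ennreal (exp (2 * u z)) * indicator ?D z) * (ennreal \<bar>gauss_curvature u z\<bar> * indicator ?D z) \<partial>lborel)"
    unfolding area_measure_def by (rule nn_integral_density) auto
  also have "\<dots> = (\<integral>\<^sup>+z\<in>?D. ennreal \<bar>laplacian u z\<bar> \<partial>lborel)"
  proof (rule nn_integral_cong)
    fix z
    have "exp (2 * u z) * \<bar>gauss_curvature u z\<bar> = (exp (2 * u z) * exp (- (2 * u z))) * \<bar>laplacian u z\<bar>"
      by (simp add: gauss_curvature_def abs_mult)
    also have "\<dots> = \<bar>laplacian u z\<bar>" by (simp flip: exp_add)
    finally show "(ennreal (exp (2 * u z)) * indicator ?D z) * (ennreal \<bar>gauss_curvature u z\<bar> * indicator ?D z) = ennreal \<bar>laplacian u z\<bar> * indicator ?D z"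
      by (simp add: indicator_def flip: ennreal_mult)
  qed
  finally show ?thesis .
qed

text \<open>The charge is the cut-off Laplacian divided by \<open>cauchy_mass\<close>, whence the
  bound on \<epsilon>. For |z| < 1/2 the weight 3/4 - |z| is at least 1/4, which turns
  \<open>32 * R\<^sup>2\<close> into \<open>128 * R\<^sup>2\<close>.\<close>

lemma admissible_metric_decomposed:
  assumes adm: "admissible_metric \<Lambda> \<epsilon> u" and \<epsilon>: "\<epsilon> \<le> m0 * cauchy_mass" and m0: "m0 > 0"
    and N: "N \<ge> 1" "\<Lambda> * pi * 49 * dist_const\<^sup>2 * exp 6 \<le> real N * area_const * exp (-4)"
    and R: "R = real N + 2" "2 * m0 \<le> 1/2" "R powr (2 * m0) \<le> 2"
  obtains F G where "decomposed_metric F m0 u G (128 * R\<^sup>2)"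
proof -
  have u: "Ck_on 2 u (ball 0 1)" using adm by (simp add: admissible_metric_def smooth_on_def)
  note uD = Ck_on_2D[OF u]
  note M = cauchy_mass_pos
  obtain F G where FG: "continuous_on UNIV F" "\<And>x. norm x \<ge> 1 \<Longrightarrow> F x = 0"
    "\<And>x. \<bar>F x\<bar> \<le> \<bar>laplacian u x\<bar> / cauchy_mass"
    "G holomorphic_on ball 0 (7/8)"
    "\<And>z. norm z < 7/8 \<Longrightarrow> u z = (\<integral>x. F x * ln (norm (x - z)) \<partial>lborel) + Re (G z)"
    by (rule log_potential_representation[OF u]) blast
  have [measurable]: "(\<lambda>z. ennreal \<bar>laplacian u z\<bar> * indicator (ball 0 1) z) \<in> borel_measurable borel"
    by (intro borel_measurable_ennreal_indicator continuous_intros uD) auto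
  have "(\<integral>\<^sup>+x. ennreal \<bar>F x\<bar> \<partial>lborel) \<le> (\<integral>\<^sup>+x. ennreal (1 / cauchy_mass) * (ennreal \<bar>laplacian u x\<bar> * indicator (ball 0 1) x) \<partial>lborel)"
  proof (rule nn_integral_mono)
    fix x
    show "ennreal \<bar>F x\<bar> \<le> ennreal (1 / cauchy_mass) * (ennreal \<bar>laplacian u x\<bar> * indicator (ball 0 1) x)"
    proof (cases "norm x < 1")
      case True
      then show ?thesis using FG(3)[of x] M by (simp add: ennreal_leI flip: ennreal_mult)
    next
      case False
      then show ?thesis using FG(2)[of x] by simp
    qed
  qed
  also have "\<dots> = ennreal (1 / cauchy_mass) * (\<integral>\<^sup>+x\<in>ball 0 1. ennreal \<bar>laplacian u x\<bar> \<partial>lborel)"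
    by (rule nn_integral_cmult) measurable
  also have "\<dots> \<le> ennreal (1 / cauchy_mass) * ennreal (m0 * cauchy_mass)"
  proof (rule mult_left_mono)
    have "(\<integral>\<^sup>+x\<in>ball 0 1. ennreal \<bar>laplacian u x\<bar> \<partial>lborel) \<le> ennreal \<epsilon>"
      using adm unfolding admissible_metric_def nn_integral_gauss_curvature[OF u] by blast
    also have "\<dots> \<le> ennreal (m0 * cauchy_mass)" using \<epsilon> by (rule ennreal_leI)
    finally show "(\<integral>\<^sup>+x\<in>ball 0 1. ennreal \<bar>laplacian u x\<bar> \<partial>lborel) \<le> ennreal (m0 * cauchy_mass)" .
  qed simp
  also have "\<dots> = ennreal m0" using M m0 by (simp flip: ennreal_mult)
  finally interpret planar_charge F m0
    by unfold_locales (use FG m0 in auto)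
  have rep: "u z = log_pot z + Re (G z)" if "norm z < 7/8" for z
    using FG(5)[OF that] by (simp add: log_pot_def)
  have "decomposed_metric F m0 u G (128 * R\<^sup>2)"
  proof unfold_locales
    show "norm (deriv G z) \<le> 128 * R\<^sup>2" if z: "norm z < 1/2" for z
    proof -
      have "(3/4 - norm z) * norm (deriv G z) < 32 * R\<^sup>2"
      proof (rule holomorphic_part_bound[OF FG(4) uD(4) rep _ N R])
        show "emeasure (area_measure (ball 0 1) u) (geodesic_ball (ball 0 1) u w r) / ennreal (pi * r\<^sup>2) < ennreal \<Lambda>"
          if "r > 0" "w \<in> ball 0 (3/4)" for r w
          using adm that by (simp add: admissible_metric_def)
      qed (use z in auto)
      moreover have "1/4 * norm (deriv G z) \<le> (3/4 - norm z) * norm (deriv G z)"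
        using z by (intro mult_right_mono) auto
      ultimately show ?thesis by simp
    qed
  qed (use FG rep uD R in auto)
  then show ?thesis using that by blast
qed

theorem theorem1p2:
  fixes \<Lambda>\<^sub>1 :: real
  assumes "\<Lambda>\<^sub>1 > 0"
  shows "\<exists>\<epsilon>\<^sub>0. 0 < \<epsilon>\<^sub>0 \<and> \<epsilon>\<^sub>0 < 4 / 3 * pi \<and>
    (\<exists>C>0. \<forall>u. admissible_metric \<Lambda>\<^sub>1 \<epsilon>\<^sub>0 u \<longrightarrow>
       weak_Lp_norm 2 (ball 0 (1/2)) (grad u) < ennreal C) \<and>
    (\<forall>p. 1 < p \<and> p < 2 \<longrightarrow>
      (\<exists>C>0. \<forall>u. admissible_metric \<Lambda>\<^sub>1 \<epsilon>\<^sub>0 u \<longrightarrow>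
         W1p_norm p (ball 0 (1/2)) u
           \<le> ennreal (C * (1 + \<bar>ln (measure (area_measure (ball 0 1) u) (ball 0 (1/2)))\<bar>))))"
proof -
  \<comment> \<open>With at least x disks, the array would violate the area bound.\<close>
  define x where "x = \<Lambda>\<^sub>1 * pi * 49 * dist_const\<^sup>2 * exp 6 / (area_const * exp (-4))"
  obtain n :: nat where n: "x \<le> real n" using real_arch_simple by blast
  define N where "N = Suc n"
  have N1: "N \<ge> 1" by (simp add: N_def)
  have "x \<le> real N" using n by (simp add: N_def)
  then have N: "\<Lambda>\<^sub>1 * pi * 49 * dist_const\<^sup>2 * exp 6 \<le> real N * area_const * exp (-4)"
    using area_const_pos by (simp add: x_def divide_le_eq mult.assoc)
  define R where "R = real N + 2"
  have R: "R > 1" by (simp add: R_def)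
  \<comment> \<open>The 1/4 ensures 2 * m0 <= 1/2; the second entry is the solution of R powr (2 *
    m0) = 2.\<close>
  define m0 where "m0 = min (1/4) (ln 2 / (2 * ln R))"
  have m0: "m0 > 0" "2 * m0 \<le> 1/2" using R by (auto simp: m0_def)
  have "m0 \<le> ln 2 / (2 * ln R)" by (simp add: m0_def)
  then have "2 * m0 * ln R \<le> ln 2" using R by (simp add: field_simps)
  then have "exp (2 * m0 * ln R) \<le> exp (ln 2)" by (subst exp_le_cancel_iff)
  then have Rm0: "R powr (2 * m0) \<le> 2" using R by (simp add: powr_def)
  \<comment> \<open>The 1 keeps \<epsilon> below 4 \<pi> / 3.\<close>
  define \<epsilon> where "\<epsilon> = min 1 (m0 * cauchy_mass)"
  have \<epsilon>: "0 < \<epsilon>" "\<epsilon> < 4 / 3 * pi" "\<epsilon> \<le> m0 * cauchy_mass"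
    using m0 cauchy_mass_pos pi_gt3 by (auto simp: \<epsilon>_def)
  define K where "K = 128 * R\<^sup>2"
  have K: "K \<ge> 0" by (simp add: K_def)
  have decomposed: "\<exists>F G. decomposed_metric F m0 u G K" if "admissible_metric \<Lambda>\<^sub>1 \<epsilon> u" for u
    unfolding K_def using admissible_metric_decomposed[OF that \<epsilon>(3) m0(1) N1 N R_def m0(2) Rm0] by blast
  \<comment> \<open>The summand 1 makes the inequality strict.\<close>
  define C1 where "C1 = 2 * K + 4 * (m0 * (riesz_const 1 + 1)) + 1"
  have C1: "0 \<le> 2 * K + 4 * (m0 * (riesz_const 1 + 1))" using K m0 by (simp add: add_nonneg_nonneg)
  have weak: "weak_Lp_norm 2 (ball 0 (1/2)) (grad u) < ennreal C1" if adm: "admissible_metric \<Lambda>\<^sub>1 \<epsilon> u" for u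
  proof -
    obtain F G where "decomposed_metric F m0 u G K" using decomposed[OF adm] by blast
    then interpret decomposed_metric F m0 u G K .
    have "weak_Lp_norm 2 (ball 0 (1/2)) (grad u) \<le> ennreal (2 * K + 4 * (m0 * (riesz_const 1 + 1)))"
      by (rule weak_L2_grad_le)
    also have "\<dots> < ennreal C1" using C1 by (simp add: C1_def ennreal_less_iff)
    finally show ?thesis .
  qed
  have W1p: "\<exists>C>0. \<forall>u. admissible_metric \<Lambda>\<^sub>1 \<epsilon> u \<longrightarrow>
         W1p_norm p (ball 0 (1/2)) u
           \<le> ennreal (C * (1 + \<bar>ln (measure (area_measure (ball 0 1) u) (ball 0 (1/2)))\<bar>))"
    if p: "1 < p" "p < 2" for p
  proof -
    define A where "A = exp_const + (K powr p + 4 * (m0 powr p * ((riesz_const p + pi) * (1/2) powr (2 - p))))"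
    define C where "C = 4 * (A + 1) * (1 + 2 * K + \<bar>ln area_const\<bar> + \<bar>ln exp_const\<bar>)"
    have "A \<ge> 0" unfolding A_def using exp_const_pos by (intro add_nonneg_nonneg mult_nonneg_nonneg) auto
    then have "C > 0" unfolding C_def using K by (intro mult_pos_pos) auto
    moreover have "W1p_norm p (ball 0 (1/2)) u
           \<le> ennreal (C * (1 + \<bar>ln (measure (area_measure (ball 0 1) u) (ball 0 (1/2)))\<bar>))"
      if adm: "admissible_metric \<Lambda>\<^sub>1 \<epsilon> u" for u
    proof -
      obtain F G where "decomposed_metric F m0 u G K" using decomposed[OF adm] by blast
      then interpret decomposed_metric F m0 u G K .
      show ?thesis using W1p_norm_le[OF p] by (simp add: C_def A_def)
    qed
    ultimately show ?thesis by blast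
  qed
  have "C1 > 0" using C1 by (simp add: C1_def)
  then have "\<exists>C>0. \<forall>u. admissible_metric \<Lambda>\<^sub>1 \<epsilon> u \<longrightarrow> weak_Lp_norm 2 (ball 0 (1/2)) (grad u) < ennreal C"
    using weak by blast
  with \<epsilon>(1,2) W1p show ?thesis by blast
qed

end
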